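(* Let $\mathsf{T}$ be a compactly generated triangulated category with a single compact generator $G$ such that $\operatorname{Hom}_{\mathsf{T}}(\Sigma^{-i}G,G)=0$ for all $i\gg 0$. If $\langle \mathsf{A},\mathsf{B}\rangle$ is a semiorthogonal decomposition of the category of compact objects $\mathsf{T}^c$, then $\langle \operatorname{Coprod}(\mathsf{A})\cap\mathsf{T}^-_c,\ \operatorname{Coprod}(\mathsf{B})\cap\mathsf{T}^-_c\rangle$ is a semiorthogonal decomposition of $\mathsf{T}^-_c$. If $\mathsf{B}$ is further assumed to be admissible in $\mathsf{T}^c$, then $\langle \operatorname{Coprod}(\mathsf{A})\cap{}^{\mathrm{I}}\mathsf{T}^b_c,\ \operatorname{Coprod}(\mathsf{B})\cap{}^{\mathrm{I}}\mathsf{T}^b_c\rangle$ is a semiorthogonal decomposition of ${}^{\mathrm{I}}\mathsf{T}^b_c$.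
   Context: $\Sigma$ is the shift functor. A semiorthogonal decomposition $\langle \mathsf{A},\mathsf{B}\rangle$ of a triangulated category $\mathsf{S}$ is a pair of strictly full triangulated subcategories with $\operatorname{Hom}(\mathsf{B},\mathsf{A})=0$ such that the smallest triangulated subcategory containing $\mathsf{A}\cup\mathsf{B}$ is $\mathsf{S}$. A strictly full triangulated subcategory is admissible if its inclusion has both adjoints. $\operatorname{Coprod}(\mathsf{C})$ is the closure of $\mathsf{C}$ under coproducts and extensions in $\mathsf{T}$; for $\mathsf{C}=\Sigma\mathsf{C}$ it is the localising subcategory generated by $\mathsf{C}$. Let ${}^{\mathrm{I}}\mathsf{T}_G^{\le 0}=\operatorname{Coprod}(\{\Sigma^iG: i\ge 0\})$ be the aisle of the t-structure on $\mathsf{T}$ generated by $G$, and ${}^{\mathrm{I}}\mathsf{T}_G^{\le -n}=\Sigma^{n}\,{}^{\mathrm{I}}\mathsf{T}_G^{\le 0}$. Then $\mathsf{T}^-_c$ is the full subcategory of $\mathsf{T}$ of objects $F$ such that for every $n\in\mathbb{Z}$ there is a triangle $E_n\to F\to D_n\to\Sigma E_n$ with $E_n\in\mathsf{T}^c$ and $D_n\in{}^{\mathrm{I}}\mathsf{T}_G^{\le -n}$. Moreover ${}^{\mathrm{I}}\mathsf{T}^b_c=\{F\in\mathsf{T}^-_c:\operatorname{Hom}_{\mathsf{T}}(\Sigma^iG,F)=0\text{ for } i\gg 0\}$. *)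

theory Defs
  imports "HOL-Algebra.Free_Abelian_Groups"
begin

unbundle cardinal_syntax

record ('o, 'm) cat =
  Obj :: "'o set"
  Arr :: "'m set"
  src :: "'m \<Rightarrow> 'o"
  tgt :: "'m \<Rightarrow> 'o"
  ident :: "'o \<Rightarrow> 'm"
  cmp :: "'m \<Rightarrow> 'm \<Rightarrow> 'm"  (infixr "\<cdot>\<index>" 70)

definition Hom :: "('o, 'm, 'z) cat_scheme \<Rightarrow> 'o \<Rightarrow> 'o \<Rightarrow> 'm set" where
  "Hom C X Y = {f \<in> Arr C. src C f = X \<and> tgt C f = Y}"

locale category =
  fixes C :: "('o, 'm, 'z) cat_scheme" (structure)
  assumes src_obj: "f \<in> Arr C \<Longrightarrow> src C f \<in> Obj C"
    and tgt_obj: "f \<in> Arr C \<Longrightarrow> tgt C f \<in> Obj C"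
    and ident_hom: "X \<in> Obj C \<Longrightarrow> ident C X \<in> Hom C X X"
    and cmp_hom: "\<lbrakk>f \<in> Hom C X Y; g \<in> Hom C Y Z\<rbrakk> \<Longrightarrow> g \<cdot> f \<in> Hom C X Z"
    and cmp_ident_right: "f \<in> Hom C X Y \<Longrightarrow> f \<cdot> ident C X = f"
    and cmp_ident_left: "f \<in> Hom C X Y \<Longrightarrow> ident C Y \<cdot> f = f"
    and cmp_assoc: "\<lbrakk>f \<in> Hom C W X; g \<in> Hom C X Y; h \<in> Hom C Y Z\<rbrakk>
      \<Longrightarrow> (h \<cdot> g) \<cdot> f = h \<cdot> (g \<cdot> f)"

definition is_iso :: "('o, 'm, 'z) cat_scheme \<Rightarrow> 'o \<Rightarrow> 'o \<Rightarrow> 'm \<Rightarrow> bool" where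
  "is_iso C X Y f \<longleftrightarrow> f \<in> Hom C X Y \<and>
     (\<exists>g \<in> Hom C Y X. g \<cdot>\<^bsub>C\<^esub> f = ident C X \<and> f \<cdot>\<^bsub>C\<^esub> g = ident C Y)"

definition isomorphic :: "('o, 'm, 'z) cat_scheme \<Rightarrow> 'o \<Rightarrow> 'o \<Rightarrow> bool" where
  "isomorphic C X Y \<longleftrightarrow> (\<exists>f. is_iso C X Y f)"

definition zero_object :: "('o, 'm, 'z) cat_scheme \<Rightarrow> 'o \<Rightarrow> bool" where
  "zero_object C Z \<longleftrightarrow> Z \<in> Obj C \<and>
     (\<forall>X \<in> Obj C. (\<exists>!f. f \<in> Hom C Z X) \<and> (\<exists>!f. f \<in> Hom C X Z))"

definition is_coproduct ::
  "('o, 'm, 'z) cat_scheme \<Rightarrow> 'i set \<Rightarrow> ('i \<Rightarrow> 'o) \<Rightarrow> 'o \<Rightarrow> ('i \<Rightarrow> 'm) \<Rightarrow> bool" where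
  "is_coproduct C I X P \<iota> \<longleftrightarrow> P \<in> Obj C \<and> (\<forall>i \<in> I. \<iota> i \<in> Hom C (X i) P) \<and>
     (\<forall>Q \<in> Obj C. \<forall>f. (\<forall>i \<in> I. f i \<in> Hom C (X i) Q) \<longrightarrow>
        (\<exists>!h. h \<in> Hom C P Q \<and> (\<forall>i \<in> I. h \<cdot>\<^bsub>C\<^esub> \<iota> i = f i)))"

definition is_functor ::
  "('o, 'm, 'z) cat_scheme \<Rightarrow> ('p, 'n, 'y) cat_scheme \<Rightarrow> ('o \<Rightarrow> 'p) \<Rightarrow> ('m \<Rightarrow> 'n) \<Rightarrow> bool" where
  "is_functor C D Fo Fa \<longleftrightarrow>
     (\<forall>X \<in> Obj C. Fo X \<in> Obj D \<and> Fa (ident C X) = ident D (Fo X)) \<and>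
     (\<forall>X Y f. f \<in> Hom C X Y \<longrightarrow> Fa f \<in> Hom D (Fo X) (Fo Y)) \<and>
     (\<forall>X Y Z f g. f \<in> Hom C X Y \<and> g \<in> Hom C Y Z \<longrightarrow> Fa (g \<cdot>\<^bsub>C\<^esub> f) = Fa g \<cdot>\<^bsub>D\<^esub> Fa f)"

text \<open>The functor \<open>F : C \<rightarrow> D\<close> is left adjoint to \<open>G : D \<rightarrow> C\<close>.\<close>

definition adjunction ::
  "('o, 'm, 'z) cat_scheme \<Rightarrow> ('p, 'n, 'y) cat_scheme \<Rightarrow>
    ('o \<Rightarrow> 'p) \<Rightarrow> ('m \<Rightarrow> 'n) \<Rightarrow> ('p \<Rightarrow> 'o) \<Rightarrow> ('n \<Rightarrow> 'm) \<Rightarrow> bool" where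
  "adjunction C D Fo Fa Go Ga \<longleftrightarrow> is_functor C D Fo Fa \<and> is_functor D C Go Ga \<and>
     (\<exists>\<phi>. (\<forall>X \<in> Obj C. \<forall>Y \<in> Obj D. bij_betw (\<phi> X Y) (Hom D (Fo X) Y) (Hom C X (Go Y))) \<and>
          (\<forall>X X' Y Y' f g h. f \<in> Hom C X' X \<and> g \<in> Hom D Y Y' \<and> h \<in> Hom D (Fo X) Y \<longrightarrow>
             \<phi> X' Y' (g \<cdot>\<^bsub>D\<^esub> h \<cdot>\<^bsub>D\<^esub> Fa f) = Ga g \<cdot>\<^bsub>C\<^esub> \<phi> X Y h \<cdot>\<^bsub>C\<^esub> f))"

definition has_left_adjoint ::
  "('o, 'm, 'z) cat_scheme \<Rightarrow> ('p, 'n, 'y) cat_scheme \<Rightarrow> ('o \<Rightarrow> 'p) \<Rightarrow> ('m \<Rightarrow> 'n) \<Rightarrow> bool" where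
  "has_left_adjoint C D Fo Fa \<longleftrightarrow> (\<exists>Lo La. adjunction D C Lo La Fo Fa)"

definition has_right_adjoint ::
  "('o, 'm, 'z) cat_scheme \<Rightarrow> ('p, 'n, 'y) cat_scheme \<Rightarrow> ('o \<Rightarrow> 'p) \<Rightarrow> ('m \<Rightarrow> 'n) \<Rightarrow> bool" where
  "has_right_adjoint C D Fo Fa \<longleftrightarrow> (\<exists>Ro Ra. adjunction C D Fo Fa Ro Ra)"

record ('o, 'm) tcat = "('o, 'm) cat" +
  hadd :: "'m \<Rightarrow> 'm \<Rightarrow> 'm"
  hzero :: "'o \<Rightarrow> 'o \<Rightarrow> 'm"
  shO :: "'o \<Rightarrow> 'o"
  shA :: "'m \<Rightarrow> 'm"
  distinguished :: "('m \<times> 'm \<times> 'm) set"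

definition hom_group :: "('o, 'm, 'z) tcat_scheme \<Rightarrow> 'o \<Rightarrow> 'o \<Rightarrow> 'm monoid" where
  "hom_group T X Y = \<lparr>carrier = Hom T X Y, mult = hadd T, one = hzero T X Y\<rparr>"

text \<open>Only the members of \<open>distinguished T\<close> that fit together as
  \<open>X \<rightarrow> Y \<rightarrow> Z \<rightarrow> \<Sigma>X\<close> in \<open>T\<close> matter. A full subcategory can therefore keep this field
  unchanged.\<close>

definition dist_tri ::
  "('o, 'm, 'z) tcat_scheme \<Rightarrow> 'o \<Rightarrow> 'o \<Rightarrow> 'o \<Rightarrow> 'm \<Rightarrow> 'm \<Rightarrow> 'm \<Rightarrow> bool" where
  "dist_tri T X Y Z u v w \<longleftrightarrow>
     u \<in> Hom T X Y \<and> v \<in> Hom T Y Z \<and> w \<in> Hom T Z (shO T X) \<and> (u, v, w) \<in> distinguished T"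

locale additive_category = category C
  for C :: "('o, 'm, 'z) tcat_scheme" (structure) +
  assumes hom_comm_group: "\<lbrakk>X \<in> Obj C; Y \<in> Obj C\<rbrakk> \<Longrightarrow> comm_group (hom_group C X Y)"
    and cmp_add_right: "\<lbrakk>f \<in> Hom C X Y; f' \<in> Hom C X Y; g \<in> Hom C Y Z\<rbrakk>
      \<Longrightarrow> g \<cdot> hadd C f f' = hadd C (g \<cdot> f) (g \<cdot> f')"
    and cmp_add_left: "\<lbrakk>f \<in> Hom C X Y; g \<in> Hom C Y Z; g' \<in> Hom C Y Z\<rbrakk>
      \<Longrightarrow> hadd C g g' \<cdot> f = hadd C (g \<cdot> f) (g' \<cdot> f)"
    and ex_zero_object: "\<exists>Z. zero_object C Z"
    and ex_binary_coproduct: "\<lbrakk>X \<in> Obj C; Y \<in> Obj C\<rbrakk>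
      \<Longrightarrow> \<exists>P \<iota>. is_coproduct C (UNIV :: bool set) (\<lambda>b. if b then X else Y) P \<iota>"

text \<open>The shift is an additive autoequivalence, not necessarily an automorphism.\<close>

locale triangulated_category = additive_category T
  for T :: "('o, 'm, 'z) tcat_scheme" (structure) +
  assumes shift_functor: "is_functor T T (shO T) (shA T)"
    and shift_additive: "\<lbrakk>f \<in> Hom T X Y; g \<in> Hom T X Y\<rbrakk>
      \<Longrightarrow> shA T (hadd T f g) = hadd T (shA T f) (shA T g)"
    and shift_fully_faithful: "\<lbrakk>X \<in> Obj T; Y \<in> Obj T\<rbrakk>
      \<Longrightarrow> bij_betw (shA T) (Hom T X Y) (Hom T (shO T X) (shO T Y))"
    and shift_ess_surj: "Y \<in> Obj T \<Longrightarrow> \<exists>X \<in> Obj T. isomorphic T (shO T X) Y"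
    and tri_iso_closed: "\<lbrakk>dist_tri T X Y Z u v w;
        u' \<in> Hom T X' Y'; v' \<in> Hom T Y' Z'; w' \<in> Hom T Z' (shO T X');
        is_iso T X X' a; is_iso T Y Y' b; is_iso T Z Z' c;
        b \<cdot> u = u' \<cdot> a; c \<cdot> v = v' \<cdot> b; shA T a \<cdot> w = w' \<cdot> c\<rbrakk>
      \<Longrightarrow> dist_tri T X' Y' Z' u' v' w'"
    and tri_ident: "\<lbrakk>X \<in> Obj T; zero_object T Z\<rbrakk>
      \<Longrightarrow> dist_tri T X X Z (ident T X) (hzero T X Z) (hzero T Z (shO T X))"
    and tri_complete: "u \<in> Hom T X Y \<Longrightarrow> \<exists>Z v w. dist_tri T X Y Z u v w"
    and tri_rotate: "\<lbrakk>u \<in> Hom T X Y; v \<in> Hom T Y Z; w \<in> Hom T Z (shO T X)\<rbrakk>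
      \<Longrightarrow> dist_tri T X Y Z u v w \<longleftrightarrow>
          dist_tri T Y Z (shO T X) v w (inv\<^bsub>hom_group T (shO T X) (shO T Y)\<^esub> (shA T u))"
    and tri_morphism: "\<lbrakk>dist_tri T X Y Z u v w; dist_tri T X' Y' Z' u' v' w';
        a \<in> Hom T X X'; b \<in> Hom T Y Y'; b \<cdot> u = u' \<cdot> a\<rbrakk>
      \<Longrightarrow> \<exists>c \<in> Hom T Z Z'. c \<cdot> v = v' \<cdot> b \<and> shA T a \<cdot> w = w' \<cdot> c"
    and octahedral: "\<lbrakk>dist_tri T X Y Z' u i i'; dist_tri T Y Z X' v j j';
        dist_tri T X Z Y' (v \<cdot> u) k k'\<rbrakk>
      \<Longrightarrow> \<exists>f g. dist_tri T Z' Y' X' f g (shA T i \<cdot> j') \<and>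
            f \<cdot> i = k \<cdot> v \<and> k' \<cdot> f = i' \<and> g \<cdot> k = j \<and> shA T u \<cdot> k' = j' \<cdot> g"

definition full_subcategory ::
  "('o, 'm, 'z) tcat_scheme \<Rightarrow> 'o set \<Rightarrow> ('o, 'm, 'z) tcat_scheme" where
  "full_subcategory T A = T\<lparr>Obj := A, Arr := {f \<in> Arr T. src T f \<in> A \<and> tgt T f \<in> A}\<rparr>"

text \<open>Full subcategories are represented by their sets of objects; strictly full means
  closed under isomorphism.\<close>

definition triangulated_subcategory :: "('o, 'm, 'z) tcat_scheme \<Rightarrow> 'o set \<Rightarrow> bool" where
  "triangulated_subcategory S A \<longleftrightarrow> A \<subseteq> Obj S \<and>
     (\<forall>Z. zero_object S Z \<longrightarrow> Z \<in> A) \<and>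
     (\<forall>X \<in> A. \<forall>Y. isomorphic S X Y \<longrightarrow> Y \<in> A) \<and>
     (\<forall>X \<in> Obj S. shO S X \<in> A \<longleftrightarrow> X \<in> A) \<and>
     (\<forall>X Y Z u v w. dist_tri S X Y Z u v w \<and> X \<in> A \<and> Y \<in> A \<longrightarrow> Z \<in> A)"

definition triangulated_hull :: "('o, 'm, 'z) tcat_scheme \<Rightarrow> 'o set \<Rightarrow> 'o set" where
  "triangulated_hull S C = \<Inter> {D. triangulated_subcategory S D \<and> C \<subseteq> D}"

definition semiorthogonal_decomposition ::
  "('o, 'm, 'z) tcat_scheme \<Rightarrow> 'o set \<Rightarrow> 'o set \<Rightarrow> bool" where
  "semiorthogonal_decomposition S A B \<longleftrightarrow> triangulated_category S \<and>
     triangulated_subcategory S A \<and> triangulated_subcategory S B \<and>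
     (\<forall>X \<in> B. \<forall>Y \<in> A. Hom S X Y = {hzero S X Y}) \<and>
     triangulated_hull S (A \<union> B) = Obj S"

definition admissible :: "('o, 'm, 'z) tcat_scheme \<Rightarrow> 'o set \<Rightarrow> bool" where
  "admissible S B \<longleftrightarrow> triangulated_subcategory S B \<and>
     has_left_adjoint (full_subcategory S B) S id id \<and>
     has_right_adjoint (full_subcategory S B) S id id"

text \<open>The \<open>i\<close>-fold shift of an object. For negative \<open>i\<close> it is only determined up to isomorphism,
  because the shift is only an autoequivalence.\<close>

definition desuspension :: "('o, 'm, 'z) tcat_scheme \<Rightarrow> 'o \<Rightarrow> 'o" where
  "desuspension T X = (SOME Y. Y \<in> Obj T \<and> isomorphic T (shO T Y) X)"

definition shift_pow :: "('o, 'm, 'z) tcat_scheme \<Rightarrow> int \<Rightarrow> 'o \<Rightarrow> 'o" where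
  "shift_pow T i X =
     (if 0 \<le> i then (shO T ^^ nat i) X else (desuspension T ^^ nat (- i)) X)"

text \<open>A set is small if its cardinality is below a fixed uncountable regular cardinal \<open>\<kappa>\<close>.
  Taking \<open>\<kappa>\<close> to be the cardinality of a Grothendieck universe gives the usual
  meaning of smallness. A small set of any type is in bijection with a subset of
  \<open>Field \<kappa>\<close>, so families indexed by sets of elements of \<open>'u\<close> suffice.\<close>

definition smallness_cardinal :: "'u rel \<Rightarrow> bool" where
  "smallness_cardinal \<kappa> \<longleftrightarrow> Card_order \<kappa> \<and> natLeq <o \<kappa> \<and> regularCard \<kappa>"

definition has_small_coproducts :: "'u rel \<Rightarrow> ('o, 'm, 'z) cat_scheme \<Rightarrow> bool" where
  "has_small_coproducts \<kappa> T \<longleftrightarrow> (\<forall>(I :: 'u set) X. |I| <o \<kappa> \<and> (\<forall>i \<in> I. X i \<in> Obj T) \<longrightarrow>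
     (\<exists>P \<iota>. is_coproduct T I X P \<iota>))"

text \<open>The canonical map \<open>\<Oplus>\<^sub>i Hom(C, X\<^sub>i) \<rightarrow> Hom(C, \<Coprod>\<^sub>i X\<^sub>i)\<close> is an isomorphism. Group operations
  in \<open>hom_group\<close> are written multiplicatively in the library, so \<open>gfinprod\<close> is the finite sum
  over the support.\<close>

definition compact_objects :: "'u rel \<Rightarrow> ('o, 'm, 'z) tcat_scheme \<Rightarrow> 'o set" where
  "compact_objects \<kappa> T = {C \<in> Obj T. \<forall>(I :: 'u set) X P \<iota>.
     |I| <o \<kappa> \<and> is_coproduct T I X P \<iota> \<longrightarrow>
       (\<lambda>x. gfinprod (hom_group T C P) (\<lambda>i. \<iota> i \<cdot>\<^bsub>T\<^esub> x i) I)
         \<in> iso (sum_group I (\<lambda>i. hom_group T C (X i))) (hom_group T C P)}"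

text \<open>In place of local smallness we only ask that morphisms out of compact objects form small
  sets. This is weaker: if all \<open>Hom\<close>-sets were required to be small, then a nonzero \<open>T\<close> with
  small coproducts would force \<open>\<kappa>\<close> to be strongly inaccessible.\<close>

definition compactly_generated_by ::
  "'u rel \<Rightarrow> ('o, 'm, 'z) tcat_scheme \<Rightarrow> 'o set \<Rightarrow> bool" where
  "compactly_generated_by \<kappa> T \<G> \<longleftrightarrow> triangulated_category T \<and> has_small_coproducts \<kappa> T \<and>
     (\<forall>C \<in> compact_objects \<kappa> T. \<forall>X \<in> Obj T. |Hom T C X| <o \<kappa>) \<and>
     |\<G>| <o \<kappa> \<and> \<G> \<subseteq> compact_objects \<kappa> T \<and>
     (\<forall>X \<in> Obj T. (\<forall>G \<in> \<G>. \<forall>i. Hom T (shift_pow T i G) X = {hzero T (shift_pow T i G) X})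
        \<longrightarrow> zero_object T X)"

definition Coprod :: "'u rel \<Rightarrow> ('o, 'm, 'z) tcat_scheme \<Rightarrow> 'o set \<Rightarrow> 'o set" where
  "Coprod \<kappa> T C = \<Inter> {S. C \<subseteq> S \<and> S \<subseteq> Obj T \<and>
     (\<forall>(I :: 'u set) X P \<iota>. |I| <o \<kappa> \<and> (\<forall>i \<in> I. X i \<in> S) \<and> is_coproduct T I X P \<iota> \<longrightarrow> P \<in> S) \<and>
     (\<forall>X Y Z u v w. dist_tri T X Y Z u v w \<and> X \<in> S \<and> Z \<in> S \<longrightarrow> Y \<in> S)}"

text \<open>\<open>aisle \<kappa> T G m\<close> is \<open>T\<^sub>G\<^sup>\<le>\<^sup>m\<close>, the replete image of \<open>T\<^sub>G\<^sup>\<le>\<^sup>0\<close> under \<open>\<Sigma>\<^sup>-\<^sup>m\<close>.\<close>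

definition aisle :: "'u rel \<Rightarrow> ('o, 'm, 'z) tcat_scheme \<Rightarrow> 'o \<Rightarrow> int \<Rightarrow> 'o set" where
  "aisle \<kappa> T G m = {X \<in> Obj T. \<exists>Y \<in> Coprod \<kappa> T {shift_pow T i G | i. 0 \<le> i}.
     isomorphic T X (shift_pow T (- m) Y)}"

definition Tc_minus :: "'u rel \<Rightarrow> ('o, 'm, 'z) tcat_scheme \<Rightarrow> 'o \<Rightarrow> 'o set" where
  "Tc_minus \<kappa> T G = {F \<in> Obj T. \<forall>n :: int. \<exists>E D u v w. dist_tri T E F D u v w \<and>
     E \<in> compact_objects \<kappa> T \<and> D \<in> aisle \<kappa> T G (- n)}"

definition Tc_bounded :: "'u rel \<Rightarrow> ('o, 'm, 'z) tcat_scheme \<Rightarrow> 'o \<Rightarrow> 'o set" where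
  "Tc_bounded \<kappa> T G = {F \<in> Tc_minus \<kappa> T G.
     \<exists>N :: int. \<forall>i \<ge> N. Hom T (shift_pow T i G) F = {hzero T (shift_pow T i G) F}}"

end

theory Submission
  imports Defs
begin

text \<open>Write \<open>b * a\<close> for the class of extensions of \<open>a\<close> by \<open>b\<close>. Since \<open>*\<close> is associative and
  \<open>a * b \<subseteq> b * a\<close> whenever the connecting maps \<open>b \<rightarrow> \<Sigma>a\<close> vanish, \<open>Coprod B * Coprod A\<close> is closed under
  extensions and coproducts, so it contains the aisles as well as the compact objects, hence
  all of \<open>T\<^sup>-\<^sub>c\<close>. To see that both parts of an object of \<open>T\<^sup>-\<^sub>c\<close> lie in \<open>T\<^sup>-\<^sub>c\<close> again, decompose a
  compact approximation and the remainder in a deep aisle separately and recombine them, using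
  uniqueness of the decomposition. This needs that compact objects are bounded above, and closure of
  \<open>T\<^sup>-\<^sub>c\<close> under extensions needs that they admit no maps to deep aisles; both hold because a
  compact object is a retract of one built from the shifts \<open>\<Sigma>\<^sup>jG\<close> with \<open>|j| \<le> n\<close>.

  For admissible \<open>B\<close>, let \<open>\<lambda>G\<close> be the reflection of \<open>G\<close> in \<open>B\<close>. The fibre of \<open>G \<rightarrow> \<lambda>G\<close> is orthogonal to
  \<open>Coprod B\<close>, so maps from \<open>\<Sigma>\<^sup>iG\<close> to the \<open>B\<close>-part of \<open>F\<close> are maps \<open>\<Sigma>\<^sup>i\<lambda>G \<rightarrow> F\<close>, which vanish for
  large \<open>i\<close> because \<open>\<lambda>G\<close> is compact.\<close>

subsection \<open>Additive categories\<close>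

text \<open>The shift is only an autoequivalence, so negative shifts are choices and identities
  between shifts hold only up to isomorphism. Triangles are therefore mostly handled through the
  relation \<open>ext\<close>, which forgets the three maps: it is invariant under isomorphism and
  under rotation, and signs disappear from it. Associativity of \<open>*\<close> is the octahedral
  axiom, used in both directions.

  Decomposing an object built from the shifts with exponent at least \<open>n + c\<close> yields
  parts built from exponents at least \<open>n\<close>. The loss \<open>c\<close> does not depend on
  \<open>n\<close>: it measures how far the two parts of \<open>G\<close> reach, and they are
  compact, hence bounded above. An approximation of depth \<open>n\<close> decomposes an object in a
  way that depends on \<open>n\<close>, whereas membership in \<open>Tcm\<close> asks for
  approximations of one object at all depths; uniqueness of the decomposition closes this gap.

  Compact objects are reached only as retracts. A swindle absorbs retracts into classes stable under
  the shift, which covers half-infinite ranges of exponents; for two-sided ranges orthogonality is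
  passed to the retract directly.\<close>

context category begin

lemma Hom_objD: "f \<in> Hom C X Y \<Longrightarrow> X \<in> Obj C" "f \<in> Hom C X Y \<Longrightarrow> Y \<in> Obj C"
  using src_obj tgt_obj by (auto simp: Hom_def)

text \<open>The rewrite rules speak of \<open>Arr\<close>, \<open>src\<close> and
  \<open>tgt\<close>, so that unfolding \<open>Hom_def\<close> turns every typing condition into
  equations which simplification can discharge.\<close>

lemma ident_simps [simp]:
  assumes "X \<in> Obj C"
  shows "ident C X \<in> Arr C" "src C (ident C X) = X" "tgt C (ident C X) = X"
  using ident_hom[OF assms] by (auto simp: Hom_def)

lemma cmp_simps [simp]:
  assumes "f \<in> Arr C" "g \<in> Arr C" "tgt C f = src C g"
  shows "g \<cdot> f \<in> Arr C" "src C (g \<cdot> f) = src C f" "tgt C (g \<cdot> f) = tgt C g"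
  using cmp_hom[of f "src C f" "src C g" g "tgt C g"] assms by (auto simp: Hom_def)

lemma arr_obj [simp]: "f \<in> Arr C \<Longrightarrow> src C f \<in> Obj C" "f \<in> Arr C \<Longrightarrow> tgt C f \<in> Obj C"
  using src_obj tgt_obj by auto

lemma cmp_ident [simp]:
  "f \<in> Arr C \<Longrightarrow> src C f = X \<Longrightarrow> f \<cdot> ident C X = f"
  "f \<in> Arr C \<Longrightarrow> tgt C f = X \<Longrightarrow> ident C X \<cdot> f = f"
  using cmp_ident_right[of f X "tgt C f"] cmp_ident_left[of f "src C f" X] by (auto simp: Hom_def)

lemma cmp_assoc_arr [simp]:
  assumes "f \<in> Arr C" "g \<in> Arr C" "h \<in> Arr C" "tgt C f = src C g" "tgt C g = src C h"
  shows "(h \<cdot> g) \<cdot> f = h \<cdot> (g \<cdot> f)"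
  using cmp_assoc[of f "src C f" "src C g" g "src C h" h "tgt C h"] assms by (auto simp: Hom_def)

text \<open>Composites are normalised to the right, where an equation for \<open>g \<cdot> f\<close>
  no longer matches; this form applies it inside a longer composite.\<close>

lemma cmp_cong:
  assumes "g \<cdot> f = k" "e \<in> Arr C" "f \<in> Arr C" "g \<in> Arr C" "tgt C e = src C f" "tgt C f = src C g"
  shows "g \<cdot> (f \<cdot> e) = k \<cdot> e"
  using assms cmp_assoc_arr by metis

lemma is_iso_sym:
  assumes "is_iso C X Y f"
  obtains g where "is_iso C Y X g" "g \<cdot> f = ident C X" "f \<cdot> g = ident C Y"
  using assms unfolding is_iso_def by blast

lemma is_iso_ident: "X \<in> Obj C \<Longrightarrow> is_iso C X X (ident C X)"
  unfolding is_iso_def by (auto simp: Hom_def intro!: bexI[of _ "ident C X"])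

lemma is_iso_cmp:
  assumes "is_iso C X Y f" "is_iso C Y Z g"
  shows "is_iso C X Z (g \<cdot> f)"
proof -
  obtain f' where f': "f' \<in> Hom C Y X" "f' \<cdot> f = ident C X" "f \<cdot> f' = ident C Y"
    using assms(1) unfolding is_iso_def by blast
  obtain g' where g': "g' \<in> Hom C Z Y" "g' \<cdot> g = ident C Y" "g \<cdot> g' = ident C Z"
    using assms(2) unfolding is_iso_def by blast
  have fg: "f \<in> Hom C X Y" "g \<in> Hom C Y Z" using assms by (auto simp: is_iso_def)
  have "(f' \<cdot> g') \<cdot> (g \<cdot> f) = ident C X"
    using fg f' g' cmp_cong[OF g'(2), of f] by (simp add: Hom_def)
  moreover have "(g \<cdot> f) \<cdot> (f' \<cdot> g') = ident C Z"
    using fg f' g' cmp_cong[OF f'(3), of g'] by (simp add: Hom_def)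
  ultimately show ?thesis
    unfolding is_iso_def using fg f' g' by (auto intro!: cmp_hom bexI[of _ "f' \<cdot> g'"])
qed

lemma isomorphic_refl: "X \<in> Obj C \<Longrightarrow> isomorphic C X X"
  unfolding isomorphic_def using is_iso_ident by blast

lemma isomorphic_sym: "isomorphic C X Y \<Longrightarrow> isomorphic C Y X"
  unfolding isomorphic_def by (blast elim: is_iso_sym)

lemma isomorphic_trans [trans]: "isomorphic C X Y \<Longrightarrow> isomorphic C Y Z \<Longrightarrow> isomorphic C X Z"
  unfolding isomorphic_def using is_iso_cmp by blast

lemma isomorphic_obj: "isomorphic C X Y \<Longrightarrow> X \<in> Obj C" "isomorphic C X Y \<Longrightarrow> Y \<in> Obj C"
  unfolding isomorphic_def is_iso_def using Hom_objD by blast+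

lemma iso_cancel:
  assumes "is_iso C X Y f"
  shows "e \<in> Hom C W X \<Longrightarrow> e' \<in> Hom C W X \<Longrightarrow> f \<cdot> e = f \<cdot> e' \<Longrightarrow> e = e'"
    and "h \<in> Hom C Y Z \<Longrightarrow> h' \<in> Hom C Y Z \<Longrightarrow> h \<cdot> f = h' \<cdot> f \<Longrightarrow> h = h'"
proof -
  obtain g where g: "g \<in> Hom C Y X" "g \<cdot> f = ident C X" "f \<cdot> g = ident C Y"
    using assms unfolding is_iso_def by blast
  have f: "f \<in> Hom C X Y" using assms by (auto simp: is_iso_def)
  show "e = e'" if "e \<in> Hom C W X" "e' \<in> Hom C W X" "f \<cdot> e = f \<cdot> e'"
  proof -
    have "(g \<cdot> f) \<cdot> e = (g \<cdot> f) \<cdot> e'" using that f g(1) by (simp add: Hom_def)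
    thus ?thesis using that by (simp add: Hom_def g)
  qed
  show "h = h'" if "h \<in> Hom C Y Z" "h' \<in> Hom C Y Z" "h \<cdot> f = h' \<cdot> f"
  proof -
    have "h \<cdot> (f \<cdot> g) = h' \<cdot> (f \<cdot> g)" using that f g(1) cmp_assoc_arr[of g f h] cmp_assoc_arr[of g f h'] by (simp add: Hom_def del: cmp_assoc_arr)
    thus ?thesis using that by (simp add: Hom_def g)
  qed
qed

end

text \<open>The axiom \<open>tri_rotate\<close> names the hom group of its sign; reading the group
  off the arrow makes negation a plain unary operation.\<close>

definition hneg :: "('o, 'm, 'z) tcat_scheme \<Rightarrow> 'm \<Rightarrow> 'm" where
  "hneg T f = inv\<^bsub>hom_group T (src T f) (tgt T f)\<^esub> f"

notation hadd (infixl "[+]\<index>" 65) and hneg ("[-]\<index> _" [81] 80)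

definition orth :: "('o, 'm, 'z) tcat_scheme \<Rightarrow> 'o \<Rightarrow> 'o \<Rightarrow> bool" where
  "orth T X Y \<longleftrightarrow> Hom T X Y = {hzero T X Y}"

context additive_category begin

lemma hom_group_simps [simp]:
  "carrier (hom_group D X Y) = Hom D X Y" "mult (hom_group D X Y) = hadd D"
  "one (hom_group D X Y) = hzero D X Y"
  by (simp_all add: hom_group_def)

lemma hzero_simps [simp]:
  assumes "X \<in> Obj C" "Y \<in> Obj C"
  shows "hzero C X Y \<in> Arr C" "src C (hzero C X Y) = X" "tgt C (hzero C X Y) = Y"
proof -
  interpret comm_group "hom_group C X Y" by (rule hom_comm_group[OF assms])
  show "hzero C X Y \<in> Arr C" "src C (hzero C X Y) = X" "tgt C (hzero C X Y) = Y"
    using one_closed by (auto simp: Hom_def)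
qed

lemma hadd_simps [simp]:
  assumes "f \<in> Arr C" "g \<in> Arr C" "src C f = src C g" "tgt C f = tgt C g"
  shows "f [+] g \<in> Arr C" "src C (f [+] g) = src C g" "tgt C (f [+] g) = tgt C g"
proof -
  interpret comm_group "hom_group C (src C f) (tgt C f)" by (rule hom_comm_group) (use assms in auto)
  show "f [+] g \<in> Arr C" "src C (f [+] g) = src C g" "tgt C (f [+] g) = tgt C g"
    using m_closed[of f g] assms by (auto simp: Hom_def)
qed

lemma hneg_simps [simp]:
  assumes "f \<in> Arr C"
  shows "[-] f \<in> Arr C" "src C ([-] f) = src C f" "tgt C ([-] f) = tgt C f"
proof -
  interpret comm_group "hom_group C (src C f) (tgt C f)" by (rule hom_comm_group) (use assms in auto)
  show "[-] f \<in> Arr C" "src C ([-] f) = src C f" "tgt C ([-] f) = tgt C f"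
    using inv_closed[of f] assms by (auto simp: Hom_def hneg_def)
qed

lemma hadd_zero [simp]:
  assumes "f \<in> Arr C"
  shows "src C f = X \<Longrightarrow> tgt C f = Y \<Longrightarrow> f [+] hzero C X Y = f"
    "src C f = X \<Longrightarrow> tgt C f = Y \<Longrightarrow> hzero C X Y [+] f = f"
    "f [+] ([-] f) = hzero C (src C f) (tgt C f)"
    "([-] f) [+] f = hzero C (src C f) (tgt C f)"
    "[-] ([-] f) = f"
proof -
  interpret comm_group "hom_group C (src C f) (tgt C f)" by (rule hom_comm_group) (use assms in auto)
  have f: "f \<in> carrier (hom_group C (src C f) (tgt C f))" using assms by (auto simp: Hom_def)
  show "src C f = X \<Longrightarrow> tgt C f = Y \<Longrightarrow> f [+] hzero C X Y = f"
    "src C f = X \<Longrightarrow> tgt C f = Y \<Longrightarrow> hzero C X Y [+] f = f"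
    "f [+] ([-] f) = hzero C (src C f) (tgt C f)"
    "([-] f) [+] f = hzero C (src C f) (tgt C f)"
    using r_one[OF f] l_one[OF f] r_inv[OF f] l_inv[OF f] by (auto simp: hneg_def)
  show "[-] ([-] f) = f"
    using inv_inv[OF f] assms by (simp add: hneg_def[of C "[-] f"]) (simp add: hneg_def)
qed

lemma hadd_ac:
  assumes "f \<in> Arr C" "g \<in> Arr C" "src C f = src C g" "tgt C f = tgt C g"
  shows "f [+] g = g [+] f"
    "h \<in> Arr C \<Longrightarrow> src C g = src C h \<Longrightarrow> tgt C g = tgt C h \<Longrightarrow> f [+] g [+] h = f [+] (g [+] h)"
    "h \<in> Arr C \<Longrightarrow> src C g = src C h \<Longrightarrow> tgt C g = tgt C h \<Longrightarrow> f [+] (g [+] h) = g [+] (f [+] h)"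
proof -
  interpret comm_group "hom_group C (src C f) (tgt C f)" by (rule hom_comm_group) (use assms in auto)
  show "f [+] g = g [+] f"
    "h \<in> Arr C \<Longrightarrow> src C g = src C h \<Longrightarrow> tgt C g = tgt C h \<Longrightarrow> f [+] g [+] h = f [+] (g [+] h)"
    "h \<in> Arr C \<Longrightarrow> src C g = src C h \<Longrightarrow> tgt C g = tgt C h \<Longrightarrow> f [+] (g [+] h) = g [+] (f [+] h)"
    using m_comm[of f g] m_assoc[of f g h] m_lcomm[of f g h] assms by (auto simp: Hom_def)
qed

lemma hadd_cancel:
  assumes "f \<in> Arr C" "g \<in> Arr C" "src C f = src C g" "tgt C f = tgt C g"
  shows "h \<in> Arr C \<Longrightarrow> src C h = src C g \<Longrightarrow> tgt C h = tgt C g \<Longrightarrow> f [+] g = f [+] h \<Longrightarrow> g = h"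
    "f [+] ([-] g) = hzero C (src C f) (tgt C f) \<Longrightarrow> f = g"
    "f [+] g = hzero C (src C f) (tgt C f) \<Longrightarrow> g = [-] f"
proof -
  interpret comm_group "hom_group C (src C f) (tgt C f)" by (rule hom_comm_group) (use assms in auto)
  show c: "h \<in> Arr C \<Longrightarrow> src C h = src C g \<Longrightarrow> tgt C h = tgt C g \<Longrightarrow> f [+] g = f [+] h \<Longrightarrow> g = h" for h
  proof -
    assume h: "h \<in> Arr C" "src C h = src C g" "tgt C h = tgt C g" "f [+] g = f [+] h"
    let ?G = "hom_group C (src C f) (tgt C f)"
    have "f \<in> Units ?G" "g \<in> carrier ?G" "h \<in> carrier ?G" using h assms unfolding Units_eq by (auto simp: Hom_def)
    from Units_l_cancel[OF this] show "g = h" using h(4) by simp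
  qed
  show *: "f [+] g = hzero C (src C f) (tgt C f) \<Longrightarrow> g = [-] f"
    using c[of "[-] f"] assms by simp
  show "f = g" if "f [+] ([-] g) = hzero C (src C f) (tgt C f)"
  proof -
    have "f = f [+] (([-] g) [+] g)" using assms by simp
    also have "\<dots> = g" using assms that hadd_ac(2)[of f "[-] g" g, symmetric] by simp
    finally show ?thesis .
  qed
qed

lemma cmp_add [simp]:
  assumes "f \<in> Arr C" "g \<in> Arr C" "src C f = src C g" "tgt C f = tgt C g" "h \<in> Arr C"
  shows "tgt C g = src C h \<Longrightarrow> h \<cdot> (f [+] g) = h \<cdot> f [+] h \<cdot> g"
    "tgt C h = src C g \<Longrightarrow> (f [+] g) \<cdot> h = f \<cdot> h [+] g \<cdot> h"
  using cmp_add_right[of f "src C f" "tgt C f" g h] cmp_add_left[of h "src C h" "src C f" f "tgt C f" g] assms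
  by (auto simp: Hom_def)

lemma cmp_zero [simp]:
  assumes "f \<in> Arr C" "X \<in> Obj C"
  shows "src C f = Y \<Longrightarrow> f \<cdot> hzero C X Y = hzero C X (tgt C f)"
    "tgt C f = Y \<Longrightarrow> hzero C Y X \<cdot> f = hzero C (src C f) X"
proof -
  show "f \<cdot> hzero C X Y = hzero C X (tgt C f)" if Y: "src C f = Y"
  proof -
    have "f \<cdot> (hzero C X Y [+] hzero C X Y) = f \<cdot> hzero C X Y [+] f \<cdot> hzero C X Y"
      by (rule cmp_add) (use assms Y in auto)
    hence "f \<cdot> hzero C X Y [+] f \<cdot> hzero C X Y = f \<cdot> hzero C X Y [+] hzero C X (tgt C f)"
      using assms Y by auto
    thus ?thesis by (rule hadd_cancel(1)[rotated -1]) (use assms Y in auto)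
  qed
  show "hzero C Y X \<cdot> f = hzero C (src C f) X" if Y: "tgt C f = Y"
  proof -
    have "(hzero C Y X [+] hzero C Y X) \<cdot> f = hzero C Y X \<cdot> f [+] hzero C Y X \<cdot> f"
      by (rule cmp_add) (use assms Y in auto)
    hence "hzero C Y X \<cdot> f [+] hzero C Y X \<cdot> f = hzero C Y X \<cdot> f [+] hzero C (src C f) X"
      using assms Y by auto
    thus ?thesis by (rule hadd_cancel(1)[rotated -1]) (use assms Y in auto)
  qed
qed

lemma cmp_neg [simp]:
  assumes "f \<in> Arr C" "g \<in> Arr C" "tgt C f = src C g"
  shows "g \<cdot> ([-] f) = [-] (g \<cdot> f)" "([-] g) \<cdot> f = [-] (g \<cdot> f)"
proof -
  have "g \<cdot> f [+] g \<cdot> ([-] f) = hzero C (src C f) (tgt C g)"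
    using cmp_add(1)[of f "[-] f" g] assms by simp
  thus "g \<cdot> ([-] f) = [-] (g \<cdot> f)"
    by (intro hadd_cancel(3)) (use assms in auto)
  have "g \<cdot> f [+] ([-] g) \<cdot> f = hzero C (src C f) (tgt C g)"
    using cmp_add(2)[of g "[-] g" f] assms by simp
  thus "([-] g) \<cdot> f = [-] (g \<cdot> f)"
    by (intro hadd_cancel(3)) (use assms in auto)
qed

lemma neg_zero [simp]: "X \<in> Obj C \<Longrightarrow> Y \<in> Obj C \<Longrightarrow> [-] hzero C X Y = hzero C X Y"
  using hadd_cancel(3)[of "hzero C X Y" "hzero C X Y"] by simp

lemma neg_eq_zero:
  "f \<in> Hom C X Y \<Longrightarrow> [-] f = hzero C X Y \<Longrightarrow> f = hzero C X Y"
  using hadd_zero(5)[of f] neg_zero[of X Y] Hom_objD[of f X Y] by (simp add: Hom_def)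

lemma zero_hom: "X \<in> Obj C \<Longrightarrow> Y \<in> Obj C \<Longrightarrow> hzero C X Y \<in> Hom C X Y"
  by (simp add: Hom_def)

lemma add_hom: "f \<in> Hom C X Y \<Longrightarrow> g \<in> Hom C X Y \<Longrightarrow> f [+] g \<in> Hom C X Y"
  by (simp add: Hom_def)

lemma neg_hom: "f \<in> Hom C X Y \<Longrightarrow> [-] f \<in> Hom C X Y"
  by (simp add: Hom_def)

text \<open>The equational form is preserved by additive functors, which is how shifts of zero
  objects are recognised.\<close>

lemma zero_object_iff: "zero_object C Z \<longleftrightarrow> Z \<in> Obj C \<and> ident C Z = hzero C Z Z"
proof
  assume z: "zero_object C Z"
  hence "\<exists>!f. f \<in> Hom C Z Z" and Z: "Z \<in> Obj C" unfolding zero_object_def by blast+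
  thus "Z \<in> Obj C \<and> ident C Z = hzero C Z Z" using zero_hom[of Z Z] ident_hom[of Z] by blast
next
  assume z: "Z \<in> Obj C \<and> ident C Z = hzero C Z Z"
  have 1: "f = hzero C Z X" if "f \<in> Hom C Z X" for f X
  proof -
    have "f \<cdot> ident C Z = f" using that by (simp add: Hom_def)
    thus ?thesis using that z by (simp add: Hom_def)
  qed
  have 2: "f = hzero C X Z" if "f \<in> Hom C X Z" for f X
  proof -
    have "ident C Z \<cdot> f = f" using that by (simp add: Hom_def)
    thus ?thesis using that z by (simp add: Hom_def)
  qed
  show "zero_object C Z"
    unfolding zero_object_def using 1 2 z zero_hom by blast
qed

lemma zero_object_Hom:
  assumes "zero_object C Z"
  shows "f \<in> Hom C X Z \<Longrightarrow> f = hzero C X Z" "f \<in> Hom C Z X \<Longrightarrow> f = hzero C Z X"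
  using assms zero_hom[of X Z] zero_hom[of Z X] Hom_objD[of f] unfolding zero_object_def by blast+

lemma orthD: "orth C X Y \<Longrightarrow> f \<in> Hom C X Y \<Longrightarrow> f = hzero C X Y"
  by (auto simp: orth_def)

lemma orthI: "X \<in> Obj C \<Longrightarrow> Y \<in> Obj C \<Longrightarrow> (\<And>f. f \<in> Hom C X Y \<Longrightarrow> f = hzero C X Y) \<Longrightarrow> orth C X Y"
  using zero_hom unfolding orth_def by blast

lemma orth_retract_left:
  assumes "orth C W Y" "i \<in> Hom C X W" "r \<in> Hom C W X" "r \<cdot> i = ident C X" "Y \<in> Obj C"
  shows "orth C X Y"
proof (rule orthI)
  show "X \<in> Obj C" using assms Hom_objD by blast
  show "f = hzero C X Y" if f: "f \<in> Hom C X Y" for f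
  proof -
    have "f \<cdot> r = hzero C W Y" by (rule orthD[OF assms(1) cmp_hom[OF assms(3) f]])
    hence "(f \<cdot> r) \<cdot> i = hzero C X Y" using assms(2,5) by (simp add: Hom_def)
    thus ?thesis using assms f by (simp add: Hom_def)
  qed
qed fact

lemma orth_iso:
  assumes "orth C X Y" "isomorphic C X X'" "isomorphic C Y Y'"
  shows "orth C X' Y'"
proof -
  obtain a where a: "is_iso C X X' a" using assms(2) isomorphic_def by metis
  obtain b where b: "is_iso C Y' Y b" using assms(3) isomorphic_sym isomorphic_def by metis
  have ab: "a \<in> Hom C X X'" "b \<in> Hom C Y' Y" using a b by (auto simp: is_iso_def)
  show ?thesis
  proof (rule orthI)
    show obj: "X' \<in> Obj C" "Y' \<in> Obj C" using ab Hom_objD by blast+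
    show "f = hzero C X' Y'" if f: "f \<in> Hom C X' Y'" for f
    proof -
      have "b \<cdot> (f \<cdot> a) = hzero C X Y" by (rule orthD[OF assms(1) cmp_hom[OF cmp_hom[OF ab(1) f] ab(2)]])
      also have "\<dots> = b \<cdot> hzero C X Y'" using ab Hom_objD[OF ab(1)] by (simp add: Hom_def)
      finally have "f \<cdot> a = hzero C X Y'"
        using iso_cancel(1)[OF b] cmp_hom[OF ab(1) f] zero_hom Hom_objD[OF ab(1)] obj by blast
      also have "\<dots> = hzero C X' Y' \<cdot> a" using ab obj by (simp add: Hom_def)
      finally show ?thesis using iso_cancel(2)[OF a f] zero_hom obj by blast
    qed
  qed
qed

end

subsection \<open>Extensions in triangulated categories\<close>

text \<open>The membership \<open>Y \<in> X * Z\<close>. Dropping the maps makes the relation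
  invariant under isomorphism in all three places and insensitive to signs.\<close>

definition ext :: "('o, 'm, 'z) tcat_scheme \<Rightarrow> 'o \<Rightarrow> 'o \<Rightarrow> 'o \<Rightarrow> bool" where
  "ext T X Y Z \<longleftrightarrow> (\<exists>u v w. dist_tri T X Y Z u v w)"

context triangulated_category begin

abbreviation Sh where "Sh \<equiv> shO T"
abbreviation Sa where "Sa \<equiv> shA T"
abbreviation tri_sub where "tri_sub \<equiv> triangulated_subcategory T"
abbreviation Sp where "Sp \<equiv> shift_pow T"
abbreviation tri where "tri \<equiv> dist_tri T"
abbreviation isom where "isom \<equiv> isomorphic T"
abbreviation Ob where "Ob \<equiv> Obj T"
abbreviation Hm where "Hm \<equiv> Hom T"
abbreviation zer where "zer \<equiv> hzero T"
abbreviation one where "one \<equiv> ident T"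

section \<open>The shift on morphisms, isomorphisms and orthogonality\<close>

lemma shO_obj [simp]: "X \<in> Ob \<Longrightarrow> Sh X \<in> Ob"
  using shift_functor unfolding is_functor_def by blast

lemma shA_ident [simp]: "X \<in> Ob \<Longrightarrow> Sa (one X) = one (Sh X)"
  using shift_functor unfolding is_functor_def by blast

lemma shA_hom: "f \<in> Hm X Y \<Longrightarrow> Sa f \<in> Hm (Sh X) (Sh Y)"
  using shift_functor unfolding is_functor_def by blast

lemma shA_simps [simp]:
  assumes "f \<in> Arr T"
  shows "Sa f \<in> Arr T" "src T (Sa f) = Sh (src T f)" "tgt T (Sa f) = Sh (tgt T f)"
  using shA_hom[of f "src T f" "tgt T f"] assms by (auto simp: Hom_def)

lemma shA_cmp [simp]:
  assumes "f \<in> Arr T" "g \<in> Arr T" "tgt T f = src T g"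
  shows "Sa (g \<cdot> f) = Sa g \<cdot> Sa f"
proof -
  have "f \<in> Hm (src T f) (src T g)" "g \<in> Hm (src T g) (tgt T g)"
    using assms by (auto simp: Hom_def)
  thus ?thesis using shift_functor unfolding is_functor_def by blast
qed

lemma shA_add [simp]:
  assumes "f \<in> Arr T" "g \<in> Arr T" "src T f = src T g" "tgt T f = tgt T g"
  shows "Sa (f [+] g) = Sa f [+] Sa g"
  using shift_additive[of f "src T f" "tgt T f" g] assms by (auto simp: Hom_def)

lemma shA_zero [simp]:
  assumes "X \<in> Ob" "Y \<in> Ob"
  shows "Sa (zer X Y) = zer (Sh X) (Sh Y)"
proof -
  have "Sa (zer X Y) [+] Sa (zer X Y) = Sa (zer X Y) [+] zer (Sh X) (Sh Y)"
    using shA_add[of "zer X Y" "zer X Y"] assms by simp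
  thus ?thesis by (rule hadd_cancel(1)[rotated -1]) (use assms in auto)
qed

lemma shA_neg [simp]:
  assumes "f \<in> Arr T"
  shows "Sa ([-] f) = [-] (Sa f)"
proof (rule hadd_cancel(3))
  show "Sa f [+] Sa ([-] f) = zer (src T (Sa f)) (tgt T (Sa f))"
    using shA_add[of f "[-] f"] assms by simp
qed (use assms in auto)

lemma shA_inj:
  assumes "f \<in> Hm X Y" "g \<in> Hm X Y" "Sa f = Sa g"
  shows "f = g"
  using shift_fully_faithful[of X Y] Hom_objD[OF assms(1)] assms
  unfolding bij_betw_def inj_on_def by blast

lemma shA_full:
  assumes "h \<in> Hm (Sh X) (Sh Y)" "X \<in> Ob" "Y \<in> Ob"
  obtains f where "f \<in> Hm X Y" "Sa f = h"
proof -
  have "h \<in> Sa ` Hm X Y"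
    using bij_betw_imp_surj_on[OF shift_fully_faithful[OF assms(2,3)]] assms(1) by simp
  thus ?thesis using that by auto
qed

lemma shA_iso:
  assumes "is_iso T X Y f"
  shows "is_iso T (Sh X) (Sh Y) (Sa f)"
proof -
  obtain g where g: "g \<in> Hm Y X" "g \<cdot> f = one X" "f \<cdot> g = one Y"
    using assms unfolding is_iso_def by blast
  have f: "f \<in> Hm X Y" using assms by (auto simp: is_iso_def)
  have "Sa g \<cdot> Sa f = one (Sh X)" "Sa f \<cdot> Sa g = one (Sh Y)"
    using f g shA_cmp[of f g] shA_cmp[of g f] Hom_objD[OF f] by (simp_all add: Hom_def)
  thus ?thesis unfolding is_iso_def using shA_hom f g by blast
qed

lemma Sh_isomorphic: "isom X Y \<Longrightarrow> isom (Sh X) (Sh Y)"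
  unfolding isomorphic_def using shA_iso by blast

lemma Sh_reflects_isomorphic:
  assumes "isom (Sh X) (Sh Y)" and X: "X \<in> Ob" and Y: "Y \<in> Ob"
  shows "isom X Y"
proof -
  obtain f g where fg: "f \<in> Hm (Sh X) (Sh Y)" "g \<in> Hm (Sh Y) (Sh X)"
    "g \<cdot> f = one (Sh X)" "f \<cdot> g = one (Sh Y)"
    using assms(1) unfolding isomorphic_def is_iso_def by blast
  obtain a where a: "a \<in> Hm X Y" "Sa a = f" using shA_full[OF fg(1) X Y] by blast
  obtain b where b: "b \<in> Hm Y X" "Sa b = g" using shA_full[OF fg(2) Y X] by blast
  have "b \<cdot> a = one X"
    by (rule shA_inj[of _ X X]) (use a b fg X Y in \<open>auto simp: Hom_def\<close>)
  moreover have "a \<cdot> b = one Y"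
    by (rule shA_inj[of _ Y Y]) (use a b fg X Y in \<open>auto simp: Hom_def\<close>)
  ultimately show ?thesis unfolding isomorphic_def is_iso_def using a b by blast
qed

lemma Sh_orth_iff:
  assumes "X \<in> Ob" "Y \<in> Ob"
  shows "orth T (Sh X) (Sh Y) \<longleftrightarrow> orth T X Y"
proof
  assume o: "orth T (Sh X) (Sh Y)"
  show "orth T X Y"
  proof (rule orthI)
    show "f = zer X Y" if "f \<in> Hm X Y" for f
    proof (rule shA_inj[of _ X Y])
      show "Sa f = Sa (zer X Y)" using orthD[OF o shA_hom[OF that]] assms by simp
    qed (use assms that zero_hom in auto)
  qed (use assms in auto)
next
  assume o: "orth T X Y"
  show "orth T (Sh X) (Sh Y)"
  proof (rule orthI)
    show "f = zer (Sh X) (Sh Y)" if f: "f \<in> Hm (Sh X) (Sh Y)" for f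
      using shA_full[OF f assms] orthD[OF o] assms shA_zero by metis
  qed (use assms in auto)
qed

lemma desusp:
  assumes "X \<in> Ob"
  obtains Y where "Y \<in> Ob" "isom (Sh Y) X"
  using shift_ess_surj assms by blast

section \<open>Exactness of the hom functors on triangles, as factorisation statements\<close>

lemma dist_triD:
  assumes "tri X Y Z u v w"
  shows "u \<in> Hm X Y" "v \<in> Hm Y Z" "w \<in> Hm Z (Sh X)"
    "X \<in> Ob" "Y \<in> Ob" "Z \<in> Ob"
  using assms Hom_objD unfolding dist_tri_def by blast+

lemma rotate:
  assumes "tri X Y Z u v w"
  shows "tri Y Z (Sh X) v w ([-] (Sa u))"
  using tri_rotate[OF dist_triD(1-3)[OF assms]] assms dist_triD[OF assms]
  by (auto simp: hneg_def Hom_def)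

lemma rotate_back:
  assumes "tri Y Z (Sh X) v w ([-] (Sa u))" "u \<in> Hm X Y"
  shows "tri X Y Z u v w"
  using tri_rotate[OF assms(2) dist_triD(1,2)[OF assms(1)]] assms
  by (auto simp: hneg_def Hom_def)

lemma diff_eq_zero:
  "f [+] ([-] g) = zer X Y \<Longrightarrow> f \<in> Hm X Y \<Longrightarrow> g \<in> Hm X Y \<Longrightarrow> f = g"
  using hadd_cancel(2)[of f g] by (simp add: Hom_def)

lemma zero_exists:
  obtains Z where "zero_object T Z" "Z \<in> Ob" using ex_zero_object zero_object_iff by blast

text \<open>Comparison with the triangle \<open>X = X -> 0\<close> factors
  \<open>v \<cdot> u\<close> through a zero object; the other two composites follow by
  rotation.\<close>

lemma tri_cmp_zero:
  assumes "tri X Y Z u v w"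
  shows "v \<cdot> u = zer X Z" "w \<cdot> v = zer Y (Sh X)" "Sa u \<cdot> w = zer Z (Sh Y)"
proof -
  have *: "v \<cdot> u = zer X Z" if t: "tri X Y Z u v w" for X Y Z u v w
  proof -
    note tD = dist_triD[OF t]
    obtain O' where O': "zero_object T O'" "O' \<in> Ob" using zero_exists .
    have t0: "tri X X O' (one X) (zer X O') (zer O' (Sh X))"
      by (rule tri_ident) (use tD O' in auto)
    obtain c where c: "c \<in> Hm O' Z" "c \<cdot> zer X O' = v \<cdot> u"
      using tri_morphism[OF t0 t ident_hom[OF tD(4)] tD(1) refl] by blast
    thus ?thesis using tD O' by (simp add: Hom_def)
  qed
  note tD = dist_triD[OF assms]
  show "v \<cdot> u = zer X Z" "w \<cdot> v = zer Y (Sh X)"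
    using *[OF assms] *[OF rotate[OF assms]] .
  have "[-] (Sa u \<cdot> w) = zer Z (Sh Y)"
    using *[OF rotate[OF rotate[OF assms]]] tD by (simp add: Hom_def)
  thus "Sa u \<cdot> w = zer Z (Sh Y)"
    by (rule neg_eq_zero[rotated]) (use tD in \<open>auto simp: Hom_def\<close>)
qed

text \<open>A map from \<open>Y\<close> that kills \<open>u\<close> is the middle part of a morphism
  into the triangle \<open>0 -> Q = Q\<close>, and \<open>tri_morphism\<close> supplies the third
  component.\<close>

lemma tri_factor_right:
  assumes t: "tri X Y Z u v w" and g: "g \<in> Hm Y Q" "g \<cdot> u = zer X Q"
  obtains h where "h \<in> Hm Z Q" "h \<cdot> v = g"
proof -
  note tD = dist_triD[OF t]
  have Q: "Q \<in> Ob" using Hom_objD[OF g(1)] by blast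
  obtain O' where O': "zero_object T O'" "O' \<in> Ob" using zero_exists .
  have "tri Q Q O' (one Q) (zer Q O') (zer O' (Sh Q))"
    by (rule tri_ident) (use Q O' in auto)
  \<comment> \<open>The axiom gives \<open>Q = Q -> 0\<close>; the zero must stand in first place,
    so the axiom is used with the zero object \<open>Sh O'\<close> and rotated back.\<close>
  hence t0: "tri O' Q Q (zer O' Q) (one Q) (zer Q (Sh O'))"
  proof -
    have shO: "zero_object T (Sh O')"
      using O' shA_ident[of O'] shA_zero[of O' O'] unfolding zero_object_iff by auto
    have t1: "tri Q Q (Sh O') (one Q) (zer Q (Sh O')) (zer (Sh O') (Sh Q))"
      by (rule tri_ident) (use Q shO in auto)
    have "[-] (Sa (zer O' Q)) = zer (Sh O') (Sh Q)" using O' Q by simp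
    thus ?thesis using rotate_back[of Q Q O' "one Q" "zer Q (Sh O')" "zer O' Q"] t1
      zero_hom O' Q by simp
  qed
  have "g \<cdot> u = zer O' Q \<cdot> zer X O'" using g tD O' Q by (simp add: Hom_def)
  then obtain c where "c \<in> Hm Z Q" "c \<cdot> v = one Q \<cdot> g"
    using tri_morphism[OF t t0 zero_hom[OF tD(4) O'(2)] g(1)] by blast
  thus ?thesis using that g by (auto simp: Hom_def)
qed

lemma tri_factor_right2:
  assumes t: "tri X Y Z u v w" and g: "g \<in> Hm Z Q" "g \<cdot> v = zer Y Q"
  obtains h where "h \<in> Hm (Sh X) Q" "h \<cdot> w = g"
  using tri_factor_right[OF rotate[OF t] g] .

lemma tri_factor_right3:
  assumes t: "tri X Y Z u v w" and g: "g \<in> Hm (Sh X) Q" "g \<cdot> w = zer Z Q"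
  obtains h where "h \<in> Hm (Sh Y) Q" "h \<cdot> Sa u = g"
proof -
  note tD = dist_triD[OF t]
  obtain h where h: "h \<in> Hm (Sh Y) Q" "h \<cdot> ([-] (Sa u)) = g"
    using tri_factor_right[OF rotate[OF rotate[OF t]] g] .
  hence "([-] h) \<cdot> Sa u = g" using tD by (simp add: Hom_def)
  thus ?thesis using that neg_hom h by blast
qed

text \<open>\<open>tri_morphism\<close> completes only the third vertex. After one rotation of both
  triangles the filler is a map \<open>Sh Q -> Sh X\<close>, which fullness of the shift brings back
  to \<open>Q -> X\<close>.\<close>

lemma tri_factor_left:
  assumes t: "tri X Y Z u v w" and g: "g \<in> Hm Q Y" "v \<cdot> g = zer Q Z"
  obtains h where "h \<in> Hm Q X" "u \<cdot> h = g"
proof -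
  note tD = dist_triD[OF t]
  have Q: "Q \<in> Ob" using Hom_objD[OF g(1)] by blast
  obtain O' where O': "zero_object T O'" "O' \<in> Ob" using zero_exists .
  have t0: "tri Q Q O' (one Q) (zer Q O') (zer O' (Sh Q))"
    by (rule tri_ident) (use Q O' in auto)
  have "zer O' Z \<cdot> zer Q O' = v \<cdot> g" using g tD O' Q by (simp add: Hom_def)
  then obtain c where c: "c \<in> Hm (Sh Q) (Sh X)"
      "Sa g \<cdot> ([-] (Sa (one Q))) = ([-] (Sa u)) \<cdot> c"
    using tri_morphism[OF rotate[OF t0] rotate[OF t] g(1) zero_hom[OF O'(2) tD(6)]] by blast
  obtain h where h: "h \<in> Hm Q X" "Sa h = c" using shA_full[OF c(1) Q tD(4)] .
  have "Sa (u \<cdot> h) = Sa g"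
  proof -
    have "[-] (Sa (u \<cdot> h)) = [-] (Sa g)" using c h g tD Q by (simp add: Hom_def)
    hence "[-] ([-] (Sa (u \<cdot> h))) = [-] ([-] (Sa g))" by simp
    thus ?thesis using g h tD by (simp add: Hom_def del: shA_cmp)
  qed
  hence "u \<cdot> h = g" using shA_inj cmp_hom[OF h(1) tD(1)] g(1) by blast
  thus ?thesis using that h by blast
qed

lemma tri_factor_left2:
  assumes t: "tri X Y Z u v w" and g: "g \<in> Hm Q Z" "w \<cdot> g = zer Q (Sh X)"
  obtains h where "h \<in> Hm Q Y" "v \<cdot> h = g"
  using tri_factor_left[OF rotate[OF t] g] .

lemma tri_factor_left3:
  assumes t: "tri X Y Z u v w" and g: "g \<in> Hm Q (Sh X)" "Sa u \<cdot> g = zer Q (Sh Y)"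
  obtains h where "h \<in> Hm Q Z" "w \<cdot> h = g"
proof -
  note tD = dist_triD[OF t]
  have "([-] (Sa u)) \<cdot> g = zer Q (Sh Y)"
    using g tD Hom_objD[OF g(1)] by (simp add: Hom_def)
  thus ?thesis using tri_factor_left[OF rotate[OF rotate[OF t]] g(1)] that by blast
qed

lemma orth_ext_right:
  assumes t: "ext T X Y Z" and "orth T Q X" "orth T Q Z" "Q \<in> Ob"
  shows "orth T Q Y"
proof -
  obtain u v w where t: "tri X Y Z u v w" using t ext_def by metis
  note tD = dist_triD[OF t]
  show ?thesis
  proof (rule orthI)
    show "f = zer Q Y" if f: "f \<in> Hm Q Y" for f
    proof -
      have "v \<cdot> f = zer Q Z" using assms orthD cmp_hom[OF f tD(2)] by blast
      then obtain h where h: "h \<in> Hm Q X" "u \<cdot> h = f" using tri_factor_left[OF t f] by blast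
      hence "h = zer Q X" using orthD assms by blast
      thus ?thesis using h tD assms(4) by (simp add: Hom_def)
    qed
  qed (use assms tD in auto)
qed

lemma orth_ext_left:
  assumes t: "ext T X Y Z" and "orth T X Q" "orth T Z Q" "Q \<in> Ob"
  shows "orth T Y Q"
proof -
  obtain u v w where t: "tri X Y Z u v w" using t ext_def by metis
  note tD = dist_triD[OF t]
  show ?thesis
  proof (rule orthI)
    show "f = zer Y Q" if f: "f \<in> Hm Y Q" for f
    proof -
      have "f \<cdot> u = zer X Q" using assms orthD cmp_hom[OF tD(1) f] by blast
      then obtain h where h: "h \<in> Hm Z Q" "h \<cdot> v = f" using tri_factor_right[OF t f] by blast
      hence "h = zer Z Q" using orthD assms by blast
      thus ?thesis using h tD assms(4) by (simp add: Hom_def)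
    qed
  qed (use assms tD in auto)
qed

text \<open>The difference \<open>c - 1\<close> factors through \<open>w\<close> and is killed by
  composing with \<open>w\<close> on the left, so its square is zero and \<open>1 - (c - 1)\<close>
  inverts \<open>c\<close>.\<close>

lemma cone_iso_endo:
  assumes t: "tri X Y Z u v w" and c: "c \<in> Hm Z Z" "c \<cdot> v = v" "w \<cdot> c = w"
  obtains d where "d \<in> Hm Z Z" "d \<cdot> c = one Z" "c \<cdot> d = one Z"
proof -
  note tD = dist_triD[OF t]
  define n where "n = c [+] ([-] (one Z))"
  have n: "n \<in> Hm Z Z" using c tD by (simp add: n_def Hom_def)
  have "n \<cdot> v = zer Y Z" "w \<cdot> n = zer Z (Sh X)"
    using c tD by (simp_all add: n_def Hom_def)
  then obtain k where k: "k \<in> Hm (Sh X) Z" "k \<cdot> w = n" using tri_factor_right2[OF t n] by blast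
  have nn: "n \<cdot> n = zer Z Z"
  proof -
    have "n \<cdot> n = k \<cdot> (w \<cdot> n)" using k n tD by (auto simp: Hom_def)
    also have "\<dots> = zer Z Z" using \<open>w \<cdot> n = _\<close> k tD by (simp add: Hom_def)
    finally show ?thesis .
  qed
  have cn: "c = one Z [+] n"
    using c tD by (simp add: n_def Hom_def hadd_ac(3)[of "one Z" c])
  show ?thesis
  proof
    show "one Z [+] ([-] n) \<in> Hm Z Z" using n tD by (simp add: Hom_def)
    show "(one Z [+] ([-] n)) \<cdot> c = one Z" "c \<cdot> (one Z [+] ([-] n)) = one Z"
      unfolding cn using n nn tD hadd_ac(3)[of n "one Z" "[-] n"] hadd_ac(2)[of "one Z" "[-] n" n]
      hadd_ac(2)[of "one Z" n "[-] n"]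
      by (simp_all add: Hom_def)
  qed
qed

text \<open>Fillers exist in both directions, and each of their composites fixes the second and
  third maps of its triangle, so \<open>cone_iso_endo\<close> makes both composites
  invertible.\<close>

lemma cone_iso:
  assumes t: "tri X Y Z u v w" and t': "tri X' Y' Z' u' v' w'"
    and a: "is_iso T X X' a" and b: "is_iso T Y Y' b" and eq: "b \<cdot> u = u' \<cdot> a"
  obtains c where "is_iso T Z Z' c" "c \<cdot> v = v' \<cdot> b" "Sa a \<cdot> w = w' \<cdot> c"
proof -
  note tD = dist_triD[OF t] and tD' = dist_triD[OF t']
  obtain a' where a': "a' \<in> Hm X' X" "a' \<cdot> a = one X" "a \<cdot> a' = one X'"
    using a unfolding is_iso_def by blast
  obtain b' where b': "b' \<in> Hm Y' Y" "b' \<cdot> b = one Y" "b \<cdot> b' = one Y'"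
    using b unfolding is_iso_def by blast
  have ab: "a \<in> Hm X X'" "b \<in> Hm Y Y'" using a b by (auto simp: is_iso_def)
  have eq': "b' \<cdot> u' = u \<cdot> a'"
  proof (rule iso_cancel(1)[OF b])
    have "b \<cdot> (u \<cdot> a') = (u' \<cdot> a) \<cdot> a'" using cmp_cong[OF eq] ab a' b' tD tD' by (simp add: Hom_def)
    also have "\<dots> = u'" using a' ab tD' by (simp add: Hom_def)
    finally show "b \<cdot> (b' \<cdot> u') = b \<cdot> (u \<cdot> a')"
      using cmp_cong[OF b'(3)] ab b' tD' by (simp add: Hom_def)
    show "b' \<cdot> u' \<in> Hm X' Y" "u \<cdot> a' \<in> Hm X' Y"
      using b' a' tD tD' by (auto simp: Hom_def)
  qed
  obtain c where c: "c \<in> Hm Z Z'" "c \<cdot> v = v' \<cdot> b" "Sa a \<cdot> w = w' \<cdot> c"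
    using tri_morphism[OF t t' ab eq] by blast
  obtain c' where c': "c' \<in> Hm Z' Z" "c' \<cdot> v' = v \<cdot> b'" "Sa a' \<cdot> w' = w \<cdot> c'"
    using tri_morphism[OF t' t a'(1) b'(1) eq'] by blast
  have sa: "Sa a' \<cdot> Sa a = one (Sh X)" "Sa a \<cdot> Sa a' = one (Sh X')"
    using shA_cmp[of a a'] shA_cmp[of a' a] a' ab tD tD' by (simp_all add: Hom_def)
  have 1: "(c' \<cdot> c) \<cdot> v = v"
  proof -
    have "(c' \<cdot> c) \<cdot> v = c' \<cdot> (v' \<cdot> b)" using c c' tD by (simp add: Hom_def)
    also have "\<dots> = (v \<cdot> b') \<cdot> b" using cmp_cong[OF c'(2), of b] c' ab tD' by (simp add: Hom_def)
    also have "\<dots> = v" using b' ab tD by (simp add: Hom_def)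
    finally show ?thesis .
  qed
  have 2: "w \<cdot> (c' \<cdot> c) = w"
  proof -
    have "w \<cdot> (c' \<cdot> c) = (Sa a' \<cdot> w') \<cdot> c"
      by (rule cmp_cong[OF c'(3)[symmetric]]) (use c' c tD in \<open>auto simp: Hom_def\<close>)
    also have "\<dots> = Sa a' \<cdot> (Sa a \<cdot> w)" using c c'(1) a' ab tD tD' by (simp add: Hom_def)
    also have "\<dots> = w" using cmp_cong[OF sa(1), of w] a' ab tD by (simp add: Hom_def)
    finally show ?thesis .
  qed
  have 3: "(c \<cdot> c') \<cdot> v' = v'"
  proof -
    have "(c \<cdot> c') \<cdot> v' = c \<cdot> (v \<cdot> b')" using c c' tD' by (simp add: Hom_def)
    also have "\<dots> = (v' \<cdot> b) \<cdot> b'" using cmp_cong[OF c(2), of b'] c b' tD by (simp add: Hom_def)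
    also have "\<dots> = v'" using b' ab tD' by (simp add: Hom_def)
    finally show ?thesis .
  qed
  have 4: "w' \<cdot> (c \<cdot> c') = w'"
  proof -
    have "w' \<cdot> (c \<cdot> c') = (Sa a \<cdot> w) \<cdot> c'"
      by (rule cmp_cong[OF c(3)[symmetric]]) (use c' c tD' in \<open>auto simp: Hom_def\<close>)
    also have "\<dots> = Sa a \<cdot> (Sa a' \<cdot> w')" using c(1) c' a' ab tD tD' by (simp add: Hom_def)
    also have "\<dots> = w'" using cmp_cong[OF sa(2), of w'] a' ab tD' by (simp add: Hom_def)
    finally show ?thesis .
  qed
  obtain d where d: "d \<in> Hm Z Z" "d \<cdot> (c' \<cdot> c) = one Z"
    using cone_iso_endo[OF t cmp_hom[OF c(1) c'(1)] 1 2] by blast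
  obtain e where e: "e \<in> Hm Z' Z'" "(c \<cdot> c') \<cdot> e = one Z'"
    using cone_iso_endo[OF t' cmp_hom[OF c'(1) c(1)] 3 4] by blast
  \<comment> \<open>Invertibility of the composites gives \<open>c\<close> a left and a right
    inverse; these coincide.\<close>
  have "d \<cdot> c' = c' \<cdot> e"
  proof -
    have "d \<cdot> c' = (d \<cdot> c') \<cdot> ((c \<cdot> c') \<cdot> e)" using d c c' e by (simp add: Hom_def)
    also have "\<dots> = (d \<cdot> (c' \<cdot> c)) \<cdot> (c' \<cdot> e)"  using d(1) c(1) c'(1) e(1) by (simp add: Hom_def)
    also have "\<dots> = c' \<cdot> e" using d c' e by (simp add: Hom_def)
    finally show ?thesis .
  qed
  moreover have "(d \<cdot> c') \<cdot> c = one Z" using d c c' by (simp add: Hom_def)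
  moreover have "c \<cdot> (c' \<cdot> e) = one Z'" using e c c' by (simp add: Hom_def)
  ultimately have "is_iso T Z Z' c" unfolding is_iso_def using c c' d e
    by (intro conjI bexI[of _ "d \<cdot> c'"]) (auto intro: cmp_hom)
  thus ?thesis using that c by blast
qed

section \<open>Calculus of the extension relation\<close>

lemma extD:
  assumes "ext T X Y Z"
  shows "X \<in> Ob" "Y \<in> Ob" "Z \<in> Ob"
proof -
  obtain u v w where "tri X Y Z u v w" using assms ext_def by metis
  from dist_triD(4-6)[OF this] show "X \<in> Ob" "Y \<in> Ob" "Z \<in> Ob" .
qed

lemma ext_iso:
  assumes "ext T X Y Z" "isom X X'" "isom Y Y'" "isom Z Z'"
  shows "ext T X' Y' Z'"
proof -
  obtain u v w where t: "tri X Y Z u v w" using assms ext_def by metis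
  note tD = dist_triD[OF t]
  obtain a where a: "is_iso T X X' a" using assms isomorphic_def by metis
  obtain b where b: "is_iso T Y Y' b" using assms isomorphic_def by metis
  obtain c where c: "is_iso T Z Z' c" using assms isomorphic_def by metis
  obtain a' where a': "is_iso T X' X a'" "a' \<cdot> a = one X" "a \<cdot> a' = one X'"
    using is_iso_sym[OF a] .
  obtain b' where b': "is_iso T Y' Y b'" "b' \<cdot> b = one Y" "b \<cdot> b' = one Y'"
    using is_iso_sym[OF b] .
  obtain c' where c': "is_iso T Z' Z c'" "c' \<cdot> c = one Z" "c \<cdot> c' = one Z'"
    using is_iso_sym[OF c] .
  note h = a b c a'(1) b'(1) c'(1)
  have H: "a \<in> Hm X X'" "b \<in> Hm Y Y'" "c \<in> Hm Z Z'"
    "a' \<in> Hm X' X" "b' \<in> Hm Y' Y" "c' \<in> Hm Z' Z"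
    using h by (auto simp: is_iso_def)
  have "tri X' Y' Z' (b \<cdot> (u \<cdot> a')) (c \<cdot> (v \<cdot> b')) (Sa a \<cdot> (w \<cdot> c'))"
  proof (rule tri_iso_closed[OF t _ _ _ a b c])
    show "b \<cdot> u = (b \<cdot> (u \<cdot> a')) \<cdot> a" "c \<cdot> v = (c \<cdot> (v \<cdot> b')) \<cdot> b" 
      "Sa a \<cdot> w = (Sa a \<cdot> (w \<cdot> c')) \<cdot> c"
      using H a' b' c' tD by (simp_all add: Hom_def)
  qed (use H tD in \<open>auto simp: Hom_def\<close>)
  thus ?thesis unfolding ext_def by blast
qed

lemma ext_rotate: "ext T X Y Z \<Longrightarrow> ext T Y Z (Sh X)"
  unfolding ext_def using rotate by blast

lemma ext_rotate_back:
  assumes "ext T Y Z (Sh X)" "X \<in> Ob"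
  shows "ext T X Y Z"
proof -
  obtain v w t where t: "tri Y Z (Sh X) v w t" using assms ext_def by metis
  note tD = dist_triD[OF t]
  \<comment> \<open>The sign cancels the one that rotation introduces.\<close>
  obtain u where u: "u \<in> Hm X Y" "Sa u = [-] t"
    using shA_full[OF neg_hom[OF tD(3)] assms(2) tD(4)] .
  hence "[-] (Sa u) = t" using tD by (simp add: Hom_def)
  thus ?thesis using rotate_back[of Y Z X v w u] t u unfolding ext_def by blast
qed

text \<open>Three rotations shift a triangle; the signs they leave on the maps are invisible to
  \<open>ext\<close>.\<close>

lemma ext_Sh: "ext T X Y Z \<Longrightarrow> ext T (Sh X) (Sh Y) (Sh Z)"
  by (intro ext_rotate)

lemma ext_Sh_back:
  assumes "ext T (Sh X) (Sh Y) (Sh Z)" "X \<in> Ob" "Y \<in> Ob" "Z \<in> Ob"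
  shows "ext T X Y Z"
  using assms ext_rotate_back by blast

lemma ext_iso_zero:
  assumes "isom X Y" "zero_object T Z"
  shows "ext T X Y Z" "ext T Z X Y"
proof -
  have obj: "X \<in> Ob" "Y \<in> Ob" "Z \<in> Ob"
    using isomorphic_obj[OF assms(1)] assms(2)[unfolded zero_object_iff] by auto
  have *: "ext T X Y Z" if Z: "zero_object T Z" for Z
  proof -
    have "ext T X X Z" using tri_ident[OF obj(1) Z] unfolding ext_def by blast
    from ext_iso[OF this isomorphic_refl[OF obj(1)] assms(1) isomorphic_refl] show ?thesis
      using Z zero_object_iff by blast
  qed
  show "ext T X Y Z" using * assms by blast
  have "zero_object T (Sh Z)"
    using assms(2) shA_ident[of Z] shA_zero[of Z Z] unfolding zero_object_iff by auto
  hence "ext T X Y (Sh Z)" using * by blast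
  thus "ext T Z X Y" using ext_rotate_back obj by blast
qed

text \<open>The cone of \<open>v\<close> is only isomorphic to a shift, so it has to be replaced by
  \<open>Sh X\<close> before the triangle can be rotated back.\<close>

lemma ext_exists_fibre:
  assumes "v \<in> Hm Y Z"
  obtains X u w where "tri X Y Z u v w"
proof -
  have obj: "Y \<in> Ob" "Z \<in> Ob" using Hom_objD[OF assms] by auto
  obtain W a b where t: "tri Y Z W v a b" using tri_complete[OF assms] by blast
  note tD = dist_triD[OF t]
  obtain X where X: "X \<in> Ob" "isom (Sh X) W" using desusp[OF tD(6)] .
  then obtain s where s: "is_iso T W (Sh X) s" using isomorphic_sym isomorphic_def by metis
  obtain s' where s': "is_iso T (Sh X) W s'" "s' \<cdot> s = one W" "s \<cdot> s' = one (Sh X)"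
    using is_iso_sym[OF s] .
  have S: "s \<in> Hm W (Sh X)" "s' \<in> Hm (Sh X) W" using s s' by (auto simp: is_iso_def)
  have t2: "tri Y Z (Sh X) v (s \<cdot> a) (b \<cdot> s')"
    by (rule tri_iso_closed[OF t _ _ _ is_iso_ident[OF obj(1)] is_iso_ident[OF obj(2)] s])
      (use S s' tD assms in \<open>auto simp: Hom_def\<close>)
  note tD2 = dist_triD[OF t2]
  obtain u where u: "u \<in> Hm X Y" "Sa u = [-] (b \<cdot> s')"
    using shA_full[OF neg_hom[OF tD2(3)] X(1) obj(1)] .
  hence "[-] (Sa u) = b \<cdot> s'" using tD2 by (simp add: Hom_def)
  thus ?thesis using rotate_back[of Y Z X v "s \<cdot> a" u] t2 u that by auto
qed

text \<open>The octahedron on \<open>X -> W -> V\<close>: membership of \<open>V\<close> in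
  \<open>(X * Z') * Y'\<close> becomes membership in \<open>X * (Z' * Y')\<close>.\<close>

lemma ext_assoc:
  assumes "ext T X W Z'" "ext T W V Y'"
  obtains U where "ext T X V U" "ext T Z' U Y'"
proof -
  obtain u i i' where t1: "tri X W Z' u i i'" using assms ext_def by metis
  obtain v j j' where t2: "tri W V Y' v j j'" using assms ext_def by metis
  have vu: "v \<cdot> u \<in> Hm X V" using cmp_hom dist_triD(1)[OF t1] dist_triD(1)[OF t2] by blast
  obtain U k k' where t3: "tri X V U (v \<cdot> u) k k'" using tri_complete[OF vu] by blast
  obtain f g where "tri Z' U Y' f g (Sa i \<cdot> j')" using octahedral[OF t1 t2 t3] by blast
  hence "ext T Z' U Y'" by (auto simp: ext_def)
  moreover have "ext T X V U" using t3 by (auto simp: ext_def)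
  ultimately show ?thesis using that by simp
qed

text \<open>The opposite direction of associativity. The octahedron on \<open>V -> U -> Y\<close>,
  taken from the rotated triangles, produces the shift of the required object
  \<open>W\<close>.\<close>

lemma ext_assoc':
  assumes "ext T X V U" "ext T Z U Y"
  obtains W where "ext T X W Z" "ext T W V Y"
proof -
  have obj: "X \<in> Ob" "Y \<in> Ob" "Z \<in> Ob" "U \<in> Ob" using assms extD by blast+
  obtain R where R: "ext T V Y R" "ext T (Sh X) R (Sh Z)"
    using ext_assoc[OF ext_rotate[OF assms(1)] ext_rotate[OF assms(2)]] .
  obtain W where W: "W \<in> Ob" "isom (Sh W) R" using desusp[OF extD(2)[OF R(2)]] .
  have iso: "isom R (Sh W)" using W isomorphic_sym by blast
  have "ext T V Y (Sh W)" "ext T (Sh X) (Sh W) (Sh Z)"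
    using ext_iso[OF R(1) isomorphic_refl isomorphic_refl iso] ext_iso[OF R(2) isomorphic_refl iso isomorphic_refl]
      extD[OF R(1)] extD[OF R(2)] by simp_all
  hence "ext T W V Y" "ext T X W Z" using ext_rotate_back ext_Sh_back W obj by blast+
  thus ?thesis by (rule that[rotated])
qed

text \<open>The cone \<open>C\<close> of the split monomorphism \<open>p\<close> has zero connecting
  map, and the factorisation of \<open>r\<close> through \<open>C\<close> is an isomorphism onto
  \<open>Z\<close> with inverse \<open>v \<cdot> s\<close>.\<close>

lemma biproduct_ext:
  assumes p: "p \<in> Hm X Y" "q \<in> Hm Y X" "q \<cdot> p = one X"
    and r: "r \<in> Hm Y Z" "s \<in> Hm Z Y" "r \<cdot> s = one Z"
    and sum: "p \<cdot> q [+] s \<cdot> r = one Y"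
  shows "ext T X Y Z"
proof -
  have obj: "X \<in> Ob" "Y \<in> Ob" "Z \<in> Ob" using p r Hom_objD by blast+
  obtain C v w where t: "tri X Y C p v w" using tri_complete[OF p(1)] by blast
  note tD = dist_triD[OF t]
  have w0: "w = zer C (Sh X)"
  proof -
    have "Sa q \<cdot> (Sa p \<cdot> w) = one (Sh X) \<cdot> w"
      using cmp_cong[of "Sa q" "Sa p" "one (Sh X)" w] shA_cmp[of p q] p tD by (simp add: Hom_def)
    thus ?thesis using tri_cmp_zero[OF t] p tD by (simp add: Hom_def)
  qed
  \<comment> \<open>Applying \<open>r\<close> to the decomposition of the identity leaves
    \<open>r \<cdot> p \<cdot> q = 0\<close>, and \<open>q\<close> has the section
    \<open>p\<close>.\<close>
  have rp: "r \<cdot> p = zer X Z"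
  proof -
    have 1: "r \<cdot> (p \<cdot> q [+] s \<cdot> r) = r" using sum r by (simp add: Hom_def)
    have "r \<cdot> (p \<cdot> q) [+] r \<cdot> (s \<cdot> r) = r" using p r 1 by (simp add: Hom_def)
    moreover have "r \<cdot> (s \<cdot> r) = r" using cmp_cong[OF r(3), of r] r by (simp add: Hom_def)
    ultimately have "r [+] r \<cdot> (p \<cdot> q) = r [+] zer Y Z"
      using p r by (simp add: Hom_def hadd_ac)
    hence z: "r \<cdot> (p \<cdot> q) = zer Y Z"
      by (rule hadd_cancel(1)[rotated -1]) (use p r obj in \<open>auto simp: Hom_def\<close>)
    have "(r \<cdot> (p \<cdot> q)) \<cdot> p = r \<cdot> p" using p r by (simp add: Hom_def)
    thus ?thesis using z p obj by (simp add: Hom_def)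
  qed
  obtain c where c: "c \<in> Hm C Z" "c \<cdot> v = r" using tri_factor_right[OF t r(1) rp] .
  have vs: "v \<cdot> s \<in> Hm Z C" using cmp_hom r tD by blast
  have 1: "c \<cdot> (v \<cdot> s) = one Z"
    using cmp_cong[OF c(2), of s] c r tD by (simp add: Hom_def)
  have vsr: "v \<cdot> (s \<cdot> r) = v"
  proof -
    have "v \<cdot> (p \<cdot> q [+] s \<cdot> r) = v" using sum tD by (simp add: Hom_def)
    moreover have "v \<cdot> (p \<cdot> q) = zer Y C"
      using cmp_cong[OF tri_cmp_zero(1)[OF t], of q] p tD by (simp add: Hom_def)
    ultimately show ?thesis using p r tD by (simp add: Hom_def)
  qed
  have 2: "(v \<cdot> s) \<cdot> c = one C"
  proof -
    define n where "n = (v \<cdot> s) \<cdot> c [+] ([-] (one C))"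
    have n: "n \<in> Hm C C" using vs c tD by (simp add: n_def Hom_def)
    have "n \<cdot> v = zer Y C" using vs c r tD vsr by (simp add: n_def Hom_def)
    then obtain k where "k \<in> Hm (Sh X) C" "k \<cdot> w = n" using tri_factor_right2[OF t n] by blast
    hence "n = zer C C" using w0 tD by (simp add: Hom_def)
    thus ?thesis unfolding n_def by (rule diff_eq_zero) (use vs c tD in \<open>auto simp: Hom_def\<close>)
  qed
  have "is_iso T C Z c" unfolding is_iso_def using c vs 1 2 by blast
  hence "isom C Z" unfolding isomorphic_def by (rule exI)
  moreover have "ext T X Y C" using t unfolding ext_def by blast
  ultimately show ?thesis using ext_iso[OF _ isomorphic_refl[OF obj(1)] isomorphic_refl[OF obj(2)]] by simp
qed

text \<open>A section \<open>s\<close> of \<open>v\<close> exists because the connecting map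
  vanishes; \<open>1 - s \<cdot> v\<close> is then killed by \<open>v\<close>, and its factorisation
  through \<open>u\<close> is the retraction \<open>q\<close>.\<close>

lemma split_biproduct:
  assumes t: "tri X Y Z u v (zer Z (Sh X))"
  obtains q s where "q \<in> Hm Y X" "s \<in> Hm Z Y" "q \<cdot> u = one X" "v \<cdot> s = one Z"
    "u \<cdot> q [+] s \<cdot> v = one Y"
proof -
  note tD = dist_triD[OF t]
  obtain s where s: "s \<in> Hm Z Y" "v \<cdot> s = one Z"
    using tri_factor_left2[OF t ident_hom[OF tD(6)]] tD by auto
  define e where "e = one Y [+] ([-] (s \<cdot> v))"
  have e: "e \<in> Hm Y Y" using s tD by (simp add: e_def Hom_def)
  have "v \<cdot> (s \<cdot> v) = v" using cmp_cong[OF s(2), of v] s tD by (simp add: Hom_def)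
  hence "v \<cdot> e = zer Y Z" using s tD by (simp add: e_def Hom_def)
  then obtain q where q: "q \<in> Hm Y X" "u \<cdot> q = e" using tri_factor_left[OF t e] by blast
  have sum: "u \<cdot> q [+] s \<cdot> v = one Y"
    using q s tD by (simp add: e_def Hom_def hadd_ac)
  define n where "n = q \<cdot> u [+] ([-] (one X))"
  have n: "n \<in> Hm X X" using q tD by (simp add: n_def Hom_def)
  have svu: "s \<cdot> (v \<cdot> u) = zer X Y" using tri_cmp_zero(1)[OF t] s tD by (simp add: Hom_def)
  have "u \<cdot> n = zer X Y"
  proof -
    have "u \<cdot> (q \<cdot> u) = e \<cdot> u" using cmp_cong[OF q(2), of u] q tD by (simp add: Hom_def)
    also have "\<dots> = u" using s tD svu by (simp add: e_def Hom_def)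
    finally show ?thesis using q tD by (simp add: n_def Hom_def)
  qed
  \<comment> \<open>After a shift, a map killed by \<open>u\<close> factors through the connecting
    map, here zero; faithfulness of the shift then gives \<open>n = 0\<close>.\<close>
  hence "Sa u \<cdot> Sa n = zer (Sh X) (Sh Y)" using shA_cmp[of n u] n tD by (simp add: Hom_def)
  then obtain h where h: "h \<in> Hm (Sh X) Z" "zer Z (Sh X) \<cdot> h = Sa n"
    using tri_factor_left3[OF t shA_hom[OF n]] by blast
  hence "Sa n = Sa (zer X X)" using tD by (simp add: Hom_def)
  hence "n = zer X X" using shA_inj n zero_hom tD by blast
  hence "q \<cdot> u = one X" unfolding n_def by (rule diff_eq_zero) (use q tD in \<open>auto simp: Hom_def\<close>)
  thus ?thesis using that q s sum by blast
qed

text \<open>The connecting map lies in the vanishing group, so the triangle splits, and a biproduct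
  can be read as a triangle in either order.\<close>

lemma ext_swap:
  assumes "ext T X Y Z" "orth T Z (Sh X)"
  shows "ext T Z Y X"
proof -
  obtain u v w where t: "tri X Y Z u v w" using assms ext_def by metis
  note tD = dist_triD[OF t]
  have t0: "tri X Y Z u v (zer Z (Sh X))" using t orthD[OF assms(2) tD(3)] by simp
  obtain q s where qs: "q \<in> Hm Y X" "s \<in> Hm Z Y" "q \<cdot> u = one X" "v \<cdot> s = one Z"
    "u \<cdot> q [+] s \<cdot> v = one Y" using split_biproduct[OF t0] .
  show ?thesis
    by (rule biproduct_ext[OF qs(2) tD(2) qs(4) qs(1) tD(1) qs(3)])
      (use qs tD in \<open>simp add: Hom_def hadd_ac\<close>)
qed

text \<open>Since \<open>X -> F -> Z'\<close> vanishes, \<open>X\<close> maps to \<open>X'\<close>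
  over \<open>F\<close>, and symmetrically; the same happens under \<open>F\<close> for
  \<open>Z\<close> and \<open>Z'\<close>. Vanishing on the shifted objects makes these
  factorisations unique, so they are mutually inverse.\<close>

lemma decomposition_unique:
  assumes "ext T X F Z" "ext T X' F Z'"
    and o: "orth T X Z'" "orth T X' Z" "orth T (Sh X) Z" "orth T (Sh X') Z'"
  shows "isom X X'" "isom Z Z'"
proof -
  obtain u v w where t: "tri X F Z u v w" using assms ext_def by metis
  obtain u' v' w' where t': "tri X' F Z' u' v' w'" using assms ext_def by metis
  note tD = dist_triD[OF t] and tD' = dist_triD[OF t']
  \<comment> \<open>If \<open>u\<close> kills \<open>d - 1\<close>, then the shift of
    \<open>d - 1\<close> factors through a map \<open>Sh X -> Z\<close>, which is zero.\<close>
  have l: "d = one X" if t: "tri X F Z u v w" and d: "d \<in> Hm X X" "u \<cdot> d = u"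
    and o: "orth T (Sh X) Z" for X Z u v w d
  proof -
    note tD = dist_triD[OF t]
    define n where "n = d [+] ([-] (one X))"
    have n: "n \<in> Hm X X" using d tD by (simp add: n_def Hom_def)
    have "u \<cdot> n = zer X F" using d tD by (simp add: n_def Hom_def)
    hence "Sa u \<cdot> Sa n = zer (Sh X) (Sh F)" using shA_cmp[of n u] n tD by (simp add: Hom_def)
    then obtain h where h: "h \<in> Hm (Sh X) Z" "w \<cdot> h = Sa n"
      using tri_factor_left3[OF t shA_hom[OF n]] by blast
    hence "h = zer (Sh X) Z" using orthD o by blast
    hence "Sa n = Sa (zer X X)" using tD h by (simp add: Hom_def)
    hence "n = zer X X" using shA_inj n zero_hom tD by blast
    thus "d = one X" unfolding n_def by (rule diff_eq_zero) (use d tD in \<open>auto simp: Hom_def\<close>)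
  qed
  have r: "d = one Z" if t: "tri X F Z u v w" and d: "d \<in> Hm Z Z" "d \<cdot> v = v"
    and o: "orth T (Sh X) Z" for X Z u v w d
  proof -
    note tD = dist_triD[OF t]
    define n where "n = d [+] ([-] (one Z))"
    have n: "n \<in> Hm Z Z" using d tD by (simp add: n_def Hom_def)
    have "n \<cdot> v = zer F Z" using d tD by (simp add: n_def Hom_def)
    then obtain h where h: "h \<in> Hm (Sh X) Z" "h \<cdot> w = n"
      using tri_factor_right2[OF t n] by blast
    hence "h = zer (Sh X) Z" using orthD o by blast
    hence "n = zer Z Z" using tD h by (auto simp: Hom_def)
    thus "d = one Z" unfolding n_def by (rule diff_eq_zero) (use d tD in \<open>auto simp: Hom_def\<close>)
  qed
  have "v' \<cdot> u = zer X Z'" "v \<cdot> u' = zer X' Z" using orthD o cmp_hom tD tD' by blast+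
  then obtain f f' g g' where f: "f \<in> Hm X X'" "u' \<cdot> f = u" and f': "f' \<in> Hm X' X" "u \<cdot> f' = u'"
    and g: "g \<in> Hm Z Z'" "g \<cdot> v = v'" and g': "g' \<in> Hm Z' Z" "g' \<cdot> v' = v"
    using tri_factor_left[OF t' tD(1)] tri_factor_left[OF t tD'(1)]
      tri_factor_right[OF t tD'(2)] tri_factor_right[OF t' tD(2)] by metis
  have "f' \<cdot> f = one X" by (rule l[OF t]) (use f f' o cmp_cong[OF f'(2), of f] tD in \<open>auto simp: Hom_def\<close>)
  moreover have "f \<cdot> f' = one X'" by (rule l[OF t']) (use f f' o cmp_cong[OF f(2), of f'] tD' in \<open>auto simp: Hom_def\<close>)
  ultimately show "isom X X'" unfolding isomorphic_def is_iso_def using f f' by blast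
  have "g' \<cdot> g = one Z" by (rule r[OF t]) (use g g' o tD in \<open>auto simp: Hom_def\<close>)
  moreover have "g \<cdot> g' = one Z'" by (rule r[OF t']) (use g g' o tD' in \<open>auto simp: Hom_def\<close>)
  ultimately show "isom Z Z'" unfolding isomorphic_def is_iso_def using g g' by blast
qed

end

subsection \<open>Semiorthogonal decompositions and full subcategories\<close>

context category begin

section \<open>Coproducts as existence and uniqueness of factorisations\<close>

lemma coproduct_obj: "is_coproduct C I X P \<iota> \<Longrightarrow> P \<in> Obj C"
  and coproduct_inj: "is_coproduct C I X P \<iota> \<Longrightarrow> i \<in> I \<Longrightarrow> \<iota> i \<in> Hom C (X i) P"
  by (simp_all add: is_coproduct_def)

lemma coproduct_factor:
  assumes "is_coproduct C I X P \<iota>" "Q \<in> Obj C" "\<And>i. i \<in> I \<Longrightarrow> f i \<in> Hom C (X i) Q"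
  obtains h where "h \<in> Hom C P Q" "\<And>i. i \<in> I \<Longrightarrow> h \<cdot> \<iota> i = f i"
proof -
  have "\<forall>f. (\<forall>i\<in>I. f i \<in> Hom C (X i) Q) \<longrightarrow> (\<exists>!h. h \<in> Hom C P Q \<and> (\<forall>i\<in>I. h \<cdot> \<iota> i = f i))"
    using assms(1,2) unfolding is_coproduct_def by simp
  hence "\<exists>h. h \<in> Hom C P Q \<and> (\<forall>i\<in>I. h \<cdot> \<iota> i = f i)" using assms(3) by blast
  thus ?thesis using that by auto
qed

lemma coproduct_eqI:
  assumes "is_coproduct C I X P \<iota>" "h \<in> Hom C P Q" "h' \<in> Hom C P Q"
    and "\<And>i. i \<in> I \<Longrightarrow> h \<cdot> \<iota> i = h' \<cdot> \<iota> i"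
  shows "h = h'"
proof -
  have Q: "Q \<in> Obj C" using Hom_objD(2)[OF assms(2)] .
  have in': "\<forall>i\<in>I. h' \<cdot> \<iota> i \<in> Hom C (X i) Q" using coproduct_inj[OF assms(1)] cmp_hom[OF _ assms(3)] by blast
  have "\<forall>f. (\<forall>i\<in>I. f i \<in> Hom C (X i) Q) \<longrightarrow> (\<exists>!h. h \<in> Hom C P Q \<and> (\<forall>i\<in>I. h \<cdot> \<iota> i = f i))"
    using assms(1) Q unfolding is_coproduct_def by simp
  from this[rule_format, of "\<lambda>i. h' \<cdot> \<iota> i"] in'
  have "\<exists>!k. k \<in> Hom C P Q \<and> (\<forall>i\<in>I. k \<cdot> \<iota> i = h' \<cdot> \<iota> i)" by simp
  thus ?thesis using assms(2-4) by blast
qed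

lemma coproductI:
  assumes "P \<in> Obj C" "\<And>i. i \<in> I \<Longrightarrow> \<iota> i \<in> Hom C (X i) P"
    and "\<And>Q f. Q \<in> Obj C \<Longrightarrow> (\<And>i. i \<in> I \<Longrightarrow> f i \<in> Hom C (X i) Q)
      \<Longrightarrow> \<exists>h \<in> Hom C P Q. \<forall>i \<in> I. h \<cdot> \<iota> i = f i"
    and "\<And>Q h h'. h \<in> Hom C P Q \<Longrightarrow> h' \<in> Hom C P Q \<Longrightarrow> (\<And>i. i \<in> I \<Longrightarrow> h \<cdot> \<iota> i = h' \<cdot> \<iota> i) \<Longrightarrow> h = h'"
  shows "is_coproduct C I X P \<iota>"
  unfolding is_coproduct_def
proof (intro conjI ballI allI impI)
  fix Q f assume Q: "Q \<in> Obj C" and f: "\<forall>i\<in>I. f i \<in> Hom C (X i) Q"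
  obtain h where h: "h \<in> Hom C P Q" "\<forall>i \<in> I. h \<cdot> \<iota> i = f i" using assms(3)[of Q f] Q f by auto
  show "\<exists>!h. h \<in> Hom C P Q \<and> (\<forall>i\<in>I. h \<cdot> \<iota> i = f i)"
  proof (rule ex1I[of _ h])
    show "k = h" if "k \<in> Hom C P Q \<and> (\<forall>i\<in>I. k \<cdot> \<iota> i = f i)" for k
      by (rule assms(4)[of k Q h]) (use that h in auto)
  qed (use h in auto)
qed (use assms in auto)

end

context triangulated_category begin

text \<open>This is what keeps binary coproducts inside a triangulated subcategory.\<close>

lemma binary_coproduct_ext:
  assumes P: "is_coproduct T (UNIV :: bool set) (\<lambda>b. if b then X else Y) P \<iota>"
    and obj: "X \<in> Ob" "Y \<in> Ob"
  shows "ext T X P Y"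
proof -
  have inj: "\<iota> True \<in> Hm X P" "\<iota> False \<in> Hm Y P"
    using coproduct_inj[OF P, of True] coproduct_inj[OF P, of False] by auto
  have Po: "P \<in> Ob" using coproduct_obj[OF P] .
  obtain q where q: "q \<in> Hm P X" "\<And>b. q \<cdot> \<iota> b = (if b then one X else zer Y X)"
  proof (rule coproduct_factor[OF P obj(1)])
    show "(if b then one X else zer Y X) \<in> Hm (if b then X else Y) X" for b
      using ident_hom obj zero_hom by simp
  qed auto
  obtain r where r: "r \<in> Hm P Y" "\<And>b. r \<cdot> \<iota> b = (if b then zer X Y else one Y)"
  proof (rule coproduct_factor[OF P obj(2)])
    show "(if b then zer X Y else one Y) \<in> Hm (if b then X else Y) Y" for b
      using ident_hom obj zero_hom by simp
  qed auto
  have "\<iota> True \<cdot> q [+] \<iota> False \<cdot> r = one P"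
  proof (rule coproduct_eqI[OF P, of _ P])
    show "(\<iota> True \<cdot> q [+] \<iota> False \<cdot> r) \<cdot> \<iota> b = one P \<cdot> \<iota> b" for b
      using inj q r obj Po by (cases b) (simp_all add: Hom_def)
  qed (use inj q(1) r(1) Po in \<open>auto simp: Hom_def\<close>)
  thus ?thesis
    using biproduct_ext[OF inj(1) q(1) _ r(1) inj(2)] q(2)[of True] r(2)[of False] by simp
qed

section \<open>Triangulated subcategories and the product \<open>B * A\<close>\<close>

lemma tri_subD:
  assumes "tri_sub A"
  shows tri_sub_obj: "X \<in> A \<Longrightarrow> X \<in> Ob"
    and tri_sub_zero: "zero_object T Z \<Longrightarrow> Z \<in> A"
    and tri_sub_iso: "isom X Y \<Longrightarrow> X \<in> A \<Longrightarrow> Y \<in> A"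
    and tri_sub_Sh: "X \<in> Ob \<Longrightarrow> Sh X \<in> A \<longleftrightarrow> X \<in> A"
    and tri_sub_cone: "ext T X Y Z \<Longrightarrow> X \<in> A \<Longrightarrow> Y \<in> A \<Longrightarrow> Z \<in> A"
  using assms unfolding triangulated_subcategory_def ext_def by blast+

lemma tri_sub_ext:
  assumes "tri_sub A" "ext T X Y Z"
  shows "X \<in> A \<Longrightarrow> Z \<in> A \<Longrightarrow> Y \<in> A" "Y \<in> A \<Longrightarrow> Z \<in> A \<Longrightarrow> X \<in> A"
proof -
  note o = extD[OF assms(2)]
  have c: "ext T Y Z (Sh X)" "ext T Z (Sh X) (Sh Y)" using ext_rotate assms(2) by blast+
  show "X \<in> A \<Longrightarrow> Z \<in> A \<Longrightarrow> Y \<in> A"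
    using tri_sub_cone[OF assms(1) c(2)] tri_sub_Sh[OF assms(1)] o by simp
  show "Y \<in> A \<Longrightarrow> Z \<in> A \<Longrightarrow> X \<in> A"
    using tri_sub_cone[OF assms(1) c(1)] tri_sub_Sh[OF assms(1)] o by simp
qed

lemma tri_sub_desusp:
  assumes "tri_sub A" "X \<in> A"
  obtains Y where "Y \<in> A" "isom X (Sh Y)"
proof -
  obtain Y where Y: "Y \<in> Ob" "isom (Sh Y) X"
    using desusp[OF tri_sub_obj[OF assms]] .
  have i: "isom X (Sh Y)" using isomorphic_sym[OF Y(2)] .
  have "Y \<in> A" using tri_sub_iso[OF assms(1) i assms(2)] tri_sub_Sh[OF assms(1) Y(1)] by simp
  thus ?thesis using that i by blast
qed

text \<open>Closure under cones follows from closure under extensions, because rotation presents the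
  cone \<open>Z\<close> as an extension of \<open>Sh X\<close> by \<open>Y\<close>.\<close>

lemma tri_subI:
  assumes "A \<subseteq> Ob" and "\<And>Z. zero_object T Z \<Longrightarrow> Z \<in> A"
    and "\<And>X Y. isom X Y \<Longrightarrow> X \<in> A \<Longrightarrow> Y \<in> A"
    and "\<And>X. X \<in> A \<Longrightarrow> Sh X \<in> A" and "\<And>X. X \<in> Ob \<Longrightarrow> Sh X \<in> A \<Longrightarrow> X \<in> A"
    and "\<And>X Y Z. ext T X Y Z \<Longrightarrow> X \<in> A \<Longrightarrow> Z \<in> A \<Longrightarrow> Y \<in> A"
  shows "tri_sub A"
  unfolding triangulated_subcategory_def
proof (intro conjI allI impI ballI)
  fix X Y Z u v w assume t: "tri X Y Z u v w \<and> X \<in> A \<and> Y \<in> A"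
  hence "ext T X Y Z" unfolding ext_def by blast
  hence "ext T Y Z (Sh X)" by (rule ext_rotate)
  thus "Z \<in> A" using assms(4,6) t by blast
next
  show "A \<subseteq> Ob" by fact
  show "Sh X \<in> A \<longleftrightarrow> X \<in> A" if "X \<in> Ob" for X using assms(4,5) that by blast
qed (use assms(2,3) in blast)+

text \<open>\<open>(b * a) * (b' * a') = b * (a * b') * a'\<close>, and the inner extension splits.\<close>

lemma ext_interchange:
  assumes "ext T X Y Z" "ext T b X a" "ext T b' Z a'" "orth T b' (Sh a)"
  obtains b'' a'' where "ext T b b'' b'" "ext T b'' Y a''" "ext T a a'' a'"
proof -
  obtain U where U: "ext T b Y U" "ext T a U Z" using ext_assoc[OF assms(2,1)] .
  obtain W where W: "ext T a W b'" "ext T W U a'" using ext_assoc'[OF U(2) assms(3)] .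
  obtain a'' where a'': "ext T b' U a''" "ext T a a'' a'"
    using ext_assoc[OF ext_swap[OF W(1) assms(4)] W(2)] .
  obtain b'' where "ext T b b'' b'" "ext T b'' Y a''" using ext_assoc'[OF U(1) a''(1)] .
  thus ?thesis using that a'' by blast
qed

text \<open>The hull of \<open>A \<union> B\<close> therefore lies in \<open>B * A\<close>, which
  turns the generation clause of a semiorthogonal decomposition into a triangle for each object.
  Extensions are handled by \<open>ext_interchange\<close>; its splitting condition holds as
  \<open>A\<close> is stable under the shift.\<close>

lemma star_triangulated:
  assumes A: "tri_sub A" and B: "tri_sub B"
    and o: "\<And>X Y. X \<in> B \<Longrightarrow> Y \<in> A \<Longrightarrow> orth T X Y"
  shows "tri_sub {F. \<exists>b\<in>B. \<exists>a\<in>A. ext T b F a}" (is "tri_sub ?S")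
proof (rule tri_subI)
  show "?S \<subseteq> Ob" using extD by blast
  show "Z \<in> ?S" if "zero_object T Z" for Z
    using ext_iso_zero(1)[OF isomorphic_refl that] tri_sub_zero[OF A that] tri_sub_zero[OF B that]
      tri_sub_obj[OF A] by blast
  show "Y \<in> ?S" if i: "isom X Y" and "X \<in> ?S" for X Y
  proof -
    obtain b a where ba: "b \<in> B" "a \<in> A" "ext T b X a" using \<open>X \<in> ?S\<close> by blast
    have "ext T b Y a" using ext_iso[OF ba(3) isomorphic_refl i isomorphic_refl] extD[OF ba(3)] by blast
    thus ?thesis using ba by blast
  qed
  show "Sh X \<in> ?S" if "X \<in> ?S" for X
  proof -
    obtain b a where ba: "b \<in> B" "a \<in> A" "ext T b X a" using \<open>X \<in> ?S\<close> by blast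
    have "Sh b \<in> B" "Sh a \<in> A" using tri_sub_Sh[OF A] tri_sub_Sh[OF B] ba extD[OF ba(3)] by auto
    thus ?thesis using ext_Sh[OF ba(3)] by blast
  qed
  show "X \<in> ?S" if X: "X \<in> Ob" and "Sh X \<in> ?S" for X
  proof -
    obtain b a where ba: "b \<in> B" "a \<in> A" "ext T b (Sh X) a" using \<open>Sh X \<in> ?S\<close> by blast
    obtain b' where b': "b' \<in> B" "isom b (Sh b')" using tri_sub_desusp[OF B ba(1)] .
    obtain a' where a': "a' \<in> A" "isom a (Sh a')" using tri_sub_desusp[OF A ba(2)] .
    have "ext T (Sh b') (Sh X) (Sh a')"
      using ext_iso[OF ba(3) b'(2) isomorphic_refl a'(2)] extD[OF ba(3)] by blast
    hence "ext T b' X a'" using ext_Sh_back X tri_sub_obj[OF A a'(1)] tri_sub_obj[OF B b'(1)] by blast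
    thus ?thesis using a' b' by blast
  qed
  show "Y \<in> ?S" if t: "ext T X Y Z" and "X \<in> ?S" "Z \<in> ?S" for X Y Z
  proof -
    obtain b a where ba: "b \<in> B" "a \<in> A" "ext T b X a" using \<open>X \<in> ?S\<close> by blast
    obtain b' a' where ba': "b' \<in> B" "a' \<in> A" "ext T b' Z a'" using \<open>Z \<in> ?S\<close> by blast
    have "orth T b' (Sh a)" using o ba ba' tri_sub_Sh[OF A] extD[OF ba(3)] by blast
    from ext_interchange[OF t ba(3) ba'(3) this] obtain b'' a''
      where r: "ext T b b'' b'" "ext T b'' Y a''" "ext T a a'' a'" .
    have "b'' \<in> B" "a'' \<in> A"
      using tri_sub_ext(1)[OF B r(1)] tri_sub_ext(1)[OF A r(3)] ba ba' by blast+
    thus ?thesis using r by blast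
  qed
qed

end

lemma (in triangulated_category) semiorthogonal_decompositionI:
  assumes A: "triangulated_subcategory T A" and B: "triangulated_subcategory T B"
    and o: "\<And>X Y. X \<in> B \<Longrightarrow> Y \<in> A \<Longrightarrow> orth T X Y"
    and gen: "\<And>F. F \<in> Obj T \<Longrightarrow> \<exists>b\<in>B. \<exists>a\<in>A. ext T b F a"
  shows "semiorthogonal_decomposition T A B"
proof -
  have "F \<in> D" if F: "F \<in> Obj T" and D: "triangulated_subcategory T D" "A \<union> B \<subseteq> D" for F D
  proof -
    obtain b a where "b \<in> B" "a \<in> A" "ext T b F a" using gen[OF F] by blast
    thus ?thesis using tri_sub_ext(1)[OF D(1)] D(2) by blast
  qed
  \<comment> \<open>The whole category is a member of the family intersected in the hull, which
    bounds the hull from above.\<close>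
  moreover have "triangulated_subcategory T (Obj T)"
    by (rule tri_subI) (auto simp: zero_object_iff isomorphic_obj extD)
  moreover have "A \<union> B \<subseteq> Obj T" using tri_sub_obj[OF A] tri_sub_obj[OF B] by blast
  ultimately have "triangulated_hull T (A \<union> B) = Obj T" unfolding triangulated_hull_def by blast
  thus ?thesis unfolding semiorthogonal_decomposition_def
    using A B o triangulated_category_axioms unfolding orth_def by blast
qed

lemma semiorthogonal_decompositionD:
  assumes "semiorthogonal_decomposition S A B"
  shows "triangulated_category S" "triangulated_subcategory S A" "triangulated_subcategory S B"
    and "\<And>X Y. X \<in> B \<Longrightarrow> Y \<in> A \<Longrightarrow> orth S X Y"
    and "\<And>F. F \<in> Obj S \<Longrightarrow> \<exists>b\<in>B. \<exists>a\<in>A. ext S b F a"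
proof -
  show S: "triangulated_category S" and A: "triangulated_subcategory S A" and B: "triangulated_subcategory S B"
    and o: "\<And>X Y. X \<in> B \<Longrightarrow> Y \<in> A \<Longrightarrow> orth S X Y"
    using assms unfolding semiorthogonal_decomposition_def orth_def by blast+
  interpret triangulated_category S by fact
  let ?S = "{F. \<exists>b\<in>B. \<exists>a\<in>A. ext S b F a}"
  obtain Z where Z: "zero_object S Z" "Z \<in> Obj S" using zero_exists .
  have ZA: "Z \<in> A" "Z \<in> B" using tri_sub_zero[OF A Z(1)] tri_sub_zero[OF B Z(1)] .
  have "X \<in> ?S" if "X \<in> A" for X
    using ext_iso_zero(2)[OF isomorphic_refl Z(1)] tri_sub_obj[OF A that] that ZA by blast
  moreover have "X \<in> ?S" if "X \<in> B" for X
    using ext_iso_zero(1)[OF isomorphic_refl Z(1)] tri_sub_obj[OF B that] that ZA by blast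
  ultimately have "A \<union> B \<subseteq> ?S" by blast
  with star_triangulated[OF A B o] have "triangulated_hull S (A \<union> B) \<subseteq> ?S"
    unfolding triangulated_hull_def by blast
  moreover have "triangulated_hull S (A \<union> B) = Obj S"
    using assms unfolding semiorthogonal_decomposition_def by blast
  ultimately show "\<exists>b\<in>B. \<exists>a\<in>A. ext S b F a" if "F \<in> Obj S" for F using that by blast
qed

section \<open>Passing between a category and its full subcategories\<close>

lemma full_subcategory_simps [simp]:
  "Obj (full_subcategory T D) = D"
  "Arr (full_subcategory T D) = {f \<in> Arr T. src T f \<in> D \<and> tgt T f \<in> D}"
  "src (full_subcategory T D) = src T" "tgt (full_subcategory T D) = tgt T"
  "ident (full_subcategory T D) = ident T" "cmp (full_subcategory T D) = cmp T"
  "hadd (full_subcategory T D) = hadd T" "hzero (full_subcategory T D) = hzero T"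
  "shO (full_subcategory T D) = shO T" "shA (full_subcategory T D) = shA T"
  "distinguished (full_subcategory T D) = distinguished T"
  by (simp_all add: full_subcategory_def)

lemma Hom_full: "f \<in> Hom (full_subcategory T D) X Y \<longleftrightarrow> f \<in> Hom T X Y \<and> X \<in> D \<and> Y \<in> D"
  by (auto simp: Hom_def)

lemma Hom_full_eq: "X \<in> D \<Longrightarrow> Y \<in> D \<Longrightarrow> Hom (full_subcategory T D) X Y = Hom T X Y"
  by (auto simp: Hom_full)

lemma is_iso_full: "is_iso (full_subcategory T D) X Y f \<longleftrightarrow> is_iso T X Y f \<and> X \<in> D \<and> Y \<in> D"
  by (auto simp: is_iso_def Hom_full)

lemma isomorphic_full: "isomorphic (full_subcategory T D) X Y \<longleftrightarrow> isomorphic T X Y \<and> X \<in> D \<and> Y \<in> D"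
  by (auto simp: isomorphic_def is_iso_full)

lemma dist_tri_full:
  "dist_tri (full_subcategory T D) X Y Z u v w \<longleftrightarrow>
    dist_tri T X Y Z u v w \<and> X \<in> D \<and> Y \<in> D \<and> Z \<in> D \<and> shO T X \<in> D"
  by (auto simp: dist_tri_def Hom_full)

lemma ext_full:
  "ext (full_subcategory T D) X Y Z \<longleftrightarrow> ext T X Y Z \<and> X \<in> D \<and> Y \<in> D \<and> Z \<in> D \<and> shO T X \<in> D"
  by (auto simp: ext_def dist_tri_full)

lemma orth_full: "X \<in> D \<Longrightarrow> Y \<in> D \<Longrightarrow> orth (full_subcategory T D) X Y \<longleftrightarrow> orth T X Y"
  by (simp add: orth_def Hom_full_eq)

lemma hom_group_full:
  "X \<in> D \<Longrightarrow> Y \<in> D \<Longrightarrow> hom_group (full_subcategory T D) X Y = hom_group T X Y"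
  by (simp add: hom_group_def Hom_full_eq)

context triangulated_category begin

lemma zero_object_full:
  assumes "D \<subseteq> Ob"
  shows "zero_object (full_subcategory T D) Z \<longleftrightarrow> zero_object T Z \<and> Z \<in> D"
proof
  assume z: "zero_object (full_subcategory T D) Z"
  hence Z: "Z \<in> D" by (simp add: zero_object_def)
  hence "\<exists>!f. f \<in> Hm Z Z" using z by (auto simp: zero_object_def Hom_full)
  thus "zero_object T Z \<and> Z \<in> D"
    using Z assms ident_hom[of Z] zero_hom[of Z Z] unfolding zero_object_iff by blast
next
  assume "zero_object T Z \<and> Z \<in> D"
  thus "zero_object (full_subcategory T D) Z"
    using assms unfolding zero_object_def full_subcategory_simps by (simp add: Hom_full_eq subset_iff)
qed

text \<open>Axioms about given data restrict directly. Closure of \<open>D\<close> matters for the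
  objects that axioms produce: zero objects, binary coproducts, desuspensions and cones.\<close>

lemma full_subcategory_triangulated:
  assumes D: "tri_sub D"
  shows "triangulated_category (full_subcategory T D)"
proof -
  let ?S = "full_subcategory T D"
  have sub: "D \<subseteq> Ob" using tri_sub_obj[OF D] by blast
  have ShD: "Sh X \<in> D" if "X \<in> D" for X using tri_sub_Sh[OF D] that sub by blast
  show ?thesis
  proof (intro triangulated_category.intro additive_category.intro category.intro
      triangulated_category_axioms.intro additive_category_axioms.intro, goal_cases)
    case (3 X) thus ?case using ident_hom sub by (auto simp: Hom_full)
  next
    case (4 f X Y g Z) thus ?case using cmp_hom by (auto simp: Hom_full)
  next
    case (7 f W X g Y h Z) thus ?case using cmp_assoc by (auto simp: Hom_full)
  next
    case (8 X Y) thus ?case using hom_comm_group sub by (auto simp: hom_group_full)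
  next
    case (11) 
    obtain Z where "zero_object T Z" using ex_zero_object by blast
    thus ?case using tri_sub_zero[OF D] zero_object_full[OF sub] by blast
  next
    case (12 X Y)
    hence XY: "X \<in> D" "Y \<in> D" by auto
    obtain P \<iota> where P: "is_coproduct T (UNIV :: bool set) (\<lambda>b. if b then X else Y) P \<iota>"
      using ex_binary_coproduct[of X Y] XY sub by blast
    have PD: "P \<in> D"
      using tri_sub_ext(1)[OF D binary_coproduct_ext[OF P]] XY sub by blast
    hence "is_coproduct ?S (UNIV :: bool set) (\<lambda>b. if b then X else Y) P \<iota>"
      using P XY sub unfolding is_coproduct_def by (auto simp: Hom_full subset_iff)
    thus ?case by blast
  next
    case 13
    show ?case using shift_functor sub ShD unfolding is_functor_def by (auto simp: Hom_full)
  next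
    case (14 f X Y g) thus ?case using shift_additive by (auto simp: Hom_full)
  next
    case (15 X Y) thus ?case using shift_fully_faithful sub ShD by (auto simp: Hom_full_eq)
  next
    case (16 Y)
    hence Y: "Y \<in> D" by simp
    obtain X where "X \<in> D" "isom Y (Sh X)" using tri_sub_desusp[OF D Y] .
    thus ?case using Y ShD isomorphic_sym by (auto simp: isomorphic_full)
  next
    case (17 X Y Z u v w u' X' Y' v' Z' w' a b c)
    hence "tri X' Y' Z' u' v' w'" 
      by (intro tri_iso_closed[of X Y Z u v w u' X' Y' v' Z' w' a b c]) (auto simp: dist_tri_full Hom_full is_iso_full)
    thus ?case using 17 by (auto simp: dist_tri_full Hom_full)
  next
    case (18 X Z)
    thus ?case using tri_ident ShD sub by (auto simp: dist_tri_full zero_object_full[OF sub])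
  next
    case (19 u X Y)
    hence XY: "u \<in> Hm X Y" "X \<in> D" "Y \<in> D" by (auto simp: Hom_full)
    obtain Z v w where t: "tri X Y Z u v w" using tri_complete[OF XY(1)] by blast
    hence "ext T X Y Z" unfolding ext_def by blast
    hence "Z \<in> D" using tri_sub_cone[OF D] XY by blast
    thus ?case using t XY ShD by (auto simp: dist_tri_full)
  next
    case (20 u X Y v Z w)
    thus ?case using tri_rotate[of u X Y v Z w] ShD by (auto simp: dist_tri_full Hom_full hom_group_full)
  next
    case (21 X Y Z u v w X' Y' Z' u' v' w' a b)
    thus ?case using tri_morphism[of X Y Z u v w X' Y' Z' u' v' w' a b]
      by (auto simp: dist_tri_full Hom_full)
  next
    case (22 X Y Z' u i i' Z X' v j j' Y' k k')
    thus ?case using octahedral[of X Y Z' u i i' Z X' v j j' Y' k k'] ShD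
      by (auto simp: dist_tri_full Hom_full)
  qed (auto simp: Hom_full cmp_ident_right cmp_ident_left cmp_add_right cmp_add_left)
qed

lemma full_tri_sub_Int:
  assumes "tri_sub D" "tri_sub A"
  shows "triangulated_subcategory (full_subcategory T D) (A \<inter> D)"
proof -
  note d = tri_subD[OF assms(1)] and a = tri_subD[OF assms(2)]
  have D: "D \<subseteq> Ob" using d(1) by auto
  show ?thesis
    unfolding triangulated_subcategory_def full_subcategory_simps zero_object_full[OF D]
      isomorphic_full dist_tri_full
  proof (intro conjI allI ballI impI)
    show "Y \<in> A \<inter> D" if "X \<in> A \<inter> D" "isom X Y \<and> X \<in> D \<and> Y \<in> D" for X Y
      using a(3)[of X Y] that by simp
    show "Sh X \<in> A \<inter> D \<longleftrightarrow> X \<in> A \<inter> D" if "X \<in> D" for X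
      using a(4)[of X] d(4)[of X] d(1)[of X] that by simp
    show "Z \<in> A \<inter> D" if "(tri X Y Z u v w \<and> X \<in> D \<and> Y \<in> D \<and> Z \<in> D \<and> Sh X \<in> D)
        \<and> X \<in> A \<inter> D \<and> Y \<in> A \<inter> D" for X Y Z u v w
      using a(5)[of X Y Z] that unfolding ext_def by auto
  qed (use a(2) in auto)
qed

text \<open>A cone formed inside \<open>D\<close> and a cone of the same map in \<open>T\<close> are
  isomorphic by \<open>cone_iso\<close>, and \<open>D\<close> is replete. Extensions are then
  reached by rotation and desuspension.\<close>

lemma tri_sub_of_full:
  assumes D: "D \<subseteq> Ob" and S: "triangulated_category (full_subcategory T D)"
    and iso: "\<And>X Y. isom X Y \<Longrightarrow> X \<in> D \<Longrightarrow> Y \<in> D"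
  shows "tri_sub D"
proof -
  let ?S = "full_subcategory T D"
  interpret S: triangulated_category ?S by fact
  have ShD: "Sh X \<in> D" if "X \<in> D" for X using S.shO_obj[of X] that by simp
  have desusp: "X \<in> D" if X: "X \<in> Ob" "Sh X \<in> D" for X
  proof -
    obtain Y where Y: "Y \<in> D" "isom (Sh Y) (Sh X)"
      using S.shift_ess_surj[of "Sh X"] X by (auto simp: isomorphic_full)
    have "isom Y X" using Sh_reflects_isomorphic[OF Y(2) _ X(1)] D Y(1) by auto
    thus ?thesis using iso Y by blast
  qed
  have cone: "Z \<in> D" if t: "ext T X Y Z" and XY: "X \<in> D" "Y \<in> D" for X Y Z
  proof -
    obtain u v w where t: "tri X Y Z u v w" using t unfolding ext_def by blast
    note tD = dist_triD[OF t]
    have "u \<in> Hom ?S X Y" using tD XY by (simp add: Hom_full)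
    then obtain Z' v' w' where t': "dist_tri ?S X Y Z' u v' w'" using S.tri_complete by blast
    hence t'': "tri X Y Z' u v' w'" "Z' \<in> D" by (auto simp: dist_tri_full)
    have "one Y \<cdot> u = u \<cdot> one X" using tD by (simp add: Hom_def)
    then obtain c where "is_iso T Z' Z c"
      using cone_iso[OF t''(1) t is_iso_ident[OF tD(4)] is_iso_ident[OF tD(5)]] by blast
    thus ?thesis using iso t''(2) unfolding isomorphic_def by blast
  qed
  show ?thesis
  proof (rule tri_subI)
    show "Z \<in> D" if Z: "zero_object T Z" for Z
    proof -
      obtain Z' where "zero_object ?S Z'" using S.ex_zero_object by blast
      hence Z': "zero_object T Z'" "Z' \<in> D" by (auto simp: zero_object_full[OF D])
      have o: "Z' \<in> Ob" "Z \<in> Ob" "one Z = zer Z Z" "one Z' = zer Z' Z'"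
        using Z Z' by (auto simp: zero_object_iff)
      have "is_iso T Z' Z (zer Z' Z)" unfolding is_iso_def
        using o zero_hom by (intro conjI bexI[of _ "zer Z Z'"]) auto
      thus ?thesis using iso Z' unfolding isomorphic_def by blast
    qed
    show "Y \<in> D" if t: "ext T X Y Z" "X \<in> D" "Z \<in> D" for X Y Z
    proof -
      have "ext T Z (Sh X) (Sh Y)" using t ext_rotate by blast
      hence "Sh Y \<in> D" using cone t ShD by blast
      thus ?thesis using desusp extD[OF t(1)] by blast
    qed
  qed (use D iso ShD desusp in blast)+
qed

lemma tri_sub_trans:
  assumes D: "tri_sub D" and A: "triangulated_subcategory (full_subcategory T D) A"
  shows "tri_sub A"
proof -
  have sub: "D \<subseteq> Ob" using tri_sub_obj[OF D] by blast
  have AD: "A \<subseteq> D" using A unfolding triangulated_subcategory_def by auto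
  have zero: "Z \<in> A" if "zero_object T Z" for Z
    using A tri_sub_zero[OF D that] that zero_object_full[OF sub] unfolding triangulated_subcategory_def by blast
  have iso: "Y \<in> A" if "X \<in> A" "isom X Y" for X Y
    using A tri_sub_iso[OF D that(2)] that AD unfolding triangulated_subcategory_def isomorphic_full by blast
  have sh: "Sh X \<in> A \<longleftrightarrow> X \<in> A" if "X \<in> Ob" for X
    using A tri_sub_Sh[OF D that] that AD unfolding triangulated_subcategory_def full_subcategory_simps by blast
  have cone: "Z \<in> A" if "tri X Y Z u v w" "X \<in> A" "Y \<in> A" for X Y Z u v w
  proof -
    have XY: "X \<in> D" "Y \<in> D" using that AD by auto
    have "ext T X Y Z" using that unfolding ext_def by blast
    hence "Z \<in> D" using tri_sub_cone[OF D] XY by blast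
    moreover have "Sh X \<in> D" using XY tri_sub_Sh[OF D] sub by blast
    ultimately have "dist_tri (full_subcategory T D) X Y Z u v w" using that XY by (simp add: dist_tri_full)
    thus ?thesis using A that unfolding triangulated_subcategory_def by blast
  qed
  show ?thesis unfolding triangulated_subcategory_def
  proof (intro conjI allI ballI impI)
    show "Z \<in> A" if "tri X Y Z u v w \<and> X \<in> A \<and> Y \<in> A" for X Y Z u v w
      using cone[of X Y Z u v w] that by simp
  qed (use zero iso sh AD sub in blast)+
qed

end

subsection \<open>Closure under coproducts and extensions\<close>

context category begin

section \<open>Change of index set and of summands in a coproduct\<close>

lemma coproduct_cong:
  assumes "is_coproduct C I X P \<iota>" "\<And>i. i \<in> I \<Longrightarrow> X i = X' i" "\<And>i. i \<in> I \<Longrightarrow> \<iota> i = \<iota>' i"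
  shows "is_coproduct C I X' P \<iota>'"
  using assms unfolding is_coproduct_def by (simp cong: ball_cong)

lemma coproduct_reindex:
  assumes h: "bij_betw h J I" and P: "is_coproduct C I X P \<iota>"
  shows "is_coproduct C J (\<lambda>j. X (h j)) P (\<lambda>j. \<iota> (h j))"
proof (rule coproductI)
  have hI: "h j \<in> I" if "j \<in> J" for j using h that by (auto simp: bij_betw_def)
  let ?k = "inv_into J h"
  have k: "?k i \<in> J" "h (?k i) = i" if "i \<in> I" for i
    using h that by (auto simp: bij_betw_def f_inv_into_f inv_into_into)
  have kh: "?k (h j) = j" if "j \<in> J" for j using h that by (auto simp: bij_betw_def)
  show "P \<in> Obj C" using coproduct_obj[OF P] .
  show "\<iota> (h j) \<in> Hom C (X (h j)) P" if "j \<in> J" for j using coproduct_inj[OF P hI[OF that]] .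
  show "\<exists>g\<in>Hom C P Q. \<forall>j\<in>J. g \<cdot> \<iota> (h j) = f j"
    if Q: "Q \<in> Obj C" and f: "\<And>j. j \<in> J \<Longrightarrow> f j \<in> Hom C (X (h j)) Q" for Q f
  proof -
    have "f (?k i) \<in> Hom C (X i) Q" if "i \<in> I" for i using f[of "?k i"] k[OF that] by simp
    from coproduct_factor[OF P Q this] obtain g
      where "g \<in> Hom C P Q" "\<And>i. i \<in> I \<Longrightarrow> g \<cdot> \<iota> i = f (?k i)" by blast
    thus ?thesis using hI kh by (intro bexI[of _ g]) auto
  qed
  show "g = g'" if "g \<in> Hom C P Q" "g' \<in> Hom C P Q" "\<And>j. j \<in> J \<Longrightarrow> g \<cdot> \<iota> (h j) = g' \<cdot> \<iota> (h j)" for Q g g'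
    by (rule coproduct_eqI[OF P that(1,2)]) (use that(3) k in metis)
qed

lemma coproduct_iso_unique:
  assumes P: "is_coproduct C I X P \<iota>" and P': "is_coproduct C I X P' \<iota>'"
  shows "isomorphic C P P'"
proof -
  note o = coproduct_obj[OF P] coproduct_obj[OF P']
  obtain f where f: "f \<in> Hom C P P'" "\<And>i. i \<in> I \<Longrightarrow> f \<cdot> \<iota> i = \<iota>' i"
    using coproduct_factor[OF P o(2) coproduct_inj[OF P']] by blast
  obtain g where g: "g \<in> Hom C P' P" "\<And>i. i \<in> I \<Longrightarrow> g \<cdot> \<iota>' i = \<iota> i"
    using coproduct_factor[OF P' o(1) coproduct_inj[OF P]] by blast
  have "g \<cdot> f = ident C P"
  proof (rule coproduct_eqI[OF P cmp_hom[OF f(1) g(1)] ident_hom[OF o(1)]])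
    show "(g \<cdot> f) \<cdot> \<iota> i = ident C P \<cdot> \<iota> i" if "i \<in> I" for i
      using cmp_assoc[OF coproduct_inj[OF P that] f(1) g(1)] f g that coproduct_inj[OF P that]
        cmp_ident_left by simp
  qed
  moreover have "f \<cdot> g = ident C P'"
  proof (rule coproduct_eqI[OF P' cmp_hom[OF g(1) f(1)] ident_hom[OF o(2)]])
    show "(f \<cdot> g) \<cdot> \<iota>' i = ident C P' \<cdot> \<iota>' i" if "i \<in> I" for i
      using cmp_assoc[OF coproduct_inj[OF P' that] g(1) f(1)] f g that coproduct_inj[OF P' that]
        cmp_ident_left by simp
  qed
  ultimately show ?thesis unfolding isomorphic_def is_iso_def using f g by blast
qed

lemma coproduct_iso_change:
  assumes P: "is_coproduct C I X P \<iota>" and a: "\<And>i. i \<in> I \<Longrightarrow> isomorphic C (X' i) (X i)"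
  obtains \<iota>' where "is_coproduct C I X' P \<iota>'"
proof -
  have "\<forall>i\<in>I. \<exists>a. is_iso C (X' i) (X i) a" using a unfolding isomorphic_def by blast
  then obtain a where a: "\<And>i. i \<in> I \<Longrightarrow> is_iso C (X' i) (X i) (a i)" by metis
  have "\<forall>i\<in>I. \<exists>b. b \<in> Hom C (X i) (X' i) \<and> b \<cdot> a i = ident C (X' i) \<and> a i \<cdot> b = ident C (X i)"
    using a unfolding is_iso_def by blast
  then obtain b where b: "\<And>i. i \<in> I \<Longrightarrow> b i \<in> Hom C (X i) (X' i)"
    "\<And>i. i \<in> I \<Longrightarrow> b i \<cdot> a i = ident C (X' i)" "\<And>i. i \<in> I \<Longrightarrow> a i \<cdot> b i = ident C (X i)"
    by metis
  have aH: "a i \<in> Hom C (X' i) (X i)" if "i \<in> I" for i using a[OF that] by (simp add: is_iso_def)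
  have "is_coproduct C I X' P (\<lambda>i. \<iota> i \<cdot> a i)"
  proof (rule coproductI)
    show "P \<in> Obj C" using coproduct_obj[OF P] .
    show "\<iota> i \<cdot> a i \<in> Hom C (X' i) P" if "i \<in> I" for i
      using cmp_hom[OF aH[OF that] coproduct_inj[OF P that]] .
    show "\<exists>g\<in>Hom C P Q. \<forall>i\<in>I. g \<cdot> (\<iota> i \<cdot> a i) = f i"
      if Q: "Q \<in> Obj C" and f: "\<And>i. i \<in> I \<Longrightarrow> f i \<in> Hom C (X' i) Q" for Q f
    proof -
      obtain g where g: "g \<in> Hom C P Q" "\<And>i. i \<in> I \<Longrightarrow> g \<cdot> \<iota> i = f i \<cdot> b i"
        using coproduct_factor[OF P Q cmp_hom[OF b(1) f]] by blast
      have "g \<cdot> (\<iota> i \<cdot> a i) = f i" if i: "i \<in> I" for i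
      proof -
        have "g \<cdot> (\<iota> i \<cdot> a i) = (f i \<cdot> b i) \<cdot> a i"
          using cmp_assoc[OF aH[OF i] coproduct_inj[OF P i] g(1)] g(2)[OF i] by simp
        also have "\<dots> = f i"
          using cmp_assoc[OF aH[OF i] b(1)[OF i] f[OF i]] b(2)[OF i] cmp_ident_right[OF f[OF i]] by simp
        finally show ?thesis .
      qed
      thus ?thesis using g by blast
    qed
    show "g = g'" if "g \<in> Hom C P Q" "g' \<in> Hom C P Q" and eq: "\<And>i. i \<in> I \<Longrightarrow> g \<cdot> (\<iota> i \<cdot> a i) = g' \<cdot> (\<iota> i \<cdot> a i)" for Q g g'
    proof (rule coproduct_eqI[OF P that(1,2)])
      fix i assume i: "i \<in> I"
      have "(g \<cdot> \<iota> i) \<cdot> a i = (g' \<cdot> \<iota> i) \<cdot> a i"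
        using eq[OF i] cmp_assoc[OF aH[OF i] coproduct_inj[OF P i] that(1)]
          cmp_assoc[OF aH[OF i] coproduct_inj[OF P i] that(2)] by simp
      thus "g \<cdot> \<iota> i = g' \<cdot> \<iota> i"
        using iso_cancel(2)[OF a[OF i]] cmp_hom[OF coproduct_inj[OF P i]] that by blast
    qed
  qed
  thus ?thesis using that by blast
qed

end

context triangulated_category begin

text \<open>Every target is isomorphic to some \<open>Sh Q'\<close>; full faithfulness of the shift
  then moves the universal property back to \<open>P\<close> and \<open>Q'\<close>.\<close>

lemma Sh_coproduct:
  assumes P: "is_coproduct T I X P \<iota>" and X: "\<And>i. i \<in> I \<Longrightarrow> X i \<in> Ob"
  shows "is_coproduct T I (\<lambda>i. Sh (X i)) (Sh P) (\<lambda>i. Sa (\<iota> i))"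
proof (rule coproductI)
  note Po = coproduct_obj[OF P]
  show "Sh P \<in> Ob" using Po by simp
  show "Sa (\<iota> i) \<in> Hm (Sh (X i)) (Sh P)" if "i \<in> I" for i
    using shA_hom[OF coproduct_inj[OF P that]] .
  show "\<exists>g\<in>Hm (Sh P) Q. \<forall>i\<in>I. g \<cdot> Sa (\<iota> i) = f i"
    if Q: "Q \<in> Ob" and f: "\<And>i. i \<in> I \<Longrightarrow> f i \<in> Hm (Sh (X i)) Q" for Q f
  proof -
    obtain Q' where Q': "Q' \<in> Ob" "isom (Sh Q') Q" using desusp[OF Q] .
    then obtain s s' where s: "s \<in> Hm (Sh Q') Q" "s' \<in> Hm Q (Sh Q')" "s \<cdot> s' = one Q"
      unfolding isomorphic_def is_iso_def by blast
    have "\<forall>i\<in>I. \<exists>g. g \<in> Hm (X i) Q' \<and> Sa g = s' \<cdot> f i"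
      using shA_full[OF cmp_hom[OF f s(2)] X Q'(1)] by metis
    then obtain g' where g': "\<And>i. i \<in> I \<Longrightarrow> g' i \<in> Hm (X i) Q'" "\<And>i. i \<in> I \<Longrightarrow> Sa (g' i) = s' \<cdot> f i"
      by metis
    obtain g where g: "g \<in> Hm P Q'" "\<And>i. i \<in> I \<Longrightarrow> g \<cdot> \<iota> i = g' i"
      using coproduct_factor[OF P Q'(1) g'(1)] by blast
    have "(s \<cdot> Sa g) \<cdot> Sa (\<iota> i) = f i" if i: "i \<in> I" for i
    proof -
      have "Sa g \<cdot> Sa (\<iota> i) = s' \<cdot> f i"
        using shA_cmp[of "\<iota> i" g] g g' i coproduct_inj[OF P i] by (simp add: Hom_def)
      hence "(s \<cdot> Sa g) \<cdot> Sa (\<iota> i) = s \<cdot> (s' \<cdot> f i)"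
        using s(1) g(1) coproduct_inj[OF P i] by (simp add: Hom_def)
      also have "\<dots> = f i" using cmp_cong[OF s(3), of "f i"] s f[OF i] by (simp add: Hom_def)
      finally show ?thesis .
    qed
    thus ?thesis using cmp_hom[OF shA_hom[OF g(1)] s(1)] by blast
  qed
  show "g = g'" if g: "g \<in> Hm (Sh P) Q" "g' \<in> Hm (Sh P) Q"
    and eq: "\<And>i. i \<in> I \<Longrightarrow> g \<cdot> Sa (\<iota> i) = g' \<cdot> Sa (\<iota> i)" for Q g g'
  proof -
    have Q: "Q \<in> Ob" using Hom_objD[OF g(1)] by simp
    obtain Q' where Q': "Q' \<in> Ob" "isom Q (Sh Q')" using desusp[OF Q] isomorphic_sym by metis
    then obtain s where s: "is_iso T Q (Sh Q') s" unfolding isomorphic_def by blast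
    hence sH: "s \<in> Hm Q (Sh Q')" by (simp add: is_iso_def)
    obtain k where k: "k \<in> Hm P Q'" "Sa k = s \<cdot> g" using shA_full[OF cmp_hom[OF g(1) sH] Po Q'(1)] .
    obtain k' where k': "k' \<in> Hm P Q'" "Sa k' = s \<cdot> g'" using shA_full[OF cmp_hom[OF g(2) sH] Po Q'(1)] .
    have "k = k'"
    proof (rule coproduct_eqI[OF P k(1) k'(1)])
      fix i assume i: "i \<in> I"
      note j = coproduct_inj[OF P i]
      show "k \<cdot> \<iota> i = k' \<cdot> \<iota> i"
      proof (rule shA_inj[OF cmp_hom[OF j k(1)] cmp_hom[OF j k'(1)]])
        have "Sa (k \<cdot> \<iota> i) = s \<cdot> (g \<cdot> Sa (\<iota> i))"
          using shA_cmp[of "\<iota> i" k] k j g sH by (simp add: Hom_def)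
        also have "\<dots> = Sa (k' \<cdot> \<iota> i)"
          using shA_cmp[of "\<iota> i" k'] k' j g sH eq[OF i] by (simp add: Hom_def)
        finally show "Sa (k \<cdot> \<iota> i) = Sa (k' \<cdot> \<iota> i)" .
      qed
    qed
    hence "s \<cdot> g = s \<cdot> g'" using k k' by simp
    thus ?thesis using iso_cancel(1)[OF s] g by blast
  qed
qed

text \<open>The cone \<open>W\<close> of the induced map \<open>U : P -> Q\<close> is proved to be a
  coproduct of the \<open>Z i\<close> by a chase in the spirit of the five lemma. Fillers between
  triangles are not unique, so existence and uniqueness of factorisations each need a correction
  term.\<close>

lemma coproduct_ext:
  assumes e: "\<And>i. i \<in> I \<Longrightarrow> ext T (X i) (Y i) (Z i)"
    and P: "is_coproduct T I X P \<alpha>" and Q: "is_coproduct T I Y Q \<beta>"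
  obtains W \<gamma> where "ext T P Q W" "is_coproduct T I Z W \<gamma>"
proof -
  have "\<forall>i\<in>I. \<exists>u v w. tri (X i) (Y i) (Z i) u v w" using e unfolding ext_def by blast
  then obtain u v w where t: "\<And>i. i \<in> I \<Longrightarrow> tri (X i) (Y i) (Z i) (u i) (v i) (w i)" by metis
  note tD = dist_triD[OF t]
  note Po = coproduct_obj[OF P] and Qo = coproduct_obj[OF Q]
  note a = coproduct_inj[OF P] and b = coproduct_inj[OF Q]
  note SP = Sh_coproduct[OF P tD(4)] and SQ = Sh_coproduct[OF Q tD(5)]
  obtain U where U: "U \<in> Hm P Q" "\<And>i. i \<in> I \<Longrightarrow> U \<cdot> \<alpha> i = \<beta> i \<cdot> u i"
    using coproduct_factor[OF P Qo cmp_hom[OF tD(1) b]] by blast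
  obtain W V D where T': "tri P Q W U V D" using tri_complete[OF U(1)] by blast
  note T'D = dist_triD[OF T']
  have "\<forall>i\<in>I. \<exists>c. c \<in> Hm (Z i) W \<and> c \<cdot> v i = V \<cdot> \<beta> i \<and> Sa (\<alpha> i) \<cdot> w i = D \<cdot> c"
    using tri_morphism[OF t T' a b U(2)[symmetric]] by blast
  then obtain c where c: "\<And>i. i \<in> I \<Longrightarrow> c i \<in> Hm (Z i) W" "\<And>i. i \<in> I \<Longrightarrow> c i \<cdot> v i = V \<cdot> \<beta> i"
    "\<And>i. i \<in> I \<Longrightarrow> Sa (\<alpha> i) \<cdot> w i = D \<cdot> c i" by metis
  have "is_coproduct T I Z W c"
  proof (rule coproductI)
    show "W \<in> Ob" using T'D by simp
    show "c i \<in> Hm (Z i) W" if "i \<in> I" for i using c that by blast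
    show "\<exists>h\<in>Hm W R. \<forall>i\<in>I. h \<cdot> c i = f i"
      if R: "R \<in> Ob" and f: "\<And>i. i \<in> I \<Longrightarrow> f i \<in> Hm (Z i) R" for R f
    proof -
      obtain g where g: "g \<in> Hm Q R" "\<And>i. i \<in> I \<Longrightarrow> g \<cdot> \<beta> i = f i \<cdot> v i"
        using coproduct_factor[OF Q R cmp_hom[OF tD(2) f]] by blast
      have "g \<cdot> U = zer P R"
      proof (rule coproduct_eqI[OF P cmp_hom[OF U(1) g(1)] zero_hom[OF Po R]])
        fix i assume i: "i \<in> I"
        have "(g \<cdot> U) \<cdot> \<alpha> i = g \<cdot> (\<beta> i \<cdot> u i)" using g(1) U(1) U(2)[OF i] a[OF i] by (simp add: Hom_def)
        also have "\<dots> = f i \<cdot> (v i \<cdot> u i)"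
          using cmp_cong[OF g(2)[OF i], of "u i"] g(1) b[OF i] f[OF i] tD[OF i] by (simp add: Hom_def)
        also have "\<dots> = zer (X i) R" using tri_cmp_zero(1)[OF t[OF i]] f[OF i] tD(4-6)[OF i] by (simp add: Hom_def)
        also have "\<dots> = zer P R \<cdot> \<alpha> i" using a[OF i] R Po by (simp add: Hom_def)
        finally show "(g \<cdot> U) \<cdot> \<alpha> i = zer P R \<cdot> \<alpha> i" .
      qed
      then obtain h where h: "h \<in> Hm W R" "h \<cdot> V = g" using tri_factor_right[OF T' g(1)] by blast
      \<comment> \<open>The map \<open>h\<close> agrees with \<open>f i\<close> only after
        precomposition with \<open>v i\<close>. The differences factor through the
        \<open>w i\<close> and glue to one correction \<open>K\<close> on
        \<open>Sh P\<close>.\<close>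
      have "\<exists>k. k \<in> Hm (Sh (X i)) R \<and> k \<cdot> w i = f i [+] ([-] (h \<cdot> c i))" if i: "i \<in> I" for i
      proof -
        have hc: "h \<cdot> c i \<in> Hm (Z i) R" using cmp_hom[OF c(1)[OF i] h(1)] .
        have d: "f i [+] ([-] (h \<cdot> c i)) \<in> Hm (Z i) R" using add_hom f[OF i] neg_hom hc by blast
        have "h \<cdot> (c i \<cdot> v i) = g \<cdot> \<beta> i"
          using c(2)[OF i] cmp_cong[OF h(2), of "\<beta> i"] h(1) T'D b[OF i] by (simp add: Hom_def)
        hence e: "(h \<cdot> c i) \<cdot> v i = f i \<cdot> v i"
          using g(2)[OF i] h(1) c(1)[OF i] tD[OF i] by (simp add: Hom_def)
        have "(f i [+] ([-] (h \<cdot> c i))) \<cdot> v i = f i \<cdot> v i [+] ([-] ((h \<cdot> c i) \<cdot> v i))"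
          using hc f[OF i] tD[OF i] by (simp add: Hom_def del: cmp_assoc_arr)
        also have "\<dots> = zer (Y i) R"
          unfolding e using f[OF i] tD[OF i] by (simp add: Hom_def)
        finally show ?thesis using tri_factor_right2[OF t[OF i] d] by blast
      qed
      then obtain k where k: "\<And>i. i \<in> I \<Longrightarrow> k i \<in> Hm (Sh (X i)) R"
        "\<And>i. i \<in> I \<Longrightarrow> k i \<cdot> w i = f i [+] ([-] (h \<cdot> c i))" by metis
      obtain K where K: "K \<in> Hm (Sh P) R" "\<And>i. i \<in> I \<Longrightarrow> K \<cdot> Sa (\<alpha> i) = k i"
        using coproduct_factor[OF SP R k(1)] by blast
      have KD: "K \<cdot> D \<in> Hm W R" using cmp_hom T'D K by blast
      have "(h [+] K \<cdot> D) \<cdot> c i = f i" if i: "i \<in> I" for i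
      proof -
        have hc: "h \<cdot> c i \<in> Hm (Z i) R" using cmp_hom[OF c(1)[OF i] h(1)] .
        have "(K \<cdot> D) \<cdot> c i = K \<cdot> (Sa (\<alpha> i) \<cdot> w i)"
          using c(3)[OF i] K(1) T'D c(1)[OF i] by (simp add: Hom_def)
        also have "\<dots> = f i [+] ([-] (h \<cdot> c i))"
          using cmp_cong[OF K(2)[OF i], of "w i"] k(2)[OF i] K(1) a[OF i] tD[OF i] by (simp add: Hom_def)
        finally have "(h [+] K \<cdot> D) \<cdot> c i = h \<cdot> c i [+] (f i [+] ([-] (h \<cdot> c i)))"
          using h(1) KD c(1)[OF i] by (simp add: Hom_def del: cmp_assoc_arr)
        also have "\<dots> = f i" using hc f[OF i] hadd_ac(3)[of "h \<cdot> c i" "f i" "[-] (h \<cdot> c i)"]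
          by (simp add: Hom_def)
        finally show ?thesis .
      qed
      thus ?thesis using add_hom[OF h(1) KD] by blast
    qed
    show "h = h'" if h: "h \<in> Hm W R" "h' \<in> Hm W R" and eq: "\<And>i. i \<in> I \<Longrightarrow> h \<cdot> c i = h' \<cdot> c i" for R h h'
    proof -
      have R: "R \<in> Ob" using Hom_objD[OF h(1)] by simp
      define n where "n = h [+] ([-] h')"
      have n: "n \<in> Hm W R" using h by (simp add: n_def Hom_def)
      have nc: "n \<cdot> c i = zer (Z i) R" if i: "i \<in> I" for i
        using eq[OF i] h c(1)[OF i] by (simp add: n_def Hom_def)
      have "n \<cdot> V = zer Q R"
      proof (rule coproduct_eqI[OF Q cmp_hom[OF T'D(2) n] zero_hom[OF Qo R]])
        fix i assume i: "i \<in> I"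
        have "(n \<cdot> V) \<cdot> \<beta> i = n \<cdot> (c i \<cdot> v i)" using n T'D b[OF i] c(2)[OF i] by (simp add: Hom_def)
        also have "\<dots> = zer Q R \<cdot> \<beta> i"
          using cmp_cong[OF nc[OF i], of "v i"] n c(1)[OF i] tD[OF i] b[OF i] R Qo by (simp add: Hom_def)
        finally show "(n \<cdot> V) \<cdot> \<beta> i = zer Q R \<cdot> \<beta> i" .
      qed
      then obtain k where k: "k \<in> Hm (Sh P) R" "k \<cdot> D = n" using tri_factor_right2[OF T' n] by blast
      \<comment> \<open>The map \<open>k\<close> with \<open>k \<cdot> D = n\<close> need not
        vanish; it is shown to factor through \<open>Sa U\<close>, and
        \<open>Sa U \<cdot> D = 0\<close>.\<close>
      have "\<exists>l. l \<in> Hm (Sh (Y i)) R \<and> l \<cdot> Sa (u i) = k \<cdot> Sa (\<alpha> i)" if i: "i \<in> I" for i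
      proof -
        have ka: "k \<cdot> Sa (\<alpha> i) \<in> Hm (Sh (X i)) R" using cmp_hom[OF shA_hom[OF a[OF i]] k(1)] .
        have "(k \<cdot> Sa (\<alpha> i)) \<cdot> w i = k \<cdot> (D \<cdot> c i)"
          using c(3)[OF i] k(1) a[OF i] tD[OF i] by (simp add: Hom_def)
        also have "\<dots> = zer (Z i) R"
          using cmp_cong[OF k(2), of "c i"] nc[OF i] k(1) T'D c(1)[OF i] by (simp add: Hom_def)
        finally show ?thesis using tri_factor_right3[OF t[OF i] ka] by blast
      qed
      then obtain l where l: "\<And>i. i \<in> I \<Longrightarrow> l i \<in> Hm (Sh (Y i)) R"
        "\<And>i. i \<in> I \<Longrightarrow> l i \<cdot> Sa (u i) = k \<cdot> Sa (\<alpha> i)" by metis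
      obtain L where L: "L \<in> Hm (Sh Q) R" "\<And>i. i \<in> I \<Longrightarrow> L \<cdot> Sa (\<beta> i) = l i"
        using coproduct_factor[OF SQ R l(1)] by blast
      have "L \<cdot> Sa U = k"
      proof (rule coproduct_eqI[OF SP cmp_hom[OF shA_hom[OF U(1)] L(1)] k(1)])
        fix i assume i: "i \<in> I"
        have "Sa U \<cdot> Sa (\<alpha> i) = Sa (\<beta> i) \<cdot> Sa (u i)"
          using U(2)[OF i] shA_cmp[of "\<alpha> i" U] shA_cmp[of "u i" "\<beta> i"] U(1) a[OF i] b[OF i] tD[OF i]
          by (simp add: Hom_def)
        hence "(L \<cdot> Sa U) \<cdot> Sa (\<alpha> i) = L \<cdot> (Sa (\<beta> i) \<cdot> Sa (u i))"
          using L(1) U(1) a[OF i] by (simp add: Hom_def)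
        also have "\<dots> = k \<cdot> Sa (\<alpha> i)"
          using cmp_cong[OF L(2)[OF i], of "Sa (u i)"] l(2)[OF i] L(1) b[OF i] tD[OF i] by (simp add: Hom_def)
        finally show "(L \<cdot> Sa U) \<cdot> Sa (\<alpha> i) = k \<cdot> Sa (\<alpha> i)" .
      qed
      hence "n = (L \<cdot> Sa U) \<cdot> D" using k(2) by simp
      also have "\<dots> = L \<cdot> (Sa U \<cdot> D)" using L(1) U(1) T'D by (simp add: Hom_def)
      also have "\<dots> = zer W R" using tri_cmp_zero(3)[OF T'] L(1) T'D by (simp add: Hom_def)
      finally show ?thesis unfolding n_def by (rule diff_eq_zero) (use h in auto)
    qed
  qed
  moreover have "ext T P Q W" using T' unfolding ext_def by blast
  ultimately show ?thesis using that by blast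
qed

end

text \<open>With the closure condition isolated, every inclusion of a \<open>Coprod\<close> into a
  class reduces to checking that the class is closed.\<close>

definition coprod_closed :: "'u rel \<Rightarrow> ('o, 'm, 'z) tcat_scheme \<Rightarrow> 'o set \<Rightarrow> bool" where
  "coprod_closed \<kappa> T S \<longleftrightarrow> S \<subseteq> Obj T \<and>
     (\<forall>(I :: 'u set) X P \<iota>. |I| <o \<kappa> \<and> (\<forall>i \<in> I. X i \<in> S) \<and> is_coproduct T I X P \<iota> \<longrightarrow> P \<in> S) \<and>
     (\<forall>X Y Z. ext T X Y Z \<and> X \<in> S \<and> Z \<in> S \<longrightarrow> Y \<in> S)"

lemma Coprod_eq: "Coprod \<kappa> T C = \<Inter> {S. C \<subseteq> S \<and> coprod_closed \<kappa> T S}"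
proof -
  have "(\<forall>X Y Z u v w. dist_tri T X Y Z u v w \<and> X \<in> S \<and> Z \<in> S \<longrightarrow> Y \<in> S) \<longleftrightarrow>
    (\<forall>X Y Z. ext T X Y Z \<and> X \<in> S \<and> Z \<in> S \<longrightarrow> Y \<in> S)" for S
    unfolding ext_def by blast
  thus ?thesis unfolding Coprod_def coprod_closed_def by (simp only:)
qed

locale coproduct_triangulated = triangulated_category T
  for T :: "('o, 'm, 'z) tcat_scheme" (structure) +
  fixes \<kappa> :: "'u rel"
  assumes small: "smallness_cardinal \<kappa>"
    and coproducts: "has_small_coproducts \<kappa> T"
begin

abbreviation closed where "closed \<equiv> coprod_closed \<kappa> T"
abbreviation Cop where "Cop \<equiv> Coprod \<kappa> T"

text \<open>Smallness notions quantify over index sets of elements of \<open>'u\<close>. Embedding a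
  small set into the field of \<open>\<kappa>\<close> makes them available for families indexed by
  naturals or by arrows.\<close>

lemma small_index:
  fixes I :: "'i set"
  assumes "|I| <o \<kappa>"
  obtains J :: "'u set" and h where "bij_betw h J I" "|J| <o \<kappa>"
proof -
  have card: "Card_order \<kappa>" using small by (simp add: smallness_cardinal_def)
  have "|I| \<le>o |Field \<kappa>|"
    using ordLess_imp_ordLeq[OF assms] card_of_Field_ordIso[OF card] ordIso_symmetric ordLeq_ordIso_trans by blast
  then obtain f where f: "inj_on f I" "f ` I \<subseteq> Field \<kappa>" unfolding card_of_ordLeq[symmetric] by blast
  have b: "bij_betw f I (f ` I)" using f by (simp add: bij_betw_def)
  have "|f ` I| <o \<kappa>"
    using assms card_of_ordIsoI[OF b] ordIso_symmetric ordIso_ordLess_trans by blast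
  thus ?thesis using that bij_betw_inv_into[OF b] by blast
qed

lemma small_coproduct:
  fixes I :: "'i set"
  assumes "|I| <o \<kappa>" "\<And>i. i \<in> I \<Longrightarrow> X i \<in> Ob"
  obtains P \<iota> where "is_coproduct T I X P \<iota>"
proof -
  obtain J :: "'u set" and h where J: "bij_betw h J I" "|J| <o \<kappa>" using small_index[OF assms(1)] .
  have "\<forall>j\<in>J. X (h j) \<in> Ob" using assms(2) J(1) by (auto simp: bij_betw_def)
  then obtain P \<iota> where P: "is_coproduct T J (\<lambda>j. X (h j)) P \<iota>"
    using coproducts[unfolded has_small_coproducts_def, rule_format, of J "\<lambda>j. X (h j)"] J(2) by auto
  let ?k = "inv_into J h"
  have k: "bij_betw ?k I J" using bij_betw_inv_into[OF J(1)] .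
  have "is_coproduct T I (\<lambda>i. X (h (?k i))) P (\<lambda>i. \<iota> (?k i))" using coproduct_reindex[OF k P] .
  hence "is_coproduct T I X P (\<lambda>i. \<iota> (?k i))"
    by (rule coproduct_cong) (use J(1) in \<open>auto simp: bij_betw_def f_inv_into_f\<close>)
  thus ?thesis using that by blast
qed

section \<open>Classes closed under small coproducts and extensions\<close>

lemma closedD:
  assumes "closed S"
  shows closed_obj: "X \<in> S \<Longrightarrow> X \<in> Ob"
    and closed_ext: "ext T X Y Z \<Longrightarrow> X \<in> S \<Longrightarrow> Z \<in> S \<Longrightarrow> Y \<in> S"
  using assms unfolding coprod_closed_def by blast+

lemma closed_coproduct:
  fixes I :: "'i set"
  assumes "closed S" "|I| <o \<kappa>" "is_coproduct T I X P \<iota>" "\<And>i. i \<in> I \<Longrightarrow> X i \<in> S"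
  shows "P \<in> S"
proof -
  obtain J :: "'u set" and h where J: "bij_betw h J I" "|J| <o \<kappa>" using small_index[OF assms(2)] .
  have "is_coproduct T J (\<lambda>j. X (h j)) P (\<lambda>j. \<iota> (h j))" using coproduct_reindex[OF J(1) assms(3)] .
  moreover have "\<forall>j\<in>J. X (h j) \<in> S" using assms(4) J(1) by (auto simp: bij_betw_def)
  ultimately show ?thesis
    using assms(1)[unfolded coprod_closed_def, THEN conjunct2, THEN conjunct1, rule_format, of J "\<lambda>j. X (h j)" P] J(2)
    by auto
qed

lemma countable_small: "|UNIV :: nat set| <o \<kappa>"
  using small card_of_nat ordIso_ordLess_trans unfolding smallness_cardinal_def by blast

lemma finite_small: "finite I \<Longrightarrow> |I| <o \<kappa>"
  using small finite_ordLess_infinite2 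
  by (metis card_of_nat finite_iff_ordLess_natLeq ordLess_transitive smallness_cardinal_def)

lemma closed_zero:
  assumes "closed S" "zero_object T Z"
  shows "Z \<in> S"
proof -
  \<comment> \<open>A zero object is a coproduct of the empty family.\<close>
  have "is_coproduct T ({} :: nat set) (\<lambda>_. Z) Z (\<lambda>_. one Z)"
    using assms(2) unfolding is_coproduct_def zero_object_def by auto
  from closed_coproduct[OF assms(1) finite_small this] show ?thesis by simp
qed

text \<open>An isomorphism is a triangle with zero third term, so repleteness comes from closure
  under extensions.\<close>

lemma closed_iso:
  assumes "closed S" "isom X Y" "X \<in> S"
  shows "Y \<in> S"
proof -
  obtain Z where Z: "zero_object T Z" using ex_zero_object by blast
  show ?thesis
    using closed_ext[OF assms(1) ext_iso_zero(1)[OF assms(2) Z]] assms(3) closed_zero[OF assms(1) Z] by blast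
qed

lemma Coprod_incl: "C \<subseteq> Cop C"
  unfolding Coprod_eq by blast

lemma Coprod_least: "closed S \<Longrightarrow> C \<subseteq> S \<Longrightarrow> Cop C \<subseteq> S"
  unfolding Coprod_eq by blast

lemma closed_Obj: "closed (Ob)"
  unfolding coprod_closed_def using coproduct_obj extD by blast

lemma Coprod_closed:
  assumes "C \<subseteq> Ob"
  shows "closed (Cop C)"
proof -
  have "Cop C \<subseteq> Ob" using Coprod_least[OF closed_Obj assms] .
  moreover have "P \<in> Cop C" if "|I| <o \<kappa> \<and> (\<forall>i \<in> I. X i \<in> Cop C) \<and> is_coproduct T I X P \<iota>"
    for I :: "'u set" and X P \<iota>
    unfolding Coprod_eq
  proof
    fix S assume "S \<in> {S. C \<subseteq> S \<and> closed S}"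
    hence S: "C \<subseteq> S" "closed S" by auto
    show "P \<in> S"
      using closed_coproduct[OF S(2), of I X P \<iota>] that Coprod_least[OF S(2,1)] by blast
  qed
  moreover have "Y \<in> Cop C" if "ext T X Y Z" "X \<in> Cop C" "Z \<in> Cop C" for X Y Z
    unfolding Coprod_eq
  proof
    fix S assume "S \<in> {S. C \<subseteq> S \<and> closed S}"
    hence S: "C \<subseteq> S" "closed S" by auto
    show "Y \<in> S"
      by (rule closed_ext[OF S(2) that(1)]) (use that Coprod_least[OF S(2,1)] in auto)
  qed
  ultimately show ?thesis unfolding coprod_closed_def by blast
qed

lemma closed_Int: "closed S \<Longrightarrow> closed S' \<Longrightarrow> closed (S \<inter> S')"
  unfolding coprod_closed_def by (intro conjI) (blast+)

lemma closed_left_orth: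
  assumes Y: "Y \<in> Ob"
  shows "closed {X \<in> Ob. orth T X Y}"
  unfolding coprod_closed_def
proof (intro conjI allI impI)
  fix I :: "'u set" and X P \<iota>
  assume "|I| <o \<kappa> \<and> (\<forall>i\<in>I. X i \<in> {X \<in> Ob. orth T X Y}) \<and> is_coproduct T I X P \<iota>"
  hence X: "\<And>i. i \<in> I \<Longrightarrow> orth T (X i) Y" and P: "is_coproduct T I X P \<iota>" by auto
  note Po = coproduct_obj[OF P]
  have "orth T P Y"
  proof (rule orthI[OF Po Y])
    fix f assume f: "f \<in> Hm P Y"
    show "f = zer P Y"
    proof (rule coproduct_eqI[OF P f zero_hom[OF Po Y]])
      fix i assume i: "i \<in> I"
      note j = coproduct_inj[OF P i]
      show "f \<cdot> \<iota> i = zer P Y \<cdot> \<iota> i"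
        using orthD[OF X[OF i] cmp_hom[OF j f]] j Y by (simp add: Hom_def)
    qed
  qed
  thus "P \<in> {X \<in> Ob. orth T X Y}" using Po by simp
next
  fix X Z W assume "ext T X Z W \<and> X \<in> {X \<in> Ob. orth T X Y} \<and> W \<in> {X \<in> Ob. orth T X Y}"
  thus "Z \<in> {X \<in> Ob. orth T X Y}" using orth_ext_left[of X Z W Y] extD[of X Z W] Y by simp
qed auto

text \<open>Coproducts of the decomposing triangles are triangles by \<open>coproduct_ext\<close>;
  extensions are merged by \<open>ext_interchange\<close>, whose inner splitting is the reason for
  the \<open>Sh\<close> in the orthogonality assumption.\<close>

lemma closed_star:
  assumes S: "closed S" "closed S'"
    and o: "\<And>X Y. X \<in> S \<Longrightarrow> Y \<in> S' \<Longrightarrow> orth T X (Sh Y)"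
  shows "closed {F. \<exists>b\<in>S. \<exists>a\<in>S'. ext T b F a}" (is "closed ?S")
  unfolding coprod_closed_def
proof (intro conjI allI impI)
  show "?S \<subseteq> Ob" using extD by blast
next
  fix I :: "'u set" and F P \<iota>
  assume a: "|I| <o \<kappa> \<and> (\<forall>i\<in>I. F i \<in> ?S) \<and> is_coproduct T I F P \<iota>"
  hence P: "is_coproduct T I F P \<iota>" and I: "|I| <o \<kappa>" by auto
  have "\<forall>i\<in>I. \<exists>b a. b \<in> S \<and> a \<in> S' \<and> ext T b (F i) a" using a by blast
  then obtain b a where ba: "\<And>i. i \<in> I \<Longrightarrow> b i \<in> S" "\<And>i. i \<in> I \<Longrightarrow> a i \<in> S'"
    "\<And>i. i \<in> I \<Longrightarrow> ext T (b i) (F i) (a i)" by metis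
  obtain Q \<beta> where Q: "is_coproduct T I b Q \<beta>"
    using small_coproduct[OF I] ba(1) closed_obj[OF S(1)] by metis
  obtain W \<gamma> where W: "ext T Q P W" "is_coproduct T I a W \<gamma>" using coproduct_ext[OF ba(3) Q P] by blast
  have "Q \<in> S" "W \<in> S'"
    using closed_coproduct[OF S(1) I Q ba(1)] closed_coproduct[OF S(2) I W(2) ba(2)] by blast+
  thus "P \<in> ?S" using W by blast
next
  fix X Y Z assume a: "ext T X Y Z \<and> X \<in> ?S \<and> Z \<in> ?S"
  then obtain b a b' a' where ba: "b \<in> S" "a \<in> S'" "ext T b X a" "b' \<in> S" "a' \<in> S'" "ext T b' Z a'" by blast
  obtain b'' a'' where r: "ext T b b'' b'" "ext T b'' Y a''" "ext T a a'' a'"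
    using ext_interchange[OF _ ba(3) ba(6) o[OF ba(4) ba(2)]] a by blast
  have "b'' \<in> S" "a'' \<in> S'" using closed_ext[OF S(1) r(1)] closed_ext[OF S(2) r(3)] ba by blast+
  thus "Y \<in> ?S" using r by blast
qed

lemma closed_Sh:
  assumes S: "closed S"
  shows "closed {X \<in> Ob. Sh X \<in> S}"
  unfolding coprod_closed_def
proof (intro conjI allI impI)
  fix I :: "'u set" and X P \<iota>
  assume a: "|I| <o \<kappa> \<and> (\<forall>i\<in>I. X i \<in> {X \<in> Ob. Sh X \<in> S}) \<and> is_coproduct T I X P \<iota>"
  hence P: "is_coproduct T I X P \<iota>" and I: "|I| <o \<kappa>" by auto
  have "Sh P \<in> S" by (rule closed_coproduct[OF S I Sh_coproduct[OF P]]) (use a in auto)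
  thus "P \<in> {X \<in> Ob. Sh X \<in> S}" using coproduct_obj[OF P] by simp
next
  fix X Y Z assume "ext T X Y Z \<and> X \<in> {X \<in> Ob. Sh X \<in> S} \<and> Z \<in> {X \<in> Ob. Sh X \<in> S}"
  thus "Y \<in> {X \<in> Ob. Sh X \<in> S}"
    using closed_ext[OF S ext_Sh[of X Y Z]] extD[of X Y Z] by simp
qed auto

text \<open>The class consists of the objects whose desuspension lies in \<open>S\<close>, phrased
  so that no choice of desuspension enters.\<close>

lemma closed_desusp:
  assumes S: "closed S"
  shows "closed {X. \<exists>Y\<in>S. isom (Sh Y) X}" (is "closed ?S")
  unfolding coprod_closed_def
proof (intro conjI allI impI)
  show "?S \<subseteq> Ob" using isomorphic_obj by blast
next
  fix I :: "'u set" and X P \<iota>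
  assume a: "|I| <o \<kappa> \<and> (\<forall>i\<in>I. X i \<in> ?S) \<and> is_coproduct T I X P \<iota>"
  hence P: "is_coproduct T I X P \<iota>" and I: "|I| <o \<kappa>" by auto
  have "\<forall>i\<in>I. \<exists>Y. Y \<in> S \<and> isom (Sh Y) (X i)" using a by blast
  then obtain Y where Y: "\<And>i. i \<in> I \<Longrightarrow> Y i \<in> S" "\<And>i. i \<in> I \<Longrightarrow> isom (Sh (Y i)) (X i)" by metis
  have Yo: "Y i \<in> Ob" if "i \<in> I" for i using Y(1)[OF that] closed_obj[OF S] by blast
  obtain Q \<beta> where Q: "is_coproduct T I Y Q \<beta>" using small_coproduct[OF I, of Y] Yo by blast
  obtain \<iota>' where "is_coproduct T I (\<lambda>i. Sh (Y i)) P \<iota>'" using coproduct_iso_change[OF P Y(2)] by blast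
  hence "isom (Sh Q) P" using coproduct_iso_unique[OF Sh_coproduct[OF Q Yo]] by blast
  thus "P \<in> ?S" using closed_coproduct[OF S I Q Y(1)] by blast
next
  fix X Y Z assume a: "ext T X Y Z \<and> X \<in> ?S \<and> Z \<in> ?S"
  hence t: "ext T X Y Z" by simp
  obtain X' Z' where XZ: "X' \<in> S" "Z' \<in> S" "isom (Sh X') X" "isom (Sh Z') Z" using a by blast
  obtain Y' where Y': "Y' \<in> Ob" "isom (Sh Y') Y" using desusp[OF extD(2)[OF t]] .
  have "ext T (Sh X') (Sh Y') (Sh Z')"
    using ext_iso[OF t isomorphic_sym[OF XZ(3)] isomorphic_sym[OF Y'(2)] isomorphic_sym[OF XZ(4)]] .
  hence "ext T X' Y' Z'" using ext_Sh_back closed_obj[OF S] XZ Y' by blast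
  hence "Y' \<in> S" using closed_ext[OF S] XZ by blast
  thus "Y \<in> ?S" using Y' by blast
qed

text \<open>Stability under the shift and under desuspension are both instances of
  \<open>Coprod_least\<close>, applied to the closed classes of \<open>closed_Sh\<close> and
  \<open>closed_desusp\<close>.\<close>

lemma Coprod_triangulated:
  assumes A: "tri_sub A"
  shows "tri_sub (Cop A)"
proof -
  have Ao: "A \<subseteq> Ob" using tri_sub_obj[OF A] by blast
  note c = Coprod_closed[OF Ao]
  have "A \<subseteq> {X \<in> Ob. Sh X \<in> Cop A}" using Ao tri_sub_Sh[OF A] Coprod_incl by blast
  hence 1: "Sh X \<in> Cop A" if "X \<in> Cop A" for X
    using Coprod_least[OF closed_Sh[OF c]] that by blast
  have "A \<subseteq> {X. \<exists>Y\<in>Cop A. isom (Sh Y) X}"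
  proof
    fix X assume X: "X \<in> A"
    obtain Y where "Y \<in> A" "isom X (Sh Y)" using tri_sub_desusp[OF A X] .
    thus "X \<in> {X. \<exists>Y\<in>Cop A. isom (Sh Y) X}" using isomorphic_sym Coprod_incl by blast
  qed
  hence 2: "\<exists>Y\<in>Cop A. isom (Sh Y) X" if "X \<in> Cop A" for X
    using Coprod_least[OF closed_desusp[OF c]] that by blast
  show ?thesis
  proof (rule tri_subI)
    show "X \<in> Cop A" if X: "X \<in> Ob" "Sh X \<in> Cop A" for X
    proof -
      obtain Y where Y: "Y \<in> Cop A" "isom (Sh Y) (Sh X)" using 2[OF X(2)] by blast
      have "isom Y X" using Sh_reflects_isomorphic[OF Y(2) closed_obj[OF c Y(1)] X(1)] .
      thus ?thesis using closed_iso[OF c] Y(1) by blast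
    qed
    show "Cop A \<subseteq> Ob" using closed_obj[OF c] by blast
    show "Y \<in> Cop A" if "isom X Y" "X \<in> Cop A" for X Y
      using closed_iso[OF c] that by blast
  qed (use closed_zero[OF c] closed_ext[OF c] 1 in blast)+
qed

end

subsection \<open>Shifts and compact objects\<close>

context triangulated_category begin

section \<open>Integer shifts up to isomorphism\<close>

lemma desuspension:
  assumes "X \<in> Ob"
  shows "desuspension T X \<in> Ob" "isom (Sh (desuspension T X)) X"
proof -
  have "\<exists>Y. Y \<in> Ob \<and> isom (Sh Y) X" using shift_ess_surj[OF assms] by blast
  from someI_ex[OF this] show "desuspension T X \<in> Ob" "isom (Sh (desuspension T X)) X"
    unfolding desuspension_def by auto
qed

lemma shift_pow_obj [simp]: "X \<in> Ob \<Longrightarrow> Sp i X \<in> Ob"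
proof -
  assume X: "X \<in> Ob"
  have "(Sh ^^ n) X \<in> Ob" "(desuspension T ^^ n) X \<in> Ob" for n
    using X by (induction n) (auto simp: desuspension)
  thus ?thesis by (simp add: shift_pow_def)
qed

lemma shift_pow_0 [simp]: "Sp 0 X = X"
  by (simp add: shift_pow_def)

lemma Sh_shift_pow:
  assumes "X \<in> Ob"
  shows "isom (Sh (Sp i X)) (Sp (i + 1) X)"
proof (cases "0 \<le> i")
  case True
  hence "Sp (i + 1) X = Sh (Sp i X)" by (simp add: shift_pow_def nat_add_distrib)
  thus ?thesis using isomorphic_refl assms by simp
next
  case False
  hence n: "nat (- i) = Suc (nat (- (i + 1)))" by simp
  have "Sp (i + 1) X = (desuspension T ^^ nat (- (i + 1))) X"
    using False by (cases "i = -1") (auto simp: shift_pow_def)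
  moreover have "Sp i X = desuspension T ((desuspension T ^^ nat (- (i + 1))) X)"
    using False n by (simp add: shift_pow_def)
  ultimately have "Sp i X = desuspension T (Sp (i + 1) X)" by simp
  thus ?thesis using desuspension(2) assms by simp
qed

lemma shift_pow_pred:
  assumes "X \<in> Ob"
  shows "isom (Sh (Sp (i - 1) X)) (Sp i X)"
  using Sh_shift_pow[OF assms, of "i - 1"] by simp

text \<open>For mixed signs the two objects need not be equal. Induction runs from 0 in both
  directions, and the descending step reflects an isomorphism through \<open>Sh\<close>.\<close>

lemma shift_pow_add:
  assumes X: "X \<in> Ob"
  shows "isom (Sp i (Sp j X)) (Sp (i + j) X)"
proof (induction i rule: int_induct[where k = 0])
  case base thus ?case using isomorphic_refl X by simp
next
  case (step1 i)
  have "isom (Sh (Sp (i + j) X)) (Sp (i + 1 + j) X)"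
    using Sh_shift_pow[OF X, of "i + j"] by (simp add: algebra_simps)
  with isomorphic_trans[OF isomorphic_sym[OF Sh_shift_pow] Sh_isomorphic[OF step1(2)]] show ?case
    using isomorphic_trans X by simp
next
  case (step2 i)
  have "isom (Sh (Sp (i - 1 + j) X)) (Sp (i + j) X)"
    using Sh_shift_pow[OF X, of "i - 1 + j"] by (simp add: algebra_simps)
  hence "isom (Sh (Sp (i - 1) (Sp j X))) (Sh (Sp (i - 1 + j) X))"
    using isomorphic_trans[OF shift_pow_pred isomorphic_trans[OF step2(2) isomorphic_sym]] X by simp
  thus ?case using Sh_reflects_isomorphic X by simp
qed

lemma shift_pow_minus:
  assumes "X \<in> Ob"
  shows "isom (Sp (- i) (Sp i X)) X"
    "isom (Sp i (Sp (- i) X)) X"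
  using shift_pow_add[OF assms, of "- i" i] shift_pow_add[OF assms, of i "- i"] by simp_all

lemma orth_shift_pow_same:
  assumes "X \<in> Ob" "Y \<in> Ob"
  shows "orth T (Sp i X) (Sp i Y) \<longleftrightarrow> orth T X Y"
proof (induction i rule: int_induct[where k = 0])
  case base thus ?case by simp
next
  case (step1 i)
  have "orth T (Sp (i + 1) X) (Sp (i + 1) Y) \<longleftrightarrow>
    orth T (Sh (Sp i X)) (Sh (Sp i Y))"
    using orth_iso Sh_shift_pow isomorphic_sym assms by blast
  thus ?case using step1 Sh_orth_iff assms by simp
next
  case (step2 i)
  have "orth T (Sp i X) (Sp i Y) \<longleftrightarrow>
    orth T (Sh (Sp (i - 1) X)) (Sh (Sp (i - 1) Y))"
    using orth_iso shift_pow_pred isomorphic_sym assms by blast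
  thus ?case using step2 Sh_orth_iff assms by simp
qed

lemma orth_shift_pow:
  assumes "X \<in> Ob" "Y \<in> Ob"
  shows "orth T (Sp i X) (Sp j Y) \<longleftrightarrow> orth T (Sp (i - j) X) Y"
    and "orth T (Sp i X) Y \<longleftrightarrow> orth T X (Sp (- i) Y)"
proof -
  have a: "isom (Sp j (Sp (i - j) X)) (Sp i X)"
    using shift_pow_add[OF assms(1), of j "i - j"] by simp
  have "orth T (Sp i X) (Sp j Y) \<longleftrightarrow>
    orth T (Sp j (Sp (i - j) X)) (Sp j Y)"
    using orth_iso a isomorphic_sym isomorphic_refl assms shift_pow_obj by meson
  thus "orth T (Sp i X) (Sp j Y) \<longleftrightarrow> orth T (Sp (i - j) X) Y"
    using orth_shift_pow_same[of "Sp (i - j) X" Y j] assms by simp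
  have "orth T (Sp i X) Y \<longleftrightarrow> orth T (Sp i X) (Sp i (Sp (- i) Y))"
    using orth_iso shift_pow_minus(2)[OF assms(2)] isomorphic_sym isomorphic_refl assms shift_pow_obj by meson
  thus "orth T (Sp i X) Y \<longleftrightarrow> orth T X (Sp (- i) Y)"
    using orth_shift_pow_same[of X "Sp (- i) Y" i] assms by simp
qed

lemma tri_sub_shift_pow:
  assumes A: "tri_sub A" and X: "X \<in> Ob"
  shows "Sp i X \<in> A \<longleftrightarrow> X \<in> A"
proof (induction i rule: int_induct[where k = 0])
  case base thus ?case by simp
next
  case (step1 i)
  have "Sp (i + 1) X \<in> A \<longleftrightarrow> Sh (Sp i X) \<in> A"
    using tri_sub_iso[OF A Sh_shift_pow[OF X]] tri_sub_iso[OF A isomorphic_sym[OF Sh_shift_pow[OF X]]] by blast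
  thus ?case using step1 tri_sub_Sh[OF A] X by simp
next
  case (step2 i)
  have "Sp i X \<in> A \<longleftrightarrow> Sh (Sp (i - 1) X) \<in> A"
    using tri_sub_iso[OF A shift_pow_pred[OF X]] tri_sub_iso[OF A isomorphic_sym[OF shift_pow_pred[OF X]]] by blast
  thus ?case using step2 tri_sub_Sh[OF A] X by simp
qed

lemma ext_shift_pow:
  assumes "ext T X Y Z"
  shows "ext T (Sp i X) (Sp i Y) (Sp i Z)"
proof (induction i rule: int_induct[where k = 0])
  case base thus ?case using assms by simp
next
  case (step1 i)
  show ?case using ext_iso[OF ext_Sh[OF step1(2)]] Sh_shift_pow extD[OF assms] by simp
next
  case (step2 i)
  have "ext T (Sh (Sp (i - 1) X)) (Sh (Sp (i - 1) Y)) (Sh (Sp (i - 1) Z))"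
    using ext_iso[OF step2(2)] shift_pow_pred isomorphic_sym extD[OF assms] by simp
  thus ?case using ext_Sh_back extD[OF assms] by simp
qed

end

context coproduct_triangulated begin

text \<open>One step replaces \<open>S\<close> by its preimage or its replete image under the shift,
  so the induction is over all closed classes at once.\<close>

lemma closed_shift_pow:
  assumes "closed S"
  shows "closed {X \<in> Ob. Sp k X \<in> S}"
  using assms
proof (induction k arbitrary: S rule: int_induct[where k = 0])
  case base
  have "{X \<in> Ob. Sp 0 X \<in> S} = S" using closed_obj[OF base] by auto
  thus ?case using base by simp
next
  case (step1 i)
  have "Sp (i + 1) X \<in> S \<longleftrightarrow> Sp i X \<in> {X \<in> Ob. Sh X \<in> S}" if X: "X \<in> Ob" for X
    using closed_iso[OF step1(3) Sh_shift_pow[OF X]]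
      closed_iso[OF step1(3) isomorphic_sym[OF Sh_shift_pow[OF X]]] X by auto
  hence "{X \<in> Ob. Sp (i + 1) X \<in> S} = {X \<in> Ob. Sp i X \<in> {X \<in> Ob. Sh X \<in> S}}"
    by blast
  thus ?case using step1(2)[OF closed_Sh[OF step1(3)]] by simp
next
  case (step2 i)
  have "Sp (i - 1) X \<in> S \<longleftrightarrow> Sp i X \<in> {X. \<exists>Y\<in>S. isom (Sh Y) X}"
    if X: "X \<in> Ob" for X
  proof
    show "Sp i X \<in> {X. \<exists>Y\<in>S. isom (Sh Y) X}" if "Sp (i - 1) X \<in> S"
      using that shift_pow_pred[OF X] by blast
    assume "Sp i X \<in> {X. \<exists>Y\<in>S. isom (Sh Y) X}"
    then obtain Y where Y: "Y \<in> S" "isom (Sh Y) (Sp i X)" by blast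
    have "isom (Sh Y) (Sh (Sp (i - 1) X))"
      using isomorphic_trans[OF Y(2) isomorphic_sym[OF shift_pow_pred[OF X]]] .
    hence "isom Y (Sp (i - 1) X)"
      using Sh_reflects_isomorphic closed_obj[OF step2(3) Y(1)] X by simp
    thus "Sp (i - 1) X \<in> S" using closed_iso[OF step2(3)] Y(1) by blast
  qed
  hence "{X \<in> Ob. Sp (i - 1) X \<in> S} =
    {X \<in> Ob. Sp i X \<in> {X. \<exists>Y\<in>S. isom (Sh Y) X}}" by blast
  thus ?case using step2(2)[OF closed_desusp[OF step2(3)]] by simp
qed

end

context additive_category begin

text \<open>\<open>gfinprod\<close> depends on the support of the family, finite or not.
  Precomposition with an isomorphism leaves the support unchanged, and an infinite support gives
  zero on both sides.\<close>

lemma gfinprod_cmp: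
  assumes a: "is_iso C K' K a" and P: "P \<in> Obj C"
    and f: "\<And>i. i \<in> I \<Longrightarrow> f i \<in> Hom C K P"
  shows "gfinprod (hom_group C K' P) (\<lambda>i. f i \<cdot> a) I = gfinprod (hom_group C K P) f I \<cdot> a"
proof -
  have aH: "a \<in> Hom C K' K" using a by (simp add: is_iso_def)
  have K: "K \<in> Obj C" "K' \<in> Obj C" using Hom_objD[OF aH] by auto
  interpret G: comm_group "hom_group C K P" by (rule hom_comm_group[OF K(1) P])
  interpret G': comm_group "hom_group C K' P" by (rule hom_comm_group[OF K(2) P])
  have z: "hzero C K P \<cdot> a = hzero C K' P" using aH P by (simp add: Hom_def)
  have "f i \<cdot> a = hzero C K' P \<longleftrightarrow> f i = hzero C K P" if "i \<in> I" for i
    using iso_cancel(2)[OF a f[OF that] zero_hom[OF K(1) P]] z by auto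
  hence S: "{i \<in> I. f i \<cdot> a \<noteq> hzero C K' P} = {i \<in> I. f i \<noteq> hzero C K P}" by auto
  have fin: "finprod (hom_group C K' P) (\<lambda>i. f i \<cdot> a) F = finprod (hom_group C K P) f F \<cdot> a"
    if "finite F" "F \<subseteq> I" for F
    using that
  proof (induction F rule: finite_induct)
    case empty thus ?case using z by simp
  next
    case (insert i F)
    have c: "f \<in> F \<rightarrow> Hom C K P" "f i \<in> Hom C K P" "(\<lambda>i. f i \<cdot> a) \<in> F \<rightarrow> Hom C K' P" "f i \<cdot> a \<in> Hom C K' P"
      using f insert.prems cmp_hom[OF aH] by auto
    have s: "finprod (hom_group C K P) f F \<in> Hom C K P"
      using G.finprod_closed[of f F] c by simp
    show ?case using insert c G.finprod_insert[of F i f] G'.finprod_insert[of F i "\<lambda>i. f i \<cdot> a"]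
        cmp_add_left[OF aH c(2) s] by simp
  qed
  show ?thesis unfolding gfinprod_def by (simp add: S fin z)
qed

lemma gfinprod_induct:
  assumes obj: "K \<in> Obj C" "P \<in> Obj C" and f: "\<And>i. i \<in> I \<Longrightarrow> f i \<in> Hom C K P"
    and zero: "Q (hzero C K P)" and base: "\<And>i. i \<in> I \<Longrightarrow> Q (f i)"
    and add: "\<And>g h. g \<in> Hom C K P \<Longrightarrow> h \<in> Hom C K P \<Longrightarrow> Q g \<Longrightarrow> Q h \<Longrightarrow> Q (g [+] h)"
  shows "Q (gfinprod (hom_group C K P) f I)"
proof -
  interpret G: comm_group "hom_group C K P" by (rule hom_comm_group[OF obj])
  have fin: "Q (finprod (hom_group C K P) f F)" if "finite F" "F \<subseteq> I" for F
    using that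
  proof (induction F rule: finite_induct)
    case empty thus ?case using zero by simp
  next
    case (insert i F)
    have c: "f \<in> F \<rightarrow> Hom C K P" "f i \<in> Hom C K P" using f insert.prems by auto
    have "finprod (hom_group C K P) f F \<in> Hom C K P" using G.finprod_closed[of f F] c by simp
    thus ?case using insert c add base[of i] by simp
  qed
  \<comment> \<open>An infinite support makes \<open>gfinprod\<close> the unit, which
    \<open>zero\<close> covers.\<close>
  show ?thesis unfolding gfinprod_def using fin[of "{i \<in> I. f i \<noteq> hzero C K P}"] zero by simp
qed

end

context coproduct_triangulated begin

abbreviation Tc where "Tc \<equiv> compact_objects \<kappa> T"

section \<open>Compact objects\<close>

lemma compact_obj: "K \<in> Tc \<Longrightarrow> K \<in> Ob"
  by (simp add: compact_objects_def)

lemma sum_group_carrier: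
  assumes "K \<in> Ob" "\<And>i. i \<in> I \<Longrightarrow> X i \<in> Ob"
  shows "carrier (sum_group I (\<lambda>i. hom_group T K (X i))) =
    {x \<in> \<Pi>\<^sub>E i\<in>I. Hm K (X i). finite {i \<in> I. x i \<noteq> zer K (X i)}}"
proof -
  have "group (hom_group T K (X i))" if "i \<in> I" for i
    using hom_comm_group[OF assms(1) assms(2)[OF that]] by (simp add: comm_group.axioms)
  thus ?thesis by (subst carrier_sum_group) auto
qed

text \<open>The comparison map for \<open>K'\<close> is the one for \<open>K\<close> conjugated by
  precomposition with the isomorphism and its inverse, so it is bijective as well.\<close>

lemma compact_iso:
  assumes K: "K \<in> Tc" and iso: "isom K' K"
  shows "K' \<in> Tc"
proof -
  obtain a where a: "is_iso T K' K a" using iso unfolding isomorphic_def by blast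
  then obtain b where b: "b \<in> Hm K K'" "b \<cdot> a = one K'" "a \<cdot> b = one K"
    unfolding is_iso_def by blast
  have aH: "a \<in> Hm K' K" using a by (simp add: is_iso_def)
  note Ko = Hom_objD[OF aH]
  have "(\<lambda>x. gfinprod (hom_group T K' P) (\<lambda>i. \<iota> i \<cdot> x i) I)
         \<in> iso (sum_group I (\<lambda>i. hom_group T K' (X i))) (hom_group T K' P)"
    if I: "|I| <o \<kappa>" and P: "is_coproduct T I X P \<iota>" for I :: "'u set" and X P \<iota>
  proof -
    note Po = coproduct_obj[OF P] and j = coproduct_inj[OF P]
    have X: "X i \<in> Ob" if "i \<in> I" for i using Hom_objD(1)[OF j[OF that]] .
    interpret G': comm_group "hom_group T K' P" by (rule hom_comm_group[OF Ko(1) Po])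
    let ?S = "carrier (sum_group I (\<lambda>i. hom_group T K (X i)))"
    let ?S' = "carrier (sum_group I (\<lambda>i. hom_group T K' (X i)))"
    let ?h = "\<lambda>x. gfinprod (hom_group T K P) (\<lambda>i. \<iota> i \<cdot> x i) I"
    let ?h' = "\<lambda>x. gfinprod (hom_group T K' P) (\<lambda>i. \<iota> i \<cdot> x i) I"
    let ?\<Phi> = "\<lambda>x. \<lambda>i\<in>I. x i \<cdot> b"
    have S: "?S = {x \<in> \<Pi>\<^sub>E i\<in>I. Hm K (X i). finite {i \<in> I. x i \<noteq> zer K (X i)}}"
      using sum_group_carrier[OF Ko(2), of I X] X by blast
    have S': "?S' = {x \<in> \<Pi>\<^sub>E i\<in>I. Hm K' (X i). finite {i \<in> I. x i \<noteq> zer K' (X i)}}"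
      using sum_group_carrier[OF Ko(1), of I X] X by blast
    have hK: "bij_betw ?h ?S (Hm K P)"
      using K I P unfolding compact_objects_def iso_def by auto
    have \<Phi>: "bij_betw ?\<Phi> ?S' ?S"
    proof (rule bij_betw_byWitness[where f' = "\<lambda>x. \<lambda>i\<in>I. x i \<cdot> a"])
      have 1: "(x i \<cdot> b) \<cdot> a = x i" if "x \<in> ?S'" "i \<in> I" for x i
        using that b aH unfolding S' by (auto simp: Hom_def PiE_iff)
      have 2: "(x i \<cdot> a) \<cdot> b = x i" if "x \<in> ?S" "i \<in> I" for x i
        using that b aH unfolding S by (auto simp: Hom_def PiE_iff)
      show "\<forall>x\<in>?S'. (\<lambda>i\<in>I. (?\<Phi> x) i \<cdot> a) = x"
        using 1 unfolding S' by (auto simp: PiE_iff extensional_def fun_eq_iff)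
      show "\<forall>x\<in>?S. ?\<Phi> (\<lambda>i\<in>I. x i \<cdot> a) = x"
        using 2 unfolding S by (auto simp: PiE_iff extensional_def fun_eq_iff)
      show "?\<Phi> ` ?S' \<subseteq> ?S"
      proof
        fix y assume "y \<in> ?\<Phi> ` ?S'"
        then obtain x where x: "x \<in> ?S'" "y = ?\<Phi> x" by blast
        have "{i \<in> I. ?\<Phi> x i \<noteq> zer K (X i)} \<subseteq> {i \<in> I. x i \<noteq> zer K' (X i)}"
          using b X by (auto simp: Hom_def)
        moreover have "finite {i \<in> I. x i \<noteq> zer K' (X i)}" using x(1) unfolding S' by simp
        ultimately have fin: "finite {i \<in> I. ?\<Phi> x i \<noteq> zer K (X i)}" by (rule finite_subset)
        have "?\<Phi> x \<in> (\<Pi>\<^sub>E i\<in>I. Hm K (X i))"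
          using x(1) cmp_hom[OF b(1)] unfolding S' by (simp add: PiE_iff)
        with fin show "y \<in> ?S" unfolding S x(2) by blast
      qed
      show "(\<lambda>x. \<lambda>i\<in>I. x i \<cdot> a) ` ?S \<subseteq> ?S'"
      proof
        fix y assume "y \<in> (\<lambda>x. \<lambda>i\<in>I. x i \<cdot> a) ` ?S"
        then obtain x where x: "x \<in> ?S" "y = (\<lambda>i\<in>I. x i \<cdot> a)" by blast
        have "{i \<in> I. (\<lambda>i\<in>I. x i \<cdot> a) i \<noteq> zer K' (X i)} \<subseteq> {i \<in> I. x i \<noteq> zer K (X i)}"
          using aH X by (auto simp: Hom_def)
        moreover have "finite {i \<in> I. x i \<noteq> zer K (X i)}" using x(1) unfolding S by simp
        ultimately have fin: "finite {i \<in> I. (\<lambda>i\<in>I. x i \<cdot> a) i \<noteq> zer K' (X i)}" by (rule finite_subset)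
        have "(\<lambda>i\<in>I. x i \<cdot> a) \<in> (\<Pi>\<^sub>E i\<in>I. Hm K' (X i))"
          using x(1) cmp_hom[OF aH] unfolding S by (simp add: PiE_iff)
        with fin show "y \<in> ?S'" unfolding S' x(2) by blast
      qed
    qed
    have \<Psi>: "bij_betw (\<lambda>f. f \<cdot> a) (Hm K P) (Hm K' P)"
      by (rule bij_betw_byWitness[where f' = "\<lambda>f. f \<cdot> b"]) (use aH b in \<open>auto simp: Hom_def\<close>)
    have b1: "bij_betw ((\<lambda>f. f \<cdot> a) \<circ> (?h \<circ> ?\<Phi>)) ?S' (Hm K' P)"
      using bij_betw_trans[OF bij_betw_trans[OF \<Phi> hK] \<Psi>] .
    have b2: "((\<lambda>f. f \<cdot> a) \<circ> (?h \<circ> ?\<Phi>)) x = ?h' x" if x: "x \<in> ?S'" for x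
    proof -
      have xi: "x i \<in> Hm K' (X i)" if "i \<in> I" for i using x that unfolding S' by (auto simp: PiE_iff)
      have e: "(\<iota> i \<cdot> ?\<Phi> x i) \<cdot> a = \<iota> i \<cdot> x i" if "i \<in> I" for i
        using xi[OF that] j[OF that] aH b that by (simp add: Hom_def)
      have m: "\<iota> i \<cdot> ?\<Phi> x i \<in> Hm K P" if "i \<in> I" for i
        using cmp_hom[OF cmp_hom[OF b(1) xi[OF that]] j[OF that]] that by simp
      have "?h' x = gfinprod (hom_group T K' P) (\<lambda>i. (\<iota> i \<cdot> ?\<Phi> x i) \<cdot> a) I"
        by (rule G'.gfinprod_cong) (use e j xi in \<open>auto intro: cmp_hom simp: simp_implies_def\<close>)
      also have "\<dots> = ?h (?\<Phi> x) \<cdot> a" using gfinprod_cmp[OF a Po m] .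
      finally show ?thesis by simp
    qed
    have "bij_betw ?h' ?S' (Hm K' P)" by (rule iffD1[OF bij_betw_cong[OF b2] b1])
    moreover have "?h' \<in> hom (sum_group I (\<lambda>i. hom_group T K' (X i))) (hom_group T K' P)"
    proof (rule G'.hom_group_sum)
      show "group (hom_group T K' (X i))" if "i \<in> I" for i
        using hom_comm_group[OF Ko(1) X[OF that]] by (simp add: comm_group.axioms)
      show "(\<lambda>f. \<iota> i \<cdot> f) \<in> hom (hom_group T K' (X i)) (hom_group T K' P)" if "i \<in> I" for i
        using j[OF that] cmp_hom cmp_add_right by (auto simp: hom_def)
    qed
    ultimately show ?thesis by (simp add: iso_def)
  qed
  thus ?thesis using Ko unfolding compact_objects_def by blast
qed

text \<open>Surjectivity of the comparison map writes every map from a compact object into a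
  coproduct as a finite sum of maps through single summands. A property stable under sums thus needs
  checking only on one summand.\<close>

lemma compact_induct:
  fixes I :: "'i set"
  assumes K: "K \<in> Tc" and I: "|I| <o \<kappa>" and P: "is_coproduct T I X P \<iota>"
    and g: "g \<in> Hm K P" and zero: "Q (zer K P)"
    and base: "\<And>i x. i \<in> I \<Longrightarrow> x \<in> Hm K (X i) \<Longrightarrow> Q (\<iota> i \<cdot> x)"
    and add: "\<And>g h. g \<in> Hm K P \<Longrightarrow> h \<in> Hm K P \<Longrightarrow> Q g \<Longrightarrow> Q h \<Longrightarrow> Q (g [+] h)"
  shows "Q g"
proof -
  obtain J :: "'u set" and h where J: "bij_betw h J I" "|J| <o \<kappa>" using small_index[OF I] .
  have P': "is_coproduct T J (\<lambda>j. X (h j)) P (\<lambda>j. \<iota> (h j))" using coproduct_reindex[OF J(1) P] .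
  note j = coproduct_inj[OF P']
  let ?S = "sum_group J (\<lambda>j. hom_group T K (X (h j)))"
  have "(\<lambda>x. gfinprod (hom_group T K P) (\<lambda>j. \<iota> (h j) \<cdot> x j) J) \<in> iso ?S (hom_group T K P)"
    using K J(2) P' unfolding compact_objects_def by blast
  hence "Hm K P = (\<lambda>x. gfinprod (hom_group T K P) (\<lambda>j. \<iota> (h j) \<cdot> x j) J) ` carrier ?S"
    by (simp add: iso_def bij_betw_def)
  then obtain x where x: "x \<in> carrier ?S" "g = gfinprod (hom_group T K P) (\<lambda>j. \<iota> (h j) \<cdot> x j) J"
    using g by blast
  have xi: "x i \<in> Hm K (X (h i))" if "i \<in> J" for i
    using x(1) that sum_group_carrier[OF compact_obj[OF K], of J "\<lambda>j. X (h j)"] Hom_objD(1)[OF j]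
    by (auto simp: PiE_iff)
  have hI: "h i \<in> I" if "i \<in> J" for i using that J(1) by (auto simp: bij_betw_def)
  show ?thesis unfolding x(2)
    by (rule gfinprod_induct[OF compact_obj[OF K] coproduct_obj[OF P]])
      (use cmp_hom[OF xi j] zero add base[OF hI xi] in auto)
qed

lemma closed_right_orth:
  assumes K: "K \<in> Tc"
  shows "closed {Y \<in> Ob. orth T K Y}"
  unfolding coprod_closed_def
proof (intro conjI allI impI)
  note Ko = compact_obj[OF K]
  fix I :: "'u set" and X P \<iota>
  assume a: "|I| <o \<kappa> \<and> (\<forall>i\<in>I. X i \<in> {Y \<in> Ob. orth T K Y}) \<and> is_coproduct T I X P \<iota>"
  hence X: "\<And>i. i \<in> I \<Longrightarrow> orth T K (X i)" and P: "is_coproduct T I X P \<iota>" and I: "|I| <o \<kappa>" by auto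
  note Po = coproduct_obj[OF P]
  have "orth T K P"
  proof (rule orthI[OF Ko Po])
    fix g assume g: "g \<in> Hm K P"
    show "g = zer K P"
    proof (rule compact_induct[OF K I P g])
      show "\<iota> i \<cdot> x = zer K P" if "i \<in> I" "x \<in> Hm K (X i)" for i x
        using orthD[OF X[OF that(1)] that(2)] coproduct_inj[OF P that(1)] Ko by (simp add: Hom_def)
      show "g [+] h = zer K P" if "g = zer K P" "h = zer K P" for g h
        using that Ko Po by simp
    qed simp
  qed
  thus "P \<in> {Y \<in> Ob. orth T K Y}" using Po by simp
next
  fix X Z W assume "ext T X Z W \<and> X \<in> {X \<in> Ob. orth T K X} \<and> W \<in> {X \<in> Ob. orth T K X}"
  thus "Z \<in> {X \<in> Ob. orth T K X}"
    using orth_ext_right[of X Z W K] extD[of X Z W] compact_obj[OF K] by simp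
qed auto

text \<open>Eilenberg swindle: with \<open>e = i \<cdot> r\<close> the idempotent on \<open>W\<close> and \<open>N\<close> a countable coproduct of
  copies of \<open>W\<close>, moving the \<open>e\<close>-parts one step to the right is a split monomorphism
  \<open>N \<rightarrow> N\<close> with complement \<open>K\<close>.\<close>

lemma closed_retract:
  assumes S: "closed S" "\<And>X. X \<in> S \<Longrightarrow> Sh X \<in> S" and W: "W \<in> S"
    and i: "i \<in> Hm K W" and r: "r \<in> Hm W K" and ri: "r \<cdot> i = one K"
  shows "K \<in> S"
proof -
  have Wo: "W \<in> Ob" and Ko: "K \<in> Ob" using Hom_objD[OF i] by auto
  obtain N \<iota> where N: "is_coproduct T (UNIV :: nat set) (\<lambda>_. W) N \<iota>"
    using small_coproduct[OF countable_small, of "\<lambda>_. W"] Wo by blast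
  note No = coproduct_obj[OF N]
  have j: "\<iota> n \<in> Hm W N" for n using coproduct_inj[OF N] by simp
  define e where "e = i \<cdot> r"
  define e' where "e' = one W [+] ([-] e)"
  have e: "e \<in> Hm W W" using i r by (simp add: e_def Hom_def)
  have e': "e' \<in> Hm W W" using e Wo by (simp add: e'_def Hom_def)
  have re: "r \<cdot> e = r" using cmp_cong[OF ri, of r] i r by (simp add: e_def Hom_def)
  have ei: "e \<cdot> i = i" using i r ri by (simp add: e_def Hom_def)
  have ee: "e \<cdot> e = e" using i r re by (simp add: e_def Hom_def)
  have 1: "e' \<cdot> e = zer W W" "e \<cdot> e' = zer W W" "e' \<cdot> e' = e'" "e' [+] e = one W" "e [+] e' = one W"
    using e ee Wo hadd_ac(2)[of "one W" "[-] e" e] hadd_ac(3)[of e "one W" "[-] e"]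
    by (simp_all add: e'_def Hom_def)
  have re': "r \<cdot> e' = zer W K" using r e re Wo by (simp add: e'_def Hom_def)
  obtain p where p: "p \<in> Hm N N" "\<And>n. p \<cdot> \<iota> n = \<iota> n \<cdot> e' [+] \<iota> (Suc n) \<cdot> e"
    using coproduct_factor[OF N No, of "\<lambda>n. \<iota> n \<cdot> e' [+] \<iota> (Suc n) \<cdot> e"] add_hom cmp_hom[OF e' j] cmp_hom[OF e j] by auto
  \<comment> \<open>\<open>q\<close> moves the \<open>e\<close>-parts back to the left and discards
    that of copy 0, which \<open>s\<close> records as a map to \<open>K\<close>.\<close>
  obtain q where q: "q \<in> Hm N N" "\<And>n. q \<cdot> \<iota> n = (case n of 0 \<Rightarrow> \<iota> 0 \<cdot> e' | Suc m \<Rightarrow> \<iota> n \<cdot> e' [+] \<iota> m \<cdot> e)"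
  proof (rule coproduct_factor[OF N No, where f = "\<lambda>n. case n of 0 \<Rightarrow> \<iota> 0 \<cdot> e' | Suc m \<Rightarrow> \<iota> n \<cdot> e' [+] \<iota> m \<cdot> e"])
    show "(case n of 0 \<Rightarrow> \<iota> 0 \<cdot> e' | Suc m \<Rightarrow> \<iota> n \<cdot> e' [+] \<iota> m \<cdot> e) \<in> Hm W N" for n
      using add_hom cmp_hom[OF e' j] cmp_hom[OF e j] by (cases n) simp_all
  qed auto
  obtain s where s: "s \<in> Hm N K" "\<And>n. s \<cdot> \<iota> n = (case n of 0 \<Rightarrow> r | Suc m \<Rightarrow> zer W K)"
  proof (rule coproduct_factor[OF N Ko, where f = "\<lambda>n. case n of 0 \<Rightarrow> r | Suc m \<Rightarrow> zer W K"])
    show "(case n of 0 \<Rightarrow> r | Suc m \<Rightarrow> zer W K) \<in> Hm W K" for n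
      using r zero_hom[OF Wo Ko] by (cases n) simp_all
  qed auto
  have t: "\<iota> 0 \<cdot> i \<in> Hm K N" using cmp_hom[OF i j] .
  note H = e[unfolded Hom_def] e'[unfolded Hom_def] j[unfolded Hom_def] p(1)[unfolded Hom_def] q(1)[unfolded Hom_def]
    s(1)[unfolded Hom_def] i[unfolded Hom_def] r[unfolded Hom_def] Wo Ko No
  have qi: "q \<cdot> (\<iota> n \<cdot> f) = (case n of 0 \<Rightarrow> \<iota> 0 \<cdot> (e' \<cdot> f) | Suc m \<Rightarrow> \<iota> n \<cdot> (e' \<cdot> f) [+] \<iota> m \<cdot> (e \<cdot> f))"
    if f: "f \<in> Hm W W" for f n
    using cmp_cong[OF q(2)[of n], of f] f H by (cases n) (simp_all add: Hom_def)
  have pi: "p \<cdot> (\<iota> n \<cdot> f) = \<iota> n \<cdot> (e' \<cdot> f) [+] \<iota> (Suc n) \<cdot> (e \<cdot> f)" if f: "f \<in> Hm W W" for f n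
    using cmp_cong[OF p(2)[of n], of f] f H by (simp add: Hom_def)
  have split: "\<iota> n \<cdot> e' [+] \<iota> n \<cdot> e = \<iota> n" "\<iota> n \<cdot> e [+] \<iota> n \<cdot> e' = \<iota> n" for n
  proof -
    have "\<iota> n \<cdot> (e' [+] e) = \<iota> n" "\<iota> n \<cdot> (e [+] e') = \<iota> n" using 1(4,5) H by simp_all
    thus "\<iota> n \<cdot> e' [+] \<iota> n \<cdot> e = \<iota> n" "\<iota> n \<cdot> e [+] \<iota> n \<cdot> e' = \<iota> n" using H by simp_all
  qed
  have "ext T N N K"
  proof (rule biproduct_ext[OF p(1) q(1) _ s(1) t])
    show "q \<cdot> p = one N"
    proof (rule coproduct_eqI[OF N cmp_hom[OF p(1) q(1)] ident_hom[OF No]])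
      fix n
      have "(q \<cdot> p) \<cdot> \<iota> n = q \<cdot> (\<iota> n \<cdot> e') [+] q \<cdot> (\<iota> (Suc n) \<cdot> e)" using p(2)[of n] H by simp
      also have "\<dots> = \<iota> n" using qi[OF e', of n] qi[OF e, of "Suc n"] 1 ee H split by (cases n) simp_all
      also have "\<dots> = one N \<cdot> \<iota> n" using H by simp
      finally show "(q \<cdot> p) \<cdot> \<iota> n = one N \<cdot> \<iota> n" .
    qed
    show "s \<cdot> (\<iota> 0 \<cdot> i) = one K"
      using cmp_cong[OF s(2)[of 0], of i] ri H by simp
    show "p \<cdot> q [+] (\<iota> 0 \<cdot> i) \<cdot> s = one N"
    proof (rule coproduct_eqI[OF N _ ident_hom[OF No]])
      show "p \<cdot> q [+] (\<iota> 0 \<cdot> i) \<cdot> s \<in> Hm N N"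
        using add_hom[OF cmp_hom[OF q(1) p(1)] cmp_hom[OF s(1) t]] .
      fix n
      have isn: "\<iota> 0 \<cdot> (i \<cdot> (s \<cdot> \<iota> n)) = (case n of 0 \<Rightarrow> \<iota> 0 \<cdot> e | Suc m \<Rightarrow> zer W N)"
        using s(2)[of n] H by (cases n) (simp_all add: e_def)
      have pq: "p \<cdot> (q \<cdot> \<iota> n) = (case n of 0 \<Rightarrow> \<iota> 0 \<cdot> e' | Suc m \<Rightarrow> \<iota> n)"
        using q(2)[of n] pi[OF e', of n] pi[OF e, of "n - 1"] 1 ee H split by (cases n) simp_all
      have "(p \<cdot> q [+] (\<iota> 0 \<cdot> i) \<cdot> s) \<cdot> \<iota> n = p \<cdot> (q \<cdot> \<iota> n) [+] \<iota> 0 \<cdot> (i \<cdot> (s \<cdot> \<iota> n))"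
        using H by simp
      also have "\<dots> = \<iota> n" unfolding isn pq using split H by (cases n) simp_all
      also have "\<dots> = one N \<cdot> \<iota> n" using H by simp
      finally show "(p \<cdot> q [+] (\<iota> 0 \<cdot> i) \<cdot> s) \<cdot> \<iota> n = one N \<cdot> \<iota> n" .
    qed
  qed
  \<comment> \<open>Rotation makes \<open>K\<close> an extension of \<open>Sh N\<close> by
    \<open>N\<close>; this is where stability of \<open>S\<close> under the shift enters.\<close>
  hence "ext T N K (Sh N)" using ext_rotate by blast
  moreover have "N \<in> S" using closed_coproduct[OF S(1) countable_small N] W by simp
  ultimately show ?thesis using closed_ext[OF S(1)] S(2) by blast
qed

end

subsection \<open>Approximating compact objects by shifts of the generator\<close>

locale compactly_generated = coproduct_triangulated T \<kappa>
  for T :: "('o, 'm, 'z) tcat_scheme" (structure) and \<kappa> :: "'u rel" +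
  fixes G :: 'o
  assumes generated: "compactly_generated_by \<kappa> T {G}"
    and compact_triangulated: "triangulated_subcategory T (compact_objects \<kappa> T)"
begin

abbreviation "Tcm \<equiv> Tc_minus \<kappa> T G"
abbreviation "Tcb \<equiv> Tc_bounded \<kappa> T G"
text \<open>One notation for both kinds of range: \<open>cg {n..}\<close> is an aisle by
  \<open>aisle_eq\<close>, and \<open>cg {- n..n}\<close> holds the objects built from boundedly
  many different shifts.\<close>

abbreviation "cg J \<equiv> Coprod \<kappa> T ((\<lambda>i. shift_pow T i G) ` J)"

section \<open>Classes generated by shifts of \<open>G\<close>\<close>

lemma G_compact: "G \<in> Tc"
  using generated by (simp add: compactly_generated_by_def)

lemma G_obj [simp]: "G \<in> Ob"
  using compact_obj[OF G_compact] .

lemma shift_compact: "K \<in> Tc \<Longrightarrow> Sp i K \<in> Tc"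
  using tri_sub_shift_pow[OF compact_triangulated compact_obj] by blast

lemma cg_closed: "closed (cg J)"
  by (rule Coprod_closed) auto

lemma cg_obj: "X \<in> cg J \<Longrightarrow> X \<in> Ob"
  using closed_obj[OF cg_closed] by blast

lemma cg_mono: "J \<subseteq> J' \<Longrightarrow> cg J \<subseteq> cg J'"
  using Coprod_least[OF cg_closed[of J'], of "(\<lambda>i. Sp i G) ` J"]
    Coprod_incl[of "(\<lambda>i. Sp i G) ` J'"] by (meson image_mono subset_trans)

lemma shift_G_cg: "i \<in> J \<Longrightarrow> Sp i G \<in> cg J"
  using Coprod_incl[of "(\<lambda>i. Sp i G) ` J"] by auto

lemma cg_shift_pow:
  assumes "X \<in> cg J" "\<And>j. j \<in> J \<Longrightarrow> k + j \<in> J'"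
  shows "Sp k X \<in> cg J'"
proof -
  have "cg J \<subseteq> {X \<in> Ob. Sp k X \<in> cg J'}"
  proof (rule Coprod_least[OF closed_shift_pow[OF cg_closed]])
    show "(\<lambda>i. Sp i G) ` J \<subseteq> {X \<in> Ob. Sp k X \<in> cg J'}"
      using closed_iso[OF cg_closed isomorphic_sym[OF shift_pow_add[OF G_obj]]] shift_G_cg assms(2)
      by auto
  qed
  thus ?thesis using assms(1) by blast
qed

lemma cg_Sh:
  assumes "X \<in> cg J" "\<And>j. j \<in> J \<Longrightarrow> 1 + j \<in> J'"
  shows "Sh X \<in> cg J'"
  using cg_shift_pow[OF assms] by (simp add: shift_pow_def)

lemma generation:
  assumes "X \<in> Ob" "\<And>i. orth T (Sp i G) X"
  shows "zero_object T X"
  using generated assms unfolding compactly_generated_by_def orth_def by blast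

lemma finite_Union_small:
  assumes "finite F" "\<And>j. j \<in> F \<Longrightarrow> |A j| <o \<kappa>"
  shows "|\<Union>j\<in>F. A j| <o \<kappa>"
  using assms
proof (induction F rule: finite_induct)
  case empty
  show ?case using finite_small[of "{}"] by simp
next
  case (insert j F)
  have c: "Card_order \<kappa>" "natLeq <o \<kappa>" using small by (auto simp: smallness_cardinal_def)
  have le: "natLeq \<le>o |Field \<kappa>|"
    using ordLess_imp_ordLeq[OF c(2)] ordIso_symmetric[OF card_of_Field_ordIso[OF c(1)]] ordLeq_ordIso_trans by blast
  have "\<not> finite (Field \<kappa>)" using infinite_iff_natLeq_ordLeq[of "Field \<kappa>"] le by blast
  hence "|A j \<union> (\<Union>j\<in>F. A j)| <o \<kappa>"
    by (rule card_of_Un_ordLess_infinite_Field[OF _ c(1)]) (use insert in auto)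
  thus ?case by simp
qed

text \<open>\<open>Y'\<close> is the cone of the universal map to \<open>Y\<close> from a coproduct
  of the shifts \<open>Sp j G\<close> with \<open>j\<close> in the range, one summand for each map
  to \<open>Y\<close>.\<close>

lemma cell_attachment:
  fixes n :: int
  assumes Y: "Y \<in> Ob"
  obtains Y' V y v w where "tri Y Y' V y v w" "V \<in> cg {- (n + 1)..n + 1}"
    "\<And>j f. j \<in> {- n..n} \<Longrightarrow> f \<in> Hm (Sp j G) Y \<Longrightarrow> y \<cdot> f = zer (Sp j G) Y'"
proof -
  \<comment> \<open>An arrow determines its source, so the arrows themselves can index the coproduct
    of the objects \<open>src T f\<close>.\<close>
  define I where "I = (\<Union>j\<in>{- n..n}. Hm (Sp j G) Y)"
  have I: "|I| <o \<kappa>" unfolding I_def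
  proof (rule finite_Union_small)
    show "|Hm (Sp j G) Y| <o \<kappa>" for j
      using generated shift_compact[OF G_compact] Y unfolding compactly_generated_by_def by blast
  qed simp
  have srcI: "src T f \<in> (\<lambda>i. Sp i G) ` {- n..n}" "f \<in> Hm (src T f) Y" if "f \<in> I" for f
    using that unfolding I_def Hom_def by auto
  have "src T f \<in> Ob" if "f \<in> I" for f using Hom_objD(1)[OF srcI(2)[OF that]] .
  then obtain Q \<iota> where Q: "is_coproduct T I (src T) Q \<iota>" using small_coproduct[OF I, of "src T"] by blast
  have QC: "Q \<in> cg {- n..n}"
    by (rule closed_coproduct[OF cg_closed I Q]) (use Coprod_incl srcI(1) in blast)
  obtain q where q: "q \<in> Hm Q Y" "\<And>f. f \<in> I \<Longrightarrow> q \<cdot> \<iota> f = f"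
    using coproduct_factor[OF Q Y, of "\<lambda>f. f"] srcI(2) by blast
  obtain Y' y w where t: "tri Q Y Y' q y w" using tri_complete[OF q(1)] by blast
  show ?thesis
  proof (rule that[OF rotate[OF t]])
    \<comment> \<open>The cone of \<open>y\<close> is the shift of the attached coproduct, which
      costs one exponent.\<close>
    show "Sh Q \<in> cg {- (n + 1)..n + 1}" by (rule cg_Sh[OF QC]) auto
    show "y \<cdot> f = zer (Sp j G) Y'" if j: "j \<in> {- n..n}" and f: "f \<in> Hm (Sp j G) Y" for j f
    proof -
      have fI: "f \<in> I" using j f unfolding I_def by blast
      note \<iota> = coproduct_inj[OF Q fI]
      have "y \<cdot> f = (y \<cdot> q) \<cdot> \<iota> f"
        using q(2)[OF fI] cmp_assoc[OF \<iota> q(1) dist_triD(2)[OF t]] by simp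
      also have "\<dots> = zer (src T f) Y'"
        using tri_cmp_zero(1)[OF t] \<iota> dist_triD(4-6)[OF t] by (simp add: Hom_def)
      finally show ?thesis using f by (simp add: Hom_def)
    qed
  qed
qed

end

text \<open>The image of a map \<open>f : K -> Y n\<close> in \<open>Y (n + k)\<close>. Composition
  happens at the inner end, so induction on \<open>k\<close> advances \<open>n\<close>, just as
  preimages under \<open>d\<close> are built.\<close>

primrec transport :: "('o, 'm, 'z) tcat_scheme \<Rightarrow> (nat \<Rightarrow> 'm) \<Rightarrow> nat \<Rightarrow> nat \<Rightarrow> 'm \<Rightarrow> 'm" where
  "transport T y 0 n f = f"
| "transport T y (Suc k) n f = transport T y k (Suc n) (cmp T (y n) f)"

text \<open>A sequence \<open>Y 0 -> Y 1 -> ...\<close> with coproduct \<open>P\<close>, projections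
  \<open>p n\<close> and the map \<open>s\<close> induced by the \<open>y n\<close>. The cone of
  \<open>d = 1 - s\<close> is the homotopy colimit.\<close>

locale telescope = coproduct_triangulated T \<kappa>
  for T :: "('o, 'm, 'z) tcat_scheme" (structure) and \<kappa> :: "'u rel" +
  fixes Y :: "nat \<Rightarrow> 'o" and y :: "nat \<Rightarrow> 'm" and P :: 'o and \<iota> :: "nat \<Rightarrow> 'm"
    and p :: "nat \<Rightarrow> 'm" and s :: 'm
  assumes y: "y n \<in> Hom T (Y n) (Y (Suc n))"
    and P: "is_coproduct T UNIV Y P \<iota>"
    and p: "p n \<in> Hom T P (Y n)"
    and pi: "p n \<cdot> \<iota> m = (if m = n then ident T (Y n) else hzero T (Y m) (Y n))"
    and s: "s \<in> Hom T P P" and si: "s \<cdot> \<iota> n = \<iota> (Suc n) \<cdot> y n"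
begin

definition d :: 'm where "d = one P [+] ([-] s)"

section \<open>Maps from compact objects into a homotopy colimit\<close>

lemma P_obj [simp]: "P \<in> Ob" using coproduct_obj[OF P] .
lemma Y_obj [simp]: "Y n \<in> Ob" using Hom_objD(1)[OF y] .
lemma \<iota>: "\<iota> n \<in> Hm (Y n) P" using coproduct_inj[OF P] by simp

lemmas arr [simp] = y[unfolded Hom_def, simplified] \<iota>[unfolded Hom_def, simplified]
  p[unfolded Hom_def, simplified] s[unfolded Hom_def, simplified]

lemma d: "d \<in> Hm P P" by (simp add: d_def Hom_def)

lemma p_s: "p 0 \<cdot> s = zer P (Y 0)" "p (Suc n) \<cdot> s = y n \<cdot> p n"
proof -
  show "p 0 \<cdot> s = zer P (Y 0)"
  proof (rule coproduct_eqI[OF P cmp_hom[OF s p] zero_hom])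
    show "(p 0 \<cdot> s) \<cdot> \<iota> m = zer P (Y 0) \<cdot> \<iota> m" for m
      using cmp_cong[OF pi[of 0 "Suc m"], of "y m"] by (simp add: si)
  qed simp_all
  show "p (Suc n) \<cdot> s = y n \<cdot> p n"
  proof (rule coproduct_eqI[OF P cmp_hom[OF s p] cmp_hom[OF p y]])
    show "(p (Suc n) \<cdot> s) \<cdot> \<iota> m = (y n \<cdot> p n) \<cdot> \<iota> m" for m
      using cmp_cong[OF pi[of "Suc n" "Suc m"], of "y m"] by (simp add: si pi)
  qed
qed

text \<open>The idempotent of \<open>P\<close> that keeps the first \<open>n\<close> summands; it
  expresses that a map into \<open>P\<close> has finite support.\<close>

primrec e :: "nat \<Rightarrow> 'm" where
  "e 0 = zer P P"
| "e (Suc n) = e n [+] \<iota> n \<cdot> p n"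

lemma e: "e n \<in> Hm P P"
  by (induction n) (auto simp: Hom_def)

lemma e_inj: "e n \<cdot> \<iota> m = (if m < n then \<iota> m else zer (Y m) P)"
proof (induction n)
  case 0 show ?case by simp
next
  case (Suc n)
  have "e n \<in> Arr T" "src T (e n) = P" "tgt T (e n) = P" using e[of n] by (auto simp: Hom_def)
  thus ?case using Suc by (cases "m = n") (auto simp: pi)
qed

text \<open>A map from a compact object is fixed by some \<open>e n\<close>, which is a finite sum
  of terms \<open>\<iota> i \<cdot> p i\<close>, so its components determine it.\<close>

lemma jointly_monic:
  assumes K: "K \<in> Tc" and g: "g \<in> Hm K P"
    and z: "\<And>n. p n \<cdot> g = zer K (Y n)"
  shows "g = zer K P"
proof -
  have Ko: "K \<in> Ob" using compact_obj[OF K] .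
  have eA: "e n \<in> Arr T" "src T (e n) = P" "tgt T (e n) = P" for n using e[of n] by (auto simp: Hom_def)
  \<comment> \<open>Asking for all large \<open>m\<close> makes the property stable under
    sums.\<close>
  have "\<exists>n. \<forall>m\<ge>n. e m \<cdot> g = g"
  proof (rule compact_induct[OF K countable_small P g])
    show "\<exists>n. \<forall>m\<ge>n. e m \<cdot> zer K P = zer K P" using eA Ko by simp
    show "\<exists>n. \<forall>m\<ge>n. e m \<cdot> (\<iota> i \<cdot> x) = \<iota> i \<cdot> x" if x: "x \<in> Hm K (Y i)" for i x
    proof (intro exI[of _ "Suc i"] allI impI)
      show "e m \<cdot> (\<iota> i \<cdot> x) = \<iota> i \<cdot> x" if "m \<ge> Suc i" for m
        by (rule cmp_cong) (use that x eA in \<open>auto simp: e_inj Hom_def\<close>)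
    qed
    show "\<exists>n. \<forall>m\<ge>n. e m \<cdot> (g [+] h) = g [+] h"
      if gh: "g \<in> Hm K P" "h \<in> Hm K P" "\<exists>n. \<forall>m\<ge>n. e m \<cdot> g = g" "\<exists>n. \<forall>m\<ge>n. e m \<cdot> h = h" for g h
    proof -
      obtain n n' where "\<forall>m\<ge>n. e m \<cdot> g = g" "\<forall>m\<ge>n'. e m \<cdot> h = h" using gh by blast
      thus ?thesis using gh(1,2) eA by (intro exI[of _ "max n n'"]) (auto simp: Hom_def)
    qed
  qed
  then obtain n where n: "e n \<cdot> g = g" by blast
  have "e n \<cdot> g = zer K P" for n
  proof (induction n)
    case 0 show ?case using g by (simp add: Hom_def)
  next
    case (Suc n)
    have "(\<iota> n \<cdot> p n) \<cdot> g = zer K P" using g z[of n] Ko by (simp add: Hom_def)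
    thus ?case using Suc g eA Ko by (simp add: Hom_def del: cmp_assoc_arr)
  qed
  thus ?thesis using n by simp
qed

lemma d_cmp: "g \<in> Hm K P \<Longrightarrow> d \<cdot> g = h \<Longrightarrow> g = h [+] s \<cdot> g"
  using hadd_ac(2)[of g "[-] (s \<cdot> g)" "s \<cdot> g"] by (auto simp: d_def Hom_def)

text \<open>From \<open>g = s \<cdot> g\<close> the component at 0 vanishes, and each further
  component is the previous one composed with some \<open>y n\<close>.\<close>

lemma d_injective:
  assumes K: "K \<in> Tc" and g: "g \<in> Hm K P" and dg: "d \<cdot> g = zer K P"
  shows "g = zer K P"
proof (rule jointly_monic[OF K g])
  have Ko: "K \<in> Ob" using compact_obj[OF K] .
  have sg: "g = s \<cdot> g" using d_cmp[OF g dg] g Ko by (simp add: Hom_def)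
  show "p n \<cdot> g = zer K (Y n)" for n
  proof (induction n)
    case 0
    have "p 0 \<cdot> (s \<cdot> g) = zer K (Y 0)" using cmp_cong[OF p_s(1), of g] g by (simp add: Hom_def)
    thus ?case using sg by simp
  next
    case (Suc n)
    have "p (Suc n) \<cdot> (s \<cdot> g) = y n \<cdot> (p n \<cdot> g)"
      using cmp_cong[OF p_s(2), of g] g by (simp add: Hom_def)
    thus ?case using sg Suc Ko by simp
  qed
qed

text \<open>Modulo the image of \<open>d\<close>, the map \<open>\<iota> n \<cdot> f\<close> equals
  \<open>\<iota> (Suc n) \<cdot> y n \<cdot> f\<close>. Pushing it along the sequence until it dies
  and adding up the terms gives a preimage.\<close>

lemma d_surjective:
  assumes K: "K \<in> Tc" and g: "g \<in> Hm K P"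
    and van: "\<And>n f. f \<in> Hm K (Y n) \<Longrightarrow> \<exists>k. transport T y k n f = zer K (Y (n + k))"
  shows "\<exists>h \<in> Hm K P. d \<cdot> h = g"
proof (rule compact_induct[OF K countable_small P g])
  have Ko: "K \<in> Ob" using compact_obj[OF K] .
  have dA: "d \<in> Arr T" "src T d = P" "tgt T d = P" using d by (auto simp: Hom_def)
  show "\<exists>h \<in> Hm K P. d \<cdot> h = zer K P"
    using zero_hom[OF Ko P_obj] dA Ko by (intro bexI[of _ "zer K P"]) auto
  have "\<exists>h \<in> Hm K P. d \<cdot> h = \<iota> n \<cdot> f"
    if "f \<in> Hm K (Y n)" "transport T y k n f = zer K (Y (n + k))" for k n f
    using that
  proof (induction k arbitrary: n f)
    case 0
    hence "\<iota> n \<cdot> f = zer K P" using Ko by simp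
    thus ?case using zero_hom[OF Ko P_obj] dA Ko by (intro bexI[of _ "zer K P"]) auto
  next
    case (Suc k)
    have yf: "y n \<cdot> f \<in> Hm K (Y (Suc n))" using cmp_hom[OF Suc.prems(1) y] .
    obtain h where h: "h \<in> Hm K P" "d \<cdot> h = \<iota> (Suc n) \<cdot> (y n \<cdot> f)"
      using Suc.IH[OF yf] Suc.prems(2) by auto
    have if': "\<iota> n \<cdot> f \<in> Hm K P" using cmp_hom[OF Suc.prems(1) \<iota>] .
    have sf: "s \<cdot> (\<iota> n \<cdot> f) = \<iota> (Suc n) \<cdot> (y n \<cdot> f)"
      using cmp_cong[OF si, of f n] Suc.prems(1) by (simp add: Hom_def)
    have "d \<cdot> (\<iota> n \<cdot> f [+] h) = d \<cdot> (\<iota> n \<cdot> f) [+] \<iota> (Suc n) \<cdot> (y n \<cdot> f)"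
      using if' h dA Suc.prems(1) by (simp add: Hom_def)
    also have "d \<cdot> (\<iota> n \<cdot> f) = \<iota> n \<cdot> f [+] ([-] (\<iota> (Suc n) \<cdot> (y n \<cdot> f)))"
      using if' sf Suc.prems(1) by (simp add: d_def Hom_def)
    also have "\<dots> [+] \<iota> (Suc n) \<cdot> (y n \<cdot> f) = \<iota> n \<cdot> f"
      using hadd_ac(2)[of "\<iota> n \<cdot> f" "[-] (\<iota> (Suc n) \<cdot> (y n \<cdot> f))" "\<iota> (Suc n) \<cdot> (y n \<cdot> f)"] Suc.prems(1)
      by (simp add: Hom_def)
    finally show ?case using add_hom[OF if' h(1)] by blast
  qed
  thus "\<exists>h \<in> Hm K P. d \<cdot> h = \<iota> n \<cdot> f" if "f \<in> Hm K (Y n)" for n f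
    using van[OF that] that by blast
  show "\<exists>h \<in> Hm K P. d \<cdot> h = g [+] g'" if gg': "\<exists>h \<in> Hm K P. d \<cdot> h = g" "\<exists>h \<in> Hm K P. d \<cdot> h = g'" for g g'
  proof -
    obtain h h' where h: "h \<in> Hm K P" "h' \<in> Hm K P" "d \<cdot> h = g" "d \<cdot> h' = g'" using gg' by blast
    have "d \<cdot> (h [+] h') = g [+] g'" using cmp_add_right[OF h(1,2) d] h by simp
    thus ?thesis using add_hom[OF h(1,2)] by blast
  qed
qed

text \<open>In the long exact sequence \<open>d\<close> is onto on maps from \<open>K\<close> and
  injective on maps from the desuspension \<open>K'\<close>, which leaves nothing for maps from
  \<open>K\<close> to \<open>H\<close>.\<close>

lemma cone_orth:
  assumes H: "tri P P H d v w"
    and K: "K \<in> Tc" "K' \<in> Tc" "isom (Sh K') K"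
    and van: "\<And>n f. f \<in> Hm K (Y n) \<Longrightarrow> \<exists>k. transport T y k n f = zer K (Y (n + k))"
  shows "orth T K H"
proof (rule orthI)
  note HD = dist_triD[OF H]
  have Ko: "K \<in> Ob" "K' \<in> Ob" using compact_obj K by blast+
  thus "K \<in> Ob" "H \<in> Ob" using HD by auto
  fix f assume f: "f \<in> Hm K H"
  obtain a where a: "is_iso T (Sh K') K a" using K(3) unfolding isomorphic_def by blast
  have aH: "a \<in> Hm (Sh K') K" using a by (simp add: is_iso_def)
  have wf: "w \<cdot> f \<in> Hm K (Sh P)" using cmp_hom[OF f HD(3)] .
  obtain g where g: "g \<in> Hm K' P" "Sa g = (w \<cdot> f) \<cdot> a"
    using shA_full[OF cmp_hom[OF aH wf] Ko(2) P_obj] .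
  have "Sa (d \<cdot> g) = Sa d \<cdot> ((w \<cdot> f) \<cdot> a)" using g d by (simp add: Hom_def)
  also have "\<dots> = (Sa d \<cdot> w) \<cdot> (f \<cdot> a)" using d HD f aH by (simp add: Hom_def)
  also have "\<dots> = Sa (zer K' P)"
    using tri_cmp_zero(3)[OF H] f aH Ko by (simp add: Hom_def)
  finally have "d \<cdot> g = zer K' P" using shA_inj[OF cmp_hom[OF g(1) d] zero_hom] Ko by simp
  hence "g = zer K' P" using d_injective[OF K(2) g(1)] by blast
  hence "(w \<cdot> f) \<cdot> a = zer K (Sh P) \<cdot> a" using g aH Ko by (simp add: Hom_def)
  hence "w \<cdot> f = zer K (Sh P)" using iso_cancel(2)[OF a wf zero_hom] Ko by simp
  then obtain h where h: "h \<in> Hm K P" "v \<cdot> h = f" using tri_factor_left2[OF H f] by blast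
  obtain k where k: "k \<in> Hm K P" "d \<cdot> k = h" using d_surjective[OF K(1) h(1) van] by blast
  have "f = (v \<cdot> d) \<cdot> k" using h k d HD by (auto simp: Hom_def)
  also have "\<dots> = zer K H" using tri_cmp_zero(1)[OF H] k HD by (simp add: Hom_def)
  finally show "f = zer K H" .
qed

text \<open>If \<open>H\<close> is zero, then \<open>\<iota> 0 = d \<cdot> h\<close> for some
  \<open>h\<close>, and the components of \<open>h\<close> are forced to be the maps
  \<open>c n\<close>. Compactness allows only finitely many nonzero components.\<close>

lemma vanishing_stage:
  assumes K: "K \<in> Tc" and Y0: "Y 0 = K"
    and c: "c 0 = one K" "\<And>n. c (Suc n) = y n \<cdot> c n"
    and H: "tri P P H d v w" "zero_object T H"
  shows "\<exists>n. c n = zer K (Y n)"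
proof -
  have Ko: "K \<in> Ob" using compact_obj[OF K] .
  have i0: "\<iota> 0 \<in> Hm K P" using \<iota>[of 0] Y0 by simp
  have "v \<cdot> \<iota> 0 = zer K H"
    by (rule zero_object_Hom(1)[OF H(2)]) (use cmp_hom[OF i0 dist_triD(2)[OF H(1)]] in blast)
  then obtain h where h: "h \<in> Hm K P" "d \<cdot> h = \<iota> 0" using tri_factor_left[OF H(1) i0] by blast
  have hs: "h = \<iota> 0 [+] s \<cdot> h" using d_cmp[OF h] .
  have ph: "p n \<cdot> h = p n \<cdot> \<iota> 0 [+] (p n \<cdot> s) \<cdot> h" for n
  proof -
    have "p n \<cdot> h = p n \<cdot> (\<iota> 0 [+] s \<cdot> h)" using hs by simp
    thus ?thesis using h(1) Y0 by (simp add: Hom_def)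
  qed
  have pc: "p n \<cdot> h = c n" for n
  proof (induction n)
    case 0 show ?case using ph[of 0] h(1) Y0 Ko c(1) by (simp add: pi p_s Hom_def)
  next
    case (Suc n)
    have "p (Suc n) \<cdot> h = y n \<cdot> (p n \<cdot> h)"
      using ph[of "Suc n"] h(1) Y0 Ko by (simp add: pi p_s Hom_def)
    thus ?case using Suc c(2) by simp
  qed
  have "\<exists>n. p n \<cdot> h = zer K (Y n)"
  proof -
    have "\<exists>N. \<forall>n\<ge>N. p n \<cdot> h = zer K (Y n)"
    proof (rule compact_induct[OF K countable_small P h(1)])
      show "\<exists>N. \<forall>n\<ge>N. p n \<cdot> zer K P = zer K (Y n)" using Ko by simp
      show "\<exists>N. \<forall>n\<ge>N. p n \<cdot> (\<iota> i \<cdot> x) = zer K (Y n)" if x: "x \<in> Hm K (Y i)" for i x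
      proof (intro exI[of _ "Suc i"] allI impI)
        show "p n \<cdot> (\<iota> i \<cdot> x) = zer K (Y n)" if "n \<ge> Suc i" for n
          using cmp_cong[OF pi[of n i], of x] x that by (simp add: Hom_def)
      qed
      show "\<exists>N. \<forall>n\<ge>N. p n \<cdot> (g [+] g') = zer K (Y n)"
        if gh: "g \<in> Hm K P" "g' \<in> Hm K P"
          "\<exists>N. \<forall>n\<ge>N. p n \<cdot> g = zer K (Y n)" "\<exists>N. \<forall>n\<ge>N. p n \<cdot> g' = zer K (Y n)" for g g'
      proof -
        obtain N N' where "\<forall>n\<ge>N. p n \<cdot> g = zer K (Y n)" "\<forall>n\<ge>N'. p n \<cdot> g' = zer K (Y n)"
          using gh by blast
        thus ?thesis using gh(1,2) Ko by (intro exI[of _ "max N N'"]) (auto simp: Hom_def)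
      qed
    qed
    thus ?thesis by blast
  qed
  thus ?thesis using pc by auto
qed

end

context coproduct_triangulated begin

lemma telescope_exists:
  fixes Y :: "nat \<Rightarrow> 'o"
  assumes y: "\<And>n. y n \<in> Hm (Y n) (Y (Suc n))"
  obtains P \<iota> p s where "telescope T \<kappa> Y y P \<iota> p s"
proof -
  have Yo: "Y n \<in> Ob" for n using Hom_objD(1)[OF y] .
  obtain P \<iota> where P: "is_coproduct T UNIV Y P \<iota>" using small_coproduct[OF countable_small, of Y] Yo by blast
  note j = coproduct_inj[OF P UNIV_I]
  have "\<forall>n. \<exists>q. q \<in> Hm P (Y n) \<and> (\<forall>m. q \<cdot> \<iota> m = (if m = n then one (Y n) else zer (Y m) (Y n)))"
  proof
    fix n
    obtain q where "q \<in> Hm P (Y n)"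
      "\<And>m. q \<cdot> \<iota> m = (if m = n then one (Y n) else zer (Y m) (Y n))"
    proof (rule coproduct_factor[OF P Yo[of n],
          where f = "\<lambda>m. if m = n then one (Y n) else zer (Y m) (Y n)"])
      show "(if m = n then one (Y n) else zer (Y m) (Y n)) \<in> Hm (Y m) (Y n)" for m
        using ident_hom zero_hom Yo by simp
    qed auto
    thus "\<exists>q. q \<in> Hm P (Y n) \<and> (\<forall>m. q \<cdot> \<iota> m = (if m = n then one (Y n) else zer (Y m) (Y n)))"
      by blast
  qed
  from choice[OF this] obtain p where "\<forall>n. p n \<in> Hm P (Y n) \<and>
    (\<forall>m. p n \<cdot> \<iota> m = (if m = n then one (Y n) else zer (Y m) (Y n)))" by blast
  hence p: "\<And>n. p n \<in> Hm P (Y n)"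
    "\<And>n m. p n \<cdot> \<iota> m = (if m = n then one (Y n) else zer (Y m) (Y n))" by blast+
  obtain s where s: "s \<in> Hm P P" "\<And>n. s \<cdot> \<iota> n = \<iota> (Suc n) \<cdot> y n"
  proof (rule coproduct_factor[OF P coproduct_obj[OF P], where f = "\<lambda>n. \<iota> (Suc n) \<cdot> y n"])
    show "\<iota> (Suc n) \<cdot> y n \<in> Hm (Y n) P" for n using cmp_hom[OF y j] .
  qed auto
  have "telescope T \<kappa> Y y P \<iota> p s"
    by unfold_locales (use y P p s in auto)
  thus ?thesis using that by blast
qed

end

context compactly_generated begin

text \<open>Attaching to \<open>K\<close> in the \<open>n\<close>-th step only cells \<open>\<Sigma>\<^sup>jG\<close> with \<open>|j| \<le> n\<close> still kills every map
  from a shift of \<open>G\<close> after finitely many steps, so the homotopy colimit vanishes and \<open>K\<close>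
  maps to zero at a finite stage, where only boundedly many shifts of \<open>G\<close> have been used.\<close>

lemma Sh_compact_retract:
  assumes K: "K \<in> Tc"
  obtains n :: nat and W i r where "W \<in> cg {- int n..int n}"
    "i \<in> Hm (Sh K) W" "r \<in> Hm W (Sh K)" "r \<cdot> i = one (Sh K)"
proof -
  have Ko: "K \<in> Ob" using compact_obj[OF K] .
  define R where "R n Y Y' y \<longleftrightarrow> (\<exists>V v w. tri Y Y' V y v w \<and> V \<in> cg {- (int n + 1)..int n + 1}) \<and>
    (\<forall>j\<in>{- int n..int n}. \<forall>f\<in>Hm (Sp j G) Y. y \<cdot> f = zer (Sp j G) Y')"
    for n :: nat and Y Y' y
  \<comment> \<open>The guard under the quantifier makes the chosen functions total, so the sequence
    can be defined by plain recursion.\<close>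
  have "\<exists>Y' y. Y \<in> Ob \<longrightarrow> R n Y Y' y" for n Y
  proof (cases "Y \<in> Ob")
    case True
    show ?thesis
    proof (rule cell_attachment[OF True, of "int n"])
      fix Y' V y v w assume "tri Y Y' V y v w" "V \<in> cg {- (int n + 1)..int n + 1}"
        "\<And>j f. j \<in> {- int n..int n} \<Longrightarrow> f \<in> Hm (Sp j G) Y \<Longrightarrow> y \<cdot> f = zer (Sp j G) Y'"
      hence "R n Y Y' y" unfolding R_def by blast
      thus ?thesis by blast
    qed
  qed auto
  hence "\<forall>n Y. \<exists>Y' y. Y \<in> Ob \<longrightarrow> R n Y Y' y" by blast
  then obtain N A where NA: "\<And>n Y. Y \<in> Ob \<Longrightarrow> R n Y (N n Y) (A n Y)" by metis
  define Y where "Y = rec_nat K (\<lambda>n Z. N n Z)"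
  define y where "y n = A n (Y n)" for n
  define c where "c = rec_nat (one K) (\<lambda>n f. y n \<cdot> f)"
  have Y0: "Y 0 = K" and YS: "Y (Suc n) = N n (Y n)" for n by (simp_all add: Y_def)
  have c0: "c 0 = one K" and cS: "c (Suc n) = y n \<cdot> c n" for n by (simp_all add: c_def)
  have Yo: "Y n \<in> Ob" for n
  proof (induction n)
    case 0 show ?case using Y0 Ko by simp
  next
    case (Suc n)
    show ?case using NA[OF Suc, of n] dist_triD(5) unfolding YS R_def by blast
  qed
  have Rn: "R n (Y n) (Y (Suc n)) (y n)" for n using NA[OF Yo] YS y_def by simp
  have y: "y n \<in> Hm (Y n) (Y (Suc n))" for n using Rn[of n] dist_triD(1) unfolding R_def by blast
  have cH: "c n \<in> Hm K (Y n)" for n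
    by (induction n) (use c0 cS Y0 ident_hom[OF Ko] cmp_hom[OF _ y] in auto)
  \<comment> \<open>The octahedron on \<open>K -> Y n -> Y (Suc n)\<close> extends the cone at stage
    \<open>n\<close> by the newly attached cells, with exponents at most \<open>n + 1\<close> in
    absolute value.\<close>
  have cone: "\<exists>W v w. tri K (Y n) W (c n) v w \<and> W \<in> cg {- int n..int n}" for n
  proof (induction n)
    case 0
    obtain Z where Z: "zero_object T Z" using ex_zero_object by blast
    have "tri K (Y 0) Z (c 0) (zer K Z) (zer Z (Sh K))"
      using tri_ident[OF Ko Z] c0 Y0 by simp
    thus ?case using closed_zero[OF cg_closed Z] by blast
  next
    case (Suc n)
    then obtain W v w where W: "tri K (Y n) W (c n) v w" "W \<in> cg {- int n..int n}" by blast
    obtain V v' w' where V: "tri (Y n) (Y (Suc n)) V (y n) v' w'" "V \<in> cg {- (int n + 1)..int n + 1}"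
      using Rn[of n] unfolding R_def by blast
    obtain U k k' where U: "tri K (Y (Suc n)) U (c (Suc n)) k k'"
      using tri_complete[OF cH] by blast
    obtain f g where fg: "tri W U V f g (Sa v \<cdot> w')"
      using octahedral[OF W(1) V(1) U[unfolded cS]] by blast
    have "ext T W U V" using fg unfolding ext_def by blast
    moreover have "W \<in> cg {- (int n + 1)..int n + 1}"
      using W(2) cg_mono[of "{- int n..int n}" "{- (int n + 1)..int n + 1}"] by auto
    ultimately have "U \<in> cg {- (int n + 1)..int n + 1}" using closed_ext[OF cg_closed] V(2) by blast
    moreover have "{- (int n + 1)..int n + 1} = {- int (Suc n)..int (Suc n)}" by auto
    ultimately show ?case using U by metis
  qed
  obtain P \<iota> p s where tel: "telescope T \<kappa> Y y P \<iota> p s" using telescope_exists[where Y = Y and y = y, OF y] .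
  interpret telescope T \<kappa> Y y P \<iota> p s by (rule tel)
  obtain H v w where H: "tri P P H d v w" using tri_complete[OF d] by blast
  \<comment> \<open>The last of these \<open>Suc k\<close> steps takes place at stage
    \<open>n + k\<close>, where all exponents up to \<open>n + k\<close> in absolute value are
    killed.\<close>
  have van: "transport T y (Suc k) n f = zer (Sp j G) (Y (n + Suc k))"
    if "f \<in> Hm (Sp j G) (Y n)" "\<bar>j\<bar> \<le> int (n + k)" for j k n f
    using that
  proof (induction k arbitrary: n f)
    case 0
    hence "j \<in> {- int n..int n}" by auto
    thus ?case using Rn[of n] 0(1) unfolding R_def by simp
  next
    case (Suc k)
    have "transport T y (Suc k) (Suc n) (y n \<cdot> f) = zer (Sp j G) (Y (Suc n + Suc k))"
      by (rule Suc.IH) (use cmp_hom[OF Suc.prems(1) y] Suc.prems(2) in auto)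
    thus ?case by simp
  qed
  have "orth T (Sp j G) H" for j
  proof (rule cone_orth[OF H shift_compact[OF G_compact] shift_compact[OF G_compact] shift_pow_pred[OF G_obj]])
    show "\<exists>k. transport T y k n f = zer (Sp j G) (Y (n + k))"
      if "f \<in> Hm (Sp j G) (Y n)" for n f
      using van[OF that, of "nat \<bar>j\<bar>"] by (intro exI[of _ "Suc (nat \<bar>j\<bar>)"]) auto
  qed
  hence Hz: "zero_object T H" using generation[OF dist_triD(6)[OF H]] by blast
  obtain n where n: "c n = zer K (Y n)" using vanishing_stage[OF K Y0 c0 cS H Hz] by blast
  obtain W v w where W: "tri K (Y n) W (zer K (Y n)) v w" "W \<in> cg {- int n..int n}"
    using cone[of n] n by auto
  \<comment> \<open>A triangle on the zero map \<open>K -> Y n\<close> lets the identity of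
    \<open>Sh K\<close> lift to \<open>W\<close>; thus the retract obtained is \<open>Sh K\<close>,
    and a general compact object is treated through its desuspension.\<close>
  have "Sa (zer K (Y n)) \<cdot> one (Sh K) = zer (Sh K) (Sh (Y n))" using Ko by simp
  then obtain i where "i \<in> Hm (Sh K) W" "w \<cdot> i = one (Sh K)"
    using tri_factor_left3[OF W(1) ident_hom] Ko by auto
  thus ?thesis using that[OF W(2) _ dist_triD(3)[OF W(1)]] by blast
qed

section \<open>Bounds for compact objects\<close>

lemma compact_retract:
  assumes K: "K \<in> Tc"
  obtains n :: nat and W i r where "W \<in> cg {- int n..int n}"
    "i \<in> Hm K W" "r \<in> Hm W K" "r \<cdot> i = one K"
proof -
  obtain K' where K': "K' \<in> Tc" "isom K (Sh K')"
    using tri_sub_desusp[OF compact_triangulated K] .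
  then obtain a b where ab: "a \<in> Hm K (Sh K')" "b \<in> Hm (Sh K') K" "b \<cdot> a = one K"
    unfolding isomorphic_def is_iso_def by blast
  obtain n W i r where W: "W \<in> cg {- int n..int n}" "i \<in> Hm (Sh K') W" "r \<in> Hm W (Sh K')"
    "r \<cdot> i = one (Sh K')" using Sh_compact_retract[OF K'(1)] .
  have "(b \<cdot> r) \<cdot> (i \<cdot> a) = one K"
    using cmp_cong[OF W(4), of a] W(2,3) ab by (simp add: Hom_def)
  thus ?thesis using that[OF W(1) cmp_hom[OF ab(1) W(2)] cmp_hom[OF W(3) ab(2)]] by blast
qed

text \<open>Enlarging the range to a half-line makes the class stable under the shift, as
  \<open>closed_retract\<close> demands.\<close>

lemma compact_bounded_above:
  assumes K: "K \<in> Tc"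
  obtains n :: int where "K \<in> cg {- n..}"
proof -
  obtain n W i r where W: "W \<in> cg {- int n..int n}" "i \<in> Hm K W" "r \<in> Hm W K" "r \<cdot> i = one K"
    using compact_retract[OF K] .
  have "W \<in> cg {- int n..}" using W(1) cg_mono[of "{- int n..int n}" "{- int n..}"] by auto
  moreover have "Sh X \<in> cg {- int n..}" if "X \<in> cg {- int n..}" for X by (rule cg_Sh[OF that]) simp
  ultimately have "K \<in> cg {- int n..}" using closed_retract[OF cg_closed _ _ W(2-4)] by blast
  thus ?thesis using that by blast
qed

lemma compact_orth_shifts:
  assumes K: "K \<in> Tc" and F: "F \<in> Ob"
    and N: "\<And>i. i \<ge> N \<Longrightarrow> orth T (Sp i G) F"
  obtains M :: int where "\<And>i. i \<ge> M \<Longrightarrow> orth T (Sp i K) F"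
proof -
  obtain n W i r where W: "W \<in> cg {- int n..int n}" "i \<in> Hm K W" "r \<in> Hm W K" "r \<cdot> i = one K"
    using compact_retract[OF K] .
  \<comment> \<open>Exponents in \<open>W\<close> are at least \<open>- n\<close>, so after shifting
    by \<open>k\<close> they are at least \<open>N\<close>.\<close>
  have "orth T (Sp k K) F" if k: "k \<ge> N + int n" for k
  proof -
    have Fk: "Sp (- k) F \<in> Ob" using F by simp
    have "(\<lambda>i. Sp i G) ` {- int n..int n} \<subseteq> {X \<in> Ob. orth T X (Sp (- k) F)}"
      using N orth_shift_pow(1)[OF G_obj F] k by auto
    hence "W \<in> {X \<in> Ob. orth T X (Sp (- k) F)}"
      using Coprod_least[OF closed_left_orth[OF Fk]] W(1) by blast
    hence "orth T K (Sp (- k) F)" using orth_retract_left[OF _ W(2-4) Fk] by blast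
    thus ?thesis using orth_shift_pow(2)[OF compact_obj[OF K] F] by blast
  qed
  thus ?thesis using that by blast
qed

text \<open>The vanishing of \<open>Hom(\<Sigma>^(-i) G, G)\<close> for large \<open>i\<close>
  enters here. It spreads in the first variable from shifts of \<open>G\<close> to the retract
  \<open>K\<close>, and then in the second variable, by compactness of \<open>K\<close>, to
  everything generated by deep shifts.\<close>

lemma compact_orth_below:
  assumes K: "K \<in> Tc"
    and N: "\<And>i. i \<ge> N \<Longrightarrow> orth T (Sp (- i) G) G"
  obtains M :: int where "\<And>m X. m \<ge> M \<Longrightarrow> X \<in> cg {m..} \<Longrightarrow> orth T K X"
proof -
  obtain n W i r where W: "W \<in> cg {- int n..int n}" "i \<in> Hm K W" "r \<in> Hm W K" "r \<cdot> i = one K"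
    using compact_retract[OF K] .
  have *: "orth T K (Sp k G)" if k: "k \<ge> N + int n" for k
  proof -
    have Gk: "Sp k G \<in> Ob" by simp
    have "(\<lambda>i. Sp i G) ` {- int n..int n} \<subseteq> {X \<in> Ob. orth T X (Sp k G)}"
    proof
      fix X assume "X \<in> (\<lambda>i. Sp i G) ` {- int n..int n}"
      then obtain j where j: "j \<in> {- int n..int n}" "X = Sp j G" by blast
      have "orth T (Sp (- (k - j)) G) G" using N[of "k - j"] j k by auto
      thus "X \<in> {X \<in> Ob. orth T X (Sp k G)}"
        using orth_shift_pow(1)[OF G_obj G_obj, of j k] j by simp
    qed
    hence "W \<in> {X \<in> Ob. orth T X (Sp k G)}"
      using Coprod_least[OF closed_left_orth[OF Gk]] W(1) by blast
    thus ?thesis using orth_retract_left[OF _ W(2-4) Gk] by blast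
  qed
  have "orth T K X" if "m \<ge> N + int n" "X \<in> cg {m..}" for m X
  proof -
    have "(\<lambda>i. Sp i G) ` {m..} \<subseteq> {Y \<in> Ob. orth T K Y}" using * that(1) by auto
    thus ?thesis using Coprod_least[OF closed_right_orth[OF K]] that(2) by blast
  qed
  thus ?thesis using that by blast
qed

text \<open>Shifting commutes with generation, so every shifted aisle is again a
  \<open>Coprod\<close> of shifts of \<open>G\<close>, with the exponents moved.\<close>

lemma aisle_eq: "aisle \<kappa> T G m = cg {- m..}"
proof
  have e: "{Sp i G |i. 0 \<le> i} = (\<lambda>i. Sp i G) ` {0..}" by auto
  show "aisle \<kappa> T G m \<subseteq> cg {- m..}"
  proof
    fix X assume "X \<in> aisle \<kappa> T G m"
    then obtain Y where Y: "Y \<in> cg {0..}" "isom X (Sp (- m) Y)"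
      unfolding aisle_def e by blast
    have "Sp (- m) Y \<in> cg {- m..}" by (rule cg_shift_pow[OF Y(1)]) auto
    thus "X \<in> cg {- m..}" using closed_iso[OF cg_closed isomorphic_sym[OF Y(2)]] by blast
  qed
  show "cg {- m..} \<subseteq> aisle \<kappa> T G m"
  proof
    fix X assume X: "X \<in> cg {- m..}"
    have "Sp m X \<in> cg {0..}" by (rule cg_shift_pow[OF X]) auto
    moreover have "isom X (Sp (- m) (Sp m X))"
      using isomorphic_sym[OF shift_pow_minus(1)[OF cg_obj[OF X]]] .
    ultimately show "X \<in> aisle \<kappa> T G m" using cg_obj[OF X] unfolding aisle_def e by blast
  qed
qed

end

subsection \<open>Restriction to bounded objects\<close>

context triangulated_category begin

lemma orth_ext_fibre:
  assumes "ext T X Y Z" "orth T Q Y" "orth T (Sh Q) Z" "Q \<in> Ob"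
  shows "orth T Q X"
proof -
  note o = extD[OF assms(1)]
  have "orth T (Sh Q) (Sh Y)" using Sh_orth_iff assms(2,4) o by simp
  hence "orth T (Sh Q) (Sh X)"
    using orth_ext_right[OF ext_rotate[OF ext_rotate[OF assms(1)]] assms(3)] assms(4) by simp
  thus ?thesis using Sh_orth_iff assms(4) o by simp
qed

lemma full_semiorthogonal_decomposition:
  assumes D: "tri_sub D"
    and A: "tri_sub A" and B: "tri_sub B"
    and o: "\<And>X Y. X \<in> B \<Longrightarrow> Y \<in> A \<Longrightarrow> orth T X Y"
    and dec: "\<And>F. F \<in> D \<Longrightarrow> \<exists>b\<in>B \<inter> D. \<exists>a\<in>A \<inter> D. ext T b F a"
  shows "semiorthogonal_decomposition (full_subcategory T D) (A \<inter> D) (B \<inter> D)"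
proof -
  interpret S: triangulated_category "full_subcategory T D"
    by (rule full_subcategory_triangulated[OF D])
  show ?thesis
  proof (rule S.semiorthogonal_decompositionI[OF full_tri_sub_Int[OF D A] full_tri_sub_Int[OF D B]])
    show "orth (full_subcategory T D) X Y" if "X \<in> B \<inter> D" "Y \<in> A \<inter> D" for X Y
      using o that by (simp add: orth_full)
    show "\<exists>b\<in>B \<inter> D. \<exists>a\<in>A \<inter> D. ext (full_subcategory T D) b F a"
      if F: "F \<in> Obj (full_subcategory T D)" for F
    proof -
      have FD: "F \<in> D" using F by simp
      obtain b a where ba: "b \<in> B \<inter> D" "a \<in> A \<inter> D" "ext T b F a" using dec[OF FD] by blast
      have "Sh b \<in> D" using ba(1) tri_sub_Sh[OF D tri_sub_obj[OF D]] by blast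
      thus ?thesis using ba FD by (auto simp: ext_full)
    qed
  qed
qed

text \<open>\<open>C\<close> is the fibre of the unit \<open>\<eta> : X -> L\<close>. Precomposition
  with \<open>\<eta>\<close> is bijective on maps into each object of \<open>B\<close>; for a target
  \<open>Y\<close>, surjectivity at \<open>Y\<close> and injectivity at \<open>Sh Y\<close> leave no
  maps from \<open>C\<close>.\<close>

lemma left_adjoint_fibre:
  assumes D: "tri_sub D" and B: "tri_sub B" and BD: "B \<subseteq> D"
    and adj: "has_left_adjoint (full_subcategory (full_subcategory T D) B) (full_subcategory T D) id id"
    and X: "X \<in> D"
  obtains C L where "ext T C X L" "L \<in> B" "\<And>Y. Y \<in> B \<Longrightarrow> orth T C Y"
proof -
  let ?S = "full_subcategory T D" and ?B = "full_subcategory (full_subcategory T D) B"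
  obtain Lo La where a: "adjunction ?S ?B Lo La id id" using adj unfolding has_left_adjoint_def by blast
  then obtain \<phi> where bij: "\<forall>X \<in> Obj ?S. \<forall>Y \<in> Obj ?B. bij_betw (\<phi> X Y) (Hom ?B (Lo X) Y) (Hom ?S X (id Y))"
    and nat: "\<forall>X X' Y Y' f g h. f \<in> Hom ?S X' X \<and> g \<in> Hom ?B Y Y' \<and> h \<in> Hom ?B (Lo X) Y \<longrightarrow>
             \<phi> X' Y' (g \<cdot>\<^bsub>?B\<^esub> h \<cdot>\<^bsub>?B\<^esub> La f) = id g \<cdot>\<^bsub>?S\<^esub> \<phi> X Y h \<cdot>\<^bsub>?S\<^esub> f"
    and fL: "is_functor ?S ?B Lo La"
    unfolding adjunction_def by blast
  let ?L = "Lo X"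
  have L: "?L \<in> B" "La (one X) = one ?L" using fL X unfolding is_functor_def by simp_all
  have Xo: "X \<in> Ob" and Lo: "?L \<in> Ob" using tri_sub_obj[OF D X] tri_sub_obj[OF B L(1)] .
  have HomB: "Hom ?B ?L Y = Hm ?L Y" if "Y \<in> B" for Y
    using that L(1) BD by (auto simp: Hom_full)
  have HomS: "Hom ?S X Y = Hm X Y" if "Y \<in> B" for Y
    using that X BD by (auto simp: Hom_full)
  define \<eta> where "\<eta> = \<phi> X ?L (one ?L)"
  have b: "bij_betw (\<phi> X Y) (Hm ?L Y) (Hm X Y)" if "Y \<in> B" for Y
    using bij[rule_format, of X Y] that X unfolding HomB[OF that] by (simp add: HomS)
  have \<eta>: "\<eta> \<in> Hm X ?L"
    unfolding \<eta>_def using bij_betw_apply[OF b[OF L(1)] ident_hom[OF Lo]] .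
  \<comment> \<open>Naturality evaluated at the identity of \<open>L\<close>, as in the Yoneda
    lemma, turns the abstract bijection into precomposition with \<open>\<eta>\<close>.\<close>
  have \<phi>: "\<phi> X Y h = h \<cdot> \<eta>" if Y: "Y \<in> B" and h: "h \<in> Hm ?L Y" for Y h
  proof -
    have "one X \<in> Hom ?S X X" "h \<in> Hom ?B ?L Y" "one ?L \<in> Hom ?B ?L ?L"
      using X h HomB[OF Y] HomB[OF L(1)] ident_hom[OF Xo] ident_hom[OF Lo] by (simp_all add: Hom_full)
    hence "\<phi> X Y (h \<cdot> (one ?L \<cdot> La (one X))) = h \<cdot> (\<eta> \<cdot> one X)"
      using nat unfolding \<eta>_def by fastforce
    thus ?thesis using h \<eta> L Lo by (simp add: Hom_def)
  qed
  have inj: "h = h'" if "Y \<in> B" "h \<in> Hm ?L Y" "h' \<in> Hm ?L Y" "h \<cdot> \<eta> = h' \<cdot> \<eta>" for Y h h'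
    using b[OF that(1)] that \<phi> unfolding bij_betw_def inj_on_def by metis
  have surj: "\<exists>h \<in> Hm ?L Y. h \<cdot> \<eta> = f" if "Y \<in> B" "f \<in> Hm X Y" for Y f
  proof -
    have "f \<in> \<phi> X Y ` Hm ?L Y" using bij_betw_imp_surj_on[OF b[OF that(1)]] that(2) by simp
    thus ?thesis using \<phi>[OF that(1)] by auto
  qed
  obtain C u w where t: "tri C X ?L u \<eta> w" using ext_exists_fibre[OF \<eta>] .
  note tD = dist_triD[OF t]
  have "orth T C Y" if Y: "Y \<in> B" for Y
  proof (rule orthI[OF tD(4)])
    show Yo: "Y \<in> Ob" using tri_sub_obj[OF B Y] .
    have SY: "Sh Y \<in> B" using tri_sub_Sh[OF B Yo] Y by simp
    fix g assume g: "g \<in> Hm C Y"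
    have sg: "Sa g \<in> Hm (Sh C) (Sh Y)" using shA_hom[OF g] .
    \<comment> \<open>Injectivity at \<open>Sh Y\<close> kills \<open>Sa g \<cdot> w\<close>, so
      \<open>g\<close> extends along \<open>u\<close> to \<open>X\<close>; the extension then
      factors through \<open>\<eta>\<close>, and \<open>\<eta> \<cdot> u = 0\<close>.\<close>
    have "(Sa g \<cdot> w) \<cdot> \<eta> = zer ?L (Sh Y) \<cdot> \<eta>"
      using tri_cmp_zero(2)[OF t] sg tD Yo by (simp add: Hom_def)
    hence "Sa g \<cdot> w = zer ?L (Sh Y)"
      using inj[OF SY cmp_hom[OF tD(3) sg] zero_hom] Lo Yo by simp
    then obtain h where h: "h \<in> Hm (Sh X) (Sh Y)" "h \<cdot> Sa u = Sa g"
      using tri_factor_right3[OF t sg] by blast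
    obtain h' where h': "h' \<in> Hm X Y" "Sa h' = h" using shA_full[OF h(1) Xo Yo] .
    have "Sa (h' \<cdot> u) = Sa g" using h h' tD by (simp add: Hom_def)
    hence g': "g = h' \<cdot> u" using shA_inj[OF cmp_hom[OF tD(1) h'(1)] g] by simp
    obtain k where k: "k \<in> Hm ?L Y" "k \<cdot> \<eta> = h'" using surj[OF Y h'(1)] by blast
    have "g = k \<cdot> (\<eta> \<cdot> u)" using g' k cmp_assoc[OF tD(1,2) k(1)] by simp
    thus "g = zer C Y" using tri_cmp_zero(1)[OF t] k(1) tD by (simp add: Hom_def)
  qed
  moreover have "ext T C X ?L" using t unfolding ext_def by blast
  ultimately show ?thesis using that L(1) by blast
qed

end

context compactly_generated begin

section \<open>The subcategories \<open>Tcm\<close> and \<open>Tcb\<close>\<close>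

lemma Tc_minus_iff:
  "F \<in> Tcm \<longleftrightarrow> F \<in> Ob \<and>
    (\<forall>n. \<exists>E D. ext T E F D \<and> E \<in> Tc \<and> D \<in> cg {n..})"
  unfolding Tc_minus_def aisle_eq ext_def by simp

lemma Tc_minusD:
  assumes "F \<in> Tcm"
  obtains E D where "ext T E F D" "E \<in> Tc" "D \<in> cg {n..}"
  using assms Tc_minus_iff by blast

lemma cg_atLeast_mono: "X \<in> cg {m..} \<Longrightarrow> n \<le> m \<Longrightarrow> X \<in> cg {n..}"
  using cg_mono[of "{m..}" "{n..}"] by auto

lemma cg_atLeast_Sh: "X \<in> cg {n..} \<Longrightarrow> Sh X \<in> cg {n..}"
  by (rule cg_Sh) auto

end

locale compactly_generated_bounded = compactly_generated T \<kappa> G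
  for T :: "('o, 'm, 'z) tcat_scheme" (structure) and \<kappa> :: "'u rel" and G +
  fixes N :: int
  assumes negative_orth: "i \<ge> N \<Longrightarrow> orth T (shift_pow T (- i) G) G"
begin

lemma Tc_minus_triangulated: "tri_sub (Tcm)"
proof (rule tri_subI)
  show "Tcm \<subseteq> Ob" using Tc_minus_iff by blast
  show "Z \<in> Tcm" if Z: "zero_object T Z" for Z
  proof -
    have Zo: "Z \<in> Ob" using Z zero_object_iff by blast
    show ?thesis unfolding Tc_minus_iff
      using ext_iso_zero(1)[OF isomorphic_refl[OF Zo] Z] tri_sub_zero[OF compact_triangulated Z]
        closed_zero[OF cg_closed Z] Zo by blast
  qed
  show "Y \<in> Tcm" if i: "isom X Y" and X: "X \<in> Tcm" for X Y
    unfolding Tc_minus_iff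
  proof (intro conjI allI)
    show "Y \<in> Ob" using isomorphic_obj[OF i] by simp
    fix n
    obtain E D where ED: "ext T E X D" "E \<in> Tc" "D \<in> cg {n..}" using Tc_minusD[OF X] .
    have "ext T E Y D" using ext_iso[OF ED(1) isomorphic_refl i isomorphic_refl] extD[OF ED(1)] by simp
    thus "\<exists>E D. ext T E Y D \<and> E \<in> Tc \<and> D \<in> cg {n..}" using ED by blast
  qed
  show "Sh X \<in> Tcm" if X: "X \<in> Tcm" for X
    unfolding Tc_minus_iff
  proof (intro conjI allI)
    show "Sh X \<in> Ob" using X Tc_minus_iff by simp
    fix n
    obtain E D where ED: "ext T E X D" "E \<in> Tc" "D \<in> cg {n..}" using Tc_minusD[OF X] .
    have "Sh E \<in> Tc" using tri_sub_Sh[OF compact_triangulated] extD[OF ED(1)] ED(2) by simp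
    thus "\<exists>E D. ext T E (Sh X) D \<and> E \<in> Tc \<and> D \<in> cg {n..}"
      using ext_Sh[OF ED(1)] cg_atLeast_Sh[OF ED(3)] by blast
  qed
  show "X \<in> Tcm" if Xo: "X \<in> Ob" and X: "Sh X \<in> Tcm" for X
    unfolding Tc_minus_iff
  proof (intro conjI allI)
    show "X \<in> Ob" using Xo .
    fix n
    \<comment> \<open>Depth \<open>n + 1\<close> compensates for the exponent lost when the
      remainder is desuspended.\<close>
    obtain E D where ED: "ext T E (Sh X) D" "E \<in> Tc" "D \<in> cg {n + 1..}" using Tc_minusD[OF X] .
    obtain E' where E': "E' \<in> Tc" "isom E (Sh E')" using tri_sub_desusp[OF compact_triangulated ED(2)] .
    have D': "Sp (- 1) D \<in> cg {n..}" by (rule cg_shift_pow[OF ED(3)]) auto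
    have "isom D (Sh (Sp (- 1) D))"
      using isomorphic_sym[OF shift_pow_pred[OF extD(3)[OF ED(1)], of 0]] by simp
    from ext_iso[OF ED(1) E'(2) isomorphic_refl this]
    have "ext T (Sh E') (Sh X) (Sh (Sp (- 1) D))" using Xo by simp
    hence "ext T E' X (Sp (- 1) D)"
      using ext_Sh_back compact_obj[OF E'(1)] Xo cg_obj[OF D'] by blast
    thus "\<exists>E D. ext T E X D \<and> E \<in> Tc \<and> D \<in> cg {n..}" using E' D' by blast
  qed
  show "Y \<in> Tcm" if t: "ext T X Y Z" and X: "X \<in> Tcm" and Z: "Z \<in> Tcm" for X Y Z
    unfolding Tc_minus_iff
  proof (intro conjI allI)
    show "Y \<in> Ob" using extD[OF t] by simp
    fix n
    obtain E' D' where Z': "ext T E' Z D'" "E' \<in> Tc" "D' \<in> cg {n..}" using Tc_minusD[OF Z] .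
    \<comment> \<open>The depth needed for \<open>X\<close> depends on the compact part
      \<open>E'\<close> of \<open>Z\<close>, so \<open>Z\<close> is approximated first. Then
      \<open>E'\<close> has no maps to \<open>Sh D\<close>, and the two approximations can be
      interchanged.\<close>
    obtain M where M: "\<And>m X. m \<ge> M \<Longrightarrow> X \<in> cg {m..} \<Longrightarrow> orth T E' X"
      using compact_orth_below[OF Z'(2) negative_orth] by blast
    obtain E D where X': "ext T E X D" "E \<in> Tc" "D \<in> cg {max n M..}" using Tc_minusD[OF X] .
    have "orth T E' (Sh D)" using M[OF _ cg_atLeast_Sh[OF X'(3)]] by simp
    from ext_interchange[OF t X'(1) Z'(1) this] obtain E'' D''
      where r: "ext T E E'' E'" "ext T E'' Y D''" "ext T D D'' D'" .
    have "E'' \<in> Tc" using tri_sub_ext(1)[OF compact_triangulated r(1)] X' Z' by blast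
    moreover have "D'' \<in> cg {n..}"
      using closed_ext[OF cg_closed r(3) cg_atLeast_mono[OF X'(3)] Z'(3)] by simp
    ultimately show "\<exists>E D. ext T E Y D \<and> E \<in> Tc \<and> D \<in> cg {n..}" using r by blast
  qed
qed

lemma Tc_bounded_eq:
  "Tcb = {F \<in> Tcm. \<exists>N :: int. \<forall>i\<ge>N. orth T (Sp i G) F}"
  unfolding Tc_bounded_def orth_def ..

lemma Tc_bounded_triangulated: "tri_sub (Tcb)"
proof (rule tri_subI)
  note m = Tc_minus_triangulated
  show "Tcb \<subseteq> Ob" unfolding Tc_bounded_eq using tri_sub_obj[OF m] by blast
  show "Z \<in> Tcb" if Z: "zero_object T Z" for Z
  proof -
    have "orth T (Sp i G) Z" for i
      using orthI[OF _ _ zero_object_Hom(1)[OF Z]] Z zero_object_iff by simp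
    thus ?thesis using tri_sub_zero[OF m Z] unfolding Tc_bounded_eq by blast
  qed
  show "Y \<in> Tcb" if i: "isom X Y" and X: "X \<in> Tcb" for X Y
  proof -
    have "orth T (Sp i G) X \<Longrightarrow> orth T (Sp i G) Y" for i
      using orth_iso[OF _ isomorphic_refl \<open>isom X Y\<close>] by simp
    thus ?thesis using X tri_sub_iso[OF m i] unfolding Tc_bounded_eq by blast
  qed
  have s: "orth T (Sp i G) (Sh X) \<longleftrightarrow> orth T (Sp (i - 1) G) X" if "X \<in> Ob" for i X
    using orth_shift_pow(1)[OF G_obj that, of i 1] by (simp add: shift_pow_def[of T 1 X])
  show "Sh X \<in> Tcb" if X: "X \<in> Tcb" for X
  proof -
    obtain M where M: "\<forall>i\<ge>M. orth T (Sp i G) X" and Xm: "X \<in> Tcm"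
      using X unfolding Tc_bounded_eq by blast
    have Xo: "X \<in> Ob" using tri_sub_obj[OF m Xm] .
    have "\<forall>i\<ge>M + 1. orth T (Sp i G) (Sh X)" using M s[OF Xo] by simp
    thus ?thesis using Xm tri_sub_Sh[OF m Xo] unfolding Tc_bounded_eq by blast
  qed
  show "X \<in> Tcb" if Xo: "X \<in> Ob" and X: "Sh X \<in> Tcb" for X
  proof -
    obtain M where M: "\<forall>i\<ge>M. orth T (Sp i G) (Sh X)" and Xm: "Sh X \<in> Tcm"
      using X unfolding Tc_bounded_eq by blast
    have "orth T (Sp i G) X" if "i \<ge> M" for i using M s[OF Xo, of "i + 1"] that by simp
    thus ?thesis using Xm tri_sub_Sh[OF m Xo] unfolding Tc_bounded_eq by blast
  qed
  show "Y \<in> Tcb" if t: "ext T X Y Z" and X: "X \<in> Tcb" and Z: "Z \<in> Tcb" for X Y Z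
  proof -
    obtain M M' where M: "\<forall>i\<ge>M. orth T (Sp i G) X" "\<forall>i\<ge>M'. orth T (Sp i G) Z"
      and XZ: "X \<in> Tcm" "Z \<in> Tcm"
      using X Z unfolding Tc_bounded_eq by blast
    have "\<forall>i\<ge>max M M'. orth T (Sp i G) Y" using M orth_ext_right[OF t] by simp
    thus ?thesis using tri_sub_ext(1)[OF m t XZ] unfolding Tc_bounded_eq by blast
  qed
qed

end

locale compactly_generated_decomposed = compactly_generated_bounded T \<kappa> G N
  for T :: "('o, 'm, 'z) tcat_scheme" (structure) and \<kappa> :: "'u rel" and G N +
  fixes A B :: "'o set"
  assumes A: "triangulated_subcategory T A" and B: "triangulated_subcategory T B"
    and A_compact: "A \<subseteq> compact_objects \<kappa> T" and B_compact: "B \<subseteq> compact_objects \<kappa> T"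
    and orth_BA: "b \<in> B \<Longrightarrow> a \<in> A \<Longrightarrow> orth T b a"
    and compact_decomposition: "K \<in> compact_objects \<kappa> T \<Longrightarrow> \<exists>b\<in>B. \<exists>a\<in>A. ext T b K a"
begin

abbreviation "CA \<equiv> Coprod \<kappa> T A"
abbreviation "CB \<equiv> Coprod \<kappa> T B"

section \<open>Decomposition of the objects of \<open>Tcm\<close> and \<open>Tcb\<close>\<close>

lemma CA: "tri_sub CA" and CB: "tri_sub CB"
  using Coprod_triangulated A B by blast+

lemma CA_closed: "closed CA" and CB_closed: "closed CB"
  using Coprod_closed tri_sub_obj[OF A] tri_sub_obj[OF B] by blast+

lemma orth_compact_Coprod:
  assumes K: "K \<in> Tc" and "\<And>c. c \<in> C \<Longrightarrow> orth T K c" and "C \<subseteq> Ob" and "Y \<in> Cop C"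
  shows "orth T K Y"
  using Coprod_least[OF closed_right_orth[OF K], of C] assms by blast

text \<open>The second variable is enlarged first, while the first is still compact, since passing
  to coproducts in the target needs compactness; enlarging the first variable is then
  formal.\<close>

lemma orth_CB_CA:
  assumes X: "X \<in> CB" and Y: "Y \<in> CA"
  shows "orth T X Y"
proof -
  have Yo: "Y \<in> Ob" using closed_obj[OF CA_closed Y] .
  have "orth T b Y" if "b \<in> B" for b
    using orth_compact_Coprod[OF _ orth_BA[OF that] _ Y] B_compact that tri_sub_obj[OF A] by blast
  thus ?thesis
    using Coprod_least[OF closed_left_orth[OF Yo], of B] X tri_sub_obj[OF B] by blast
qed

lemma orth_CB_Sh_CA: "X \<in> CB \<Longrightarrow> Y \<in> CA \<Longrightarrow> orth T X (Sh Y)"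
  using orth_CB_CA tri_sub_Sh[OF CA tri_sub_obj[OF CA]] by blast

text \<open>The parts of \<open>G\<close> are compact, so they lie in \<open>cg {- p..}\<close> and
  \<open>cg {- q..}\<close>. Decomposing a shift of \<open>G\<close> therefore loses at most
  \<open>max p q\<close>, and \<open>closed_star\<close> spreads this bound to all generated
  objects.\<close>

lemma cg_decomposition:
  obtains c :: int where "\<And>n D. D \<in> cg {n + c..} \<Longrightarrow> \<exists>b\<in>CB \<inter> cg {n..}. \<exists>a\<in>CA \<inter> cg {n..}. ext T b D a"
proof -
  obtain b a where ba: "b \<in> B" "a \<in> A" "ext T b G a" using compact_decomposition[OF G_compact] by blast
  have "b \<in> Tc" "a \<in> Tc" using ba A_compact B_compact by blast+
  then obtain p q where "b \<in> cg {- p..}" "a \<in> cg {- q..}" using compact_bounded_above by metis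
  hence pq: "b \<in> cg {- max p q..}" "a \<in> cg {- max p q..}" using cg_atLeast_mono by simp_all
  have "\<exists>b\<in>CB \<inter> cg {n..}. \<exists>a\<in>CA \<inter> cg {n..}. ext T b D a" if D: "D \<in> cg {n + max p q..}" for n D
  proof -
    let ?S = "{F. \<exists>b\<in>CB \<inter> cg {n..}. \<exists>a\<in>CA \<inter> cg {n..}. ext T b F a}"
    have S: "closed ?S"
      by (rule closed_star) (use closed_Int CA_closed CB_closed cg_closed orth_CB_Sh_CA in blast)+
    have "(\<lambda>i. Sp i G) ` {n + max p q..} \<subseteq> ?S"
    proof
      fix X assume "X \<in> (\<lambda>i. Sp i G) ` {n + max p q..}"
      then obtain i where i: "i \<ge> n + max p q" "X = Sp i G" by auto
      have "Sp i b \<in> cg {n..}" "Sp i a \<in> cg {n..}"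
        using cg_shift_pow[OF pq(1), of i "{n..}"] cg_shift_pow[OF pq(2), of i "{n..}"] i by auto
      moreover have "Sp i b \<in> CB" "Sp i a \<in> CA"
        using tri_sub_shift_pow[OF B] tri_sub_shift_pow[OF A] ba extD[OF ba(3)] Coprod_incl by blast+
      ultimately show "X \<in> ?S" using ext_shift_pow[OF ba(3), of i] i(2) by blast
    qed
    thus ?thesis using Coprod_least[OF S] D by blast
  qed
  thus ?thesis using that by blast
qed

lemma Tc_minus_decomposition:
  assumes F: "F \<in> Tcm"
  shows "\<exists>b\<in>CB \<inter> Tcm. \<exists>a\<in>CA \<inter> Tcm. ext T b F a"
proof -
  have *: "\<exists>b\<in>CB. \<exists>a\<in>CA. ext T b F a \<and> (\<exists>E D. ext T E b D \<and> E \<in> Tc \<and> D \<in> cg {n..}) \<and>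
    (\<exists>E D. ext T E a D \<and> E \<in> Tc \<and> D \<in> cg {n..})" for n
  proof -
    obtain c where c: "\<And>n D. D \<in> cg {n + c..} \<Longrightarrow> \<exists>b\<in>CB \<inter> cg {n..}. \<exists>a\<in>CA \<inter> cg {n..}. ext T b D a"
      using cg_decomposition by blast
    obtain E D where ED: "ext T E F D" "E \<in> Tc" "D \<in> cg {n + c..}" using Tc_minusD[OF F] .
    obtain b a where ba: "b \<in> B" "a \<in> A" "ext T b E a" using compact_decomposition[OF ED(2)] by blast
    obtain b' a' where ba': "b' \<in> CB" "b' \<in> cg {n..}" "a' \<in> CA" "a' \<in> cg {n..}" "ext T b' D a'"
      using c[OF ED(3)] by blast
    have baC: "b \<in> CB" "a \<in> CA" using ba Coprod_incl by blast+
    \<comment> \<open>The resulting triangles \<open>b -> b'' -> b'\<close> and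
      \<open>a -> a'' -> a'\<close> serve twice: they put \<open>b''\<close> and \<open>a''\<close>
      into \<open>CB\<close> and \<open>CA\<close>, and they approximate them by the compact
      \<open>b\<close> and \<open>a\<close> with remainders in \<open>cg {n..}\<close>.\<close>
    from ext_interchange[OF ED(1) ba(3) ba'(5) orth_CB_Sh_CA[OF ba'(1) baC(2)]]
    obtain b'' a'' where r: "ext T b b'' b'" "ext T b'' F a''" "ext T a a'' a'" .
    have "b'' \<in> CB" "a'' \<in> CA"
      using closed_ext[OF CB_closed r(1)] closed_ext[OF CA_closed r(3)] baC ba' by blast+
    moreover have "b \<in> Tc" "a \<in> Tc" using ba A_compact B_compact by blast+
    ultimately show ?thesis using r ba' by blast
  qed
  \<comment> \<open>Depth 0 merely fixes one decomposition; those found at other depths are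
    isomorphic to it, so their approximations transfer.\<close>
  obtain b a where ba: "b \<in> CB" "a \<in> CA" "ext T b F a" using *[of 0] by blast
  have Sh: "Sh X \<in> CB" if "X \<in> CB" for X using that tri_sub_Sh[OF CB tri_sub_obj[OF CB that]] by simp
  have "(\<exists>E D. ext T E b D \<and> E \<in> Tc \<and> D \<in> cg {n..}) \<and> (\<exists>E D. ext T E a D \<and> E \<in> Tc \<and> D \<in> cg {n..})" for n
  proof -
    obtain b' a' E D E' D' where r: "b' \<in> CB" "a' \<in> CA" "ext T b' F a'"
      "ext T E b' D" "E \<in> Tc" "D \<in> cg {n..}" "ext T E' a' D'" "E' \<in> Tc" "D' \<in> cg {n..}"
      using *[of n] by blast
    have "isom b' b" "isom a' a"
      using decomposition_unique[OF r(3) ba(3)] orth_CB_CA r ba Sh by blast+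
    hence "ext T E b D" "ext T E' a D'"
      using ext_iso[OF r(4) isomorphic_refl _ isomorphic_refl] ext_iso[OF r(7) isomorphic_refl _ isomorphic_refl]
        extD[OF r(4)] extD[OF r(7)] by simp_all
    thus ?thesis using r by blast
  qed
  hence "b \<in> Tcm" "a \<in> Tcm" unfolding Tc_minus_iff using extD[OF ba(3)] by blast+
  thus ?thesis using ba by blast
qed

lemma Tc_bounded_decomposition:
  assumes adj: "has_left_adjoint (full_subcategory (full_subcategory T (Tc)) B)
      (full_subcategory T (Tc)) id id"
    and F: "F \<in> Tcb"
  shows "\<exists>b\<in>CB \<inter> Tcb. \<exists>a\<in>CA \<inter> Tcb. ext T b F a"
proof -
  obtain M where Fm: "F \<in> Tcm" and M: "\<And>i. i \<ge> M \<Longrightarrow> orth T (Sp i G) F"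
    using F unfolding Tc_bounded_eq by blast
  obtain b a where ba: "b \<in> CB" "b \<in> Tcm" "a \<in> CA" "ext T b F a"
    using Tc_minus_decomposition[OF Fm] by blast
  obtain C L where CL: "ext T C G L" "L \<in> B" "\<And>Y. Y \<in> B \<Longrightarrow> orth T C Y"
    using left_adjoint_fibre[OF compact_triangulated B B_compact adj G_compact] by blast
  have Lc: "L \<in> Tc" using CL(2) B_compact by blast
  have Cc: "C \<in> Tc" using tri_sub_ext(2)[OF compact_triangulated CL(1) G_compact Lc] .
  note o = extD[OF CL(1)] extD[OF ba(4)]
  obtain M' where M': "\<And>i. i \<ge> M' \<Longrightarrow> orth T (Sp i L) F"
    using compact_orth_shifts[OF Lc o(5) M] by blast
  have "orth T (Sp i G) b" if i: "i \<ge> M'" for i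
  proof (rule orth_ext_left[OF ext_shift_pow[OF CL(1)] _ _ o(4)])
    have "Sp (- i) b \<in> CB" using tri_sub_shift_pow[OF CB o(4)] ba(1) by simp
    hence "orth T C (Sp (- i) b)"
      using orth_compact_Coprod[OF Cc CL(3)] tri_sub_obj[OF B] by blast
    thus "orth T (Sp i C) b" using orth_shift_pow(2)[OF o(1) o(4)] by simp
    \<comment> \<open>A map from \<open>Sp i L\<close> to \<open>b\<close> that dies in
      \<open>F\<close> comes from the desuspension of \<open>a\<close>, so orthogonality to
      \<open>a\<close> is needed for the shift of \<open>Sp i L\<close>.\<close>
    have "Sh (Sp i L) \<in> B" using tri_sub_Sh[OF B] tri_sub_shift_pow[OF B] o(3) CL(2) by simp
    hence "orth T (Sh (Sp i L)) a" using orth_CB_CA ba(3) Coprod_incl by blast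
    thus "orth T (Sp i L) b" using orth_ext_fibre[OF ba(4) M'[OF i]] o(3) by simp
  qed
  hence bb: "b \<in> Tcb" using ba(2) unfolding Tc_bounded_eq by blast
  hence "a \<in> Tcb" using tri_sub_cone[OF Tc_bounded_triangulated ba(4) _ F] by blast
  thus ?thesis using ba bb by blast
qed

end

theorem theorem2:
  fixes \<kappa> :: "'u rel" and T :: "('o, 'm) tcat" and G :: 'o and A B :: "'o set"
  assumes "smallness_cardinal \<kappa>"
    and "compactly_generated_by \<kappa> T {G}"
    and "\<exists>N :: int. \<forall>i \<ge> N. Hom T (shift_pow T (- i) G) G = {hzero T (shift_pow T (- i) G) G}"
    and "semiorthogonal_decomposition (full_subcategory T (compact_objects \<kappa> T)) A B"
  shows "semiorthogonal_decomposition (full_subcategory T (Tc_minus \<kappa> T G))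
           (Coprod \<kappa> T A \<inter> Tc_minus \<kappa> T G) (Coprod \<kappa> T B \<inter> Tc_minus \<kappa> T G) \<and>
         (admissible (full_subcategory T (compact_objects \<kappa> T)) B \<longrightarrow>
           semiorthogonal_decomposition (full_subcategory T (Tc_bounded \<kappa> T G))
             (Coprod \<kappa> T A \<inter> Tc_bounded \<kappa> T G) (Coprod \<kappa> T B \<inter> Tc_bounded \<kappa> T G))"
proof -
  let ?c = "compact_objects \<kappa> T"
  note sod = semiorthogonal_decompositionD[OF assms(4)]
  interpret triangulated_category T using assms(2) by (simp add: compactly_generated_by_def)
  interpret coproduct_triangulated T \<kappa>
    by unfold_locales (use assms(1,2) in \<open>auto simp: compactly_generated_by_def\<close>)
  \<comment> \<open>A semiorthogonal decomposition presupposes that the full subcategory of compact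
    objects is triangulated; together with repleteness this yields closure inside
    \<open>T\<close>.\<close>
  have c: "triangulated_subcategory T ?c"
    by (rule tri_sub_of_full[OF _ sod(1)]) (use compact_obj compact_iso isomorphic_sym in blast)+
  have AB: "A \<subseteq> ?c" "B \<subseteq> ?c" using sod(2,3) unfolding triangulated_subcategory_def by auto
  obtain N :: int where N: "\<And>i. i \<ge> N \<Longrightarrow> orth T (shift_pow T (- i) G) G"
    using assms(3) unfolding orth_def by blast
  interpret compactly_generated T \<kappa> G by unfold_locales (fact assms(2), fact c)
  interpret compactly_generated_decomposed T \<kappa> G N A B
  proof unfold_locales
    show "triangulated_subcategory T A" "triangulated_subcategory T B"
      using tri_sub_trans[OF c] sod(2,3) by blast+
    show "orth T b a" if "b \<in> B" "a \<in> A" for a b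
      using sod(4)[OF that] orth_full[of b ?c a T] AB that by blast
    show "\<exists>b\<in>B. \<exists>a\<in>A. ext T b K a" if "K \<in> ?c" for K
      using sod(5)[of K] that by (auto simp: ext_full)
  qed (use N AB in auto)
  show ?thesis
    using full_semiorthogonal_decomposition[OF Tc_minus_triangulated CA CB orth_CB_CA Tc_minus_decomposition]
      full_semiorthogonal_decomposition[OF Tc_bounded_triangulated CA CB orth_CB_CA Tc_bounded_decomposition]
    unfolding admissible_def by blast
qed

end
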